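(* Let $r\ge 1$ and let $G\subset \mathbb{Z}_2^r$ be a subgroup containing $1^r=(1,\dots,1)$. Then $S_G$ (constructed below) is a simple $(r,r)$-framed algebra whose structure codes are $D_{S_G}=\Delta G$ and $C_{S_G}=(\Delta G)^\perp$.
   Context: Framed algebras. Let $\mathrm{IS}=\{0,\frac12,\frac1{16}\}$ with fusion rule $\star$ (values are subsets of $\mathrm{IS}$): $0\star h=h\star 0=\{h\}$, $\frac12\star\frac12=\{0\}$, $\frac12\star\frac1{16}=\frac1{16}\star\frac12=\{\frac1{16}\}$, $\frac1{16}\star\frac1{16}=\{0,\frac12\}$. For $h_0,\dots,h_3\in\mathrm{IS}$ put $A(h_0,h_1,h_2,h_3)=\{h\in\mathrm{IS}: h\in h_2\star h_3,\ h_0\in h_1\star h\}$. For $h\in A(h_0,h_1,h_2,h_3)$, $h'\in A(h_0,h_2,h_1,h_3)$ define $B^{h,h'}_{h_0,h_1,h_2,h_3}\in\mathbb{C}$ by: $B_{*,0,*,*}=B_{*,*,0,*}=1$; $B_{*,\frac12,\frac12,*}=-1$; $B_{a,\frac12,\frac1{16},a'}=B_{a,\frac1{16},\frac12,a'}=i$ if $a$ or $a'$ equals $\frac12$ and $-i$ otherwise; $B^{b,b'}_{a,\frac1{16},\frac1{16},a'}=e^{-\pi i/8}$ times: $1$ if $a,a'\neq\frac1{16}$, $a=a'$; $i$ if $a,a'\ne\frac1{16}$, $a\ne a'$; $\frac{1+i}2$ if $a=a'=\frac1{16}$, $b=b'$; $\frac{1-i}2$ if $a=a'=\frac1{16}$,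 $b\neq b'$ (upper indices are omitted when the sets $A$ are singletons). For $l,r\ge0$ let $\mathrm{IS}^{(l,r)}=\mathrm{IS}^l\times\mathrm{IS}^r$, $\lambda=(h_1,\dots,h_l,\bar h_1,\dots,\bar h_r)$, $s(\lambda)=\sum h_i-\sum\bar h_j$; extend $\star$, $A$ componentwise, and set $B^{\lambda,\lambda'}_{\lambda^0,\lambda^1,\lambda^2,\lambda^3}=\prod_{i=1}^l B^{h_i,h_i'}_{h^0_i,h^1_i,h^2_i,h^3_i}\prod_{j=1}^r\overline{B^{\bar h_j,\bar h_j'}_{\bar h^0_j,\bar h^1_j,\bar h^2_j,\bar h^3_j}}$ (complex conjugate on right components). An $(l,r)$-framed algebra is a finite-dimensional $\mathrm{IS}^{(l,r)}$-graded complex vector space $S=\bigoplus_\lambda S_\lambda$ with a bilinear product $\cdot$ and a nonzero $1\in S_0$ ($0=(0,\dots,0)$), writing $a\cdot_\lambda b$ for the $S_\lambda$-component of $a\cdot b$, such that: (FA1) $S_\lambda=0$ unless $s(\lambda)\in\mathbb{Z}$; (FA2) $S_0=\mathbb{C}1$ and $1\cdot a=a\cdot 1=a$; (FA3) $S_{\lambda^1}\cdot S_{\lambda^2}\subset\bigoplus_{\lambda\in\lambda^1\star\lambda^2}S_\lambda$; (FA4) for all $\lambda^0,\dots,\lambda^3$, $a_i\in S_{\lambda^i}$ ($i=1,2,3$), $\lambda'\in A(\lambda^0,\lambda^2,\lambda^1,\lambda^3)$: $a_2\cdot_{\lambda^0}(a_1\cdot_{\lambda'}a_3)=\sum_{\lambda\in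 A(\lambda^0,\lambda^1,\lambda^2,\lambda^3)}B^{\lambda,\lambda'}_{\lambda^0,\lambda^1,\lambda^2,\lambda^3}\,a_1\cdot_{\lambda^0}(a_2\cdot_\lambda a_3)$. An ideal is a graded subspace $M$ with $S\cdot M\subset M$; $S$ is simple if its only ideals are $0$ and $S$. Codes. Identify $\mathrm{IS}$ with $\{(d,c)\in\mathbb{Z}_2^2: dc=0\}$ via $0\leftrightarrow(0,0)$, $\frac12\leftrightarrow(0,1)$, $\frac1{16}\leftrightarrow(1,0)$, and componentwise $\mathrm{IS}^{(l,r)}$ with pairs $(d,c)\in\mathbb{Z}_2^{l+r}\times\mathbb{Z}_2^{l+r}$ with $dc=0$ (componentwise product); write $S_{d,c}$. For $c\in\mathbb{Z}_2^{l+r}$, $|c|_l$ ($|c|_r$) is the number of ones among the first $l$ (last $r$) coordinates and $|c|=|c|_l-|c|_r$. The structure codes are $C_S=\{\alpha: S_{(0,\alpha)}\ne0\}$ and $D_S=\{d:\bigoplus_cS_{d,c}\neq0\}$. For a subgroup $A$, $A^\perp=\{\beta:|\beta a|\in2\mathbb{Z}\ \forall a\in A\}$. Put $d_\perp=1^{l+r}+d$ and $\mathbb{Z}_2^d=\{\alpha:d\alpha=\alpha\}$. Construction of $S_G$ ($l=r$). $\Delta:\mathbb{Z}_2^r\to\mathbb{Z}_2^{r+r}$, $g\mapsto(g,g)$; $D_G=\Delta G$, $C_G=D_G^\perp$. Let $C^{\rm even}_{r,r}=\{\alpha:|\alpha|\in2\mathbb{Z}\}$ with ordered basis $(v_1,\dots,v_{2r-1})=(\Delta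 e_1,\dots,\Delta e_r,\tilde e_1-\tilde e_2,\dots,\tilde e_{r-1}-\tilde e_r)$, $\tilde e_i=(e_i,0)$, and let $\varepsilon$ be the bimultiplicative map $C^{\rm even}_{r,r}\times C^{\rm even}_{r,r}\to\{\pm1\}$ with $\varepsilon(v_i,v_i)=(-1)^{|v_i|/2}$, $\varepsilon(v_i,v_j)=1$ for $i<j$, $\varepsilon(v_i,v_j)=(-1)^{|v_iv_j|}$ for $i>j$. Let $\mathbb{C}[\hat C_G]$ have basis $e_\alpha$ ($\alpha\in C_G$), $e_\alpha e_\beta=\varepsilon(\alpha,\beta)e_{\alpha+\beta}$. For $d\in\Delta\mathbb{Z}_2^r$ let $\Delta^d=\mathbb{Z}_2^d\cap\Delta\mathbb{Z}_2^r$; $\{e_\gamma\}_{\gamma\in\Delta^d}$ spans a copy of the group algebra $\mathbb{C}[\Delta^d]$. For $d\in D_G$ let $A_G(d)=\mathbb{C}[\hat C_G]\otimes_{\mathbb{C}[\Delta^d]}\mathbb{C}t_d$ ($\mathbb{C}t_d$ the trivial module), $S_G=\bigoplus_{d\in D_G}A_G(d)$, with $e_\alpha\cdot t_d$ of degree $(d,d_\perp\alpha)$, unit $1=e_0\cdot t_0$, $\delta_d=\sum_{\gamma\in\Delta^d}e_\gamma$, and the (well-defined) product $(e_{\alpha^1}\cdot t_{d^1})\cdot(e_{\alpha^2}\cdot t_{d^2})=(-1)^{|d^1d^2_\perp\alpha^1\alpha^2|+|d^1d^2\alpha^2|+\frac12|d^1\alpha^2|}\,e_{\alpha^1}\delta_{d^1d^2}e_{\alpha^2}\cdot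 t_{d^1+d^2}$. *)

theory Defs
  imports Complex_Main
begin

datatype IS = Z | H | Q

fun hval :: "IS \<Rightarrow> real" where
  "hval Z = 0" | "hval H = 1/2" | "hval Q = 1/16"

fun fusion :: "IS \<Rightarrow> IS \<Rightarrow> IS set" where
  "fusion Z h = {h}"
| "fusion h Z = {h}"
| "fusion H H = {Z}"
| "fusion H Q = {Q}"
| "fusion Q H = {Q}"
| "fusion Q Q = {Z, H}"

definition Aset :: "IS \<Rightarrow> IS \<Rightarrow> IS \<Rightarrow> IS \<Rightarrow> IS set" where
  "Aset h0 h1 h2 h3 = {h. h \<in> fusion h2 h3 \<and> h0 \<in> fusion h1 h}"

text \<open>Bval h0 h1 h2 h3 h h' is the braiding coefficient B^{h,h'}_{h0,h1,h2,h3}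
  (h in Aset h0 h1 h2 h3, h' in Aset h0 h2 h1 h3). Values outside the
  meaningful range (where the A-sets are empty) are set to 0.\<close>
definition Bval :: "IS \<Rightarrow> IS \<Rightarrow> IS \<Rightarrow> IS \<Rightarrow> IS \<Rightarrow> IS \<Rightarrow> complex" where
  "Bval a h1 h2 a' b b' =
    (if h1 = Z \<or> h2 = Z then 1
     else if h1 = H \<and> h2 = H then -1
     else if (h1 = H \<and> h2 = Q) \<or> (h1 = Q \<and> h2 = H) then
       (if a = H \<or> a' = H then \<i> else - \<i>)
     else
       exp (- (of_real pi / 8) * \<i>) *
       (if a \<noteq> Q \<and> a' \<noteq> Q then (if a = a' then 1 else \<i>)
        else if a = Q \<and> a' = Q then (if b = b' then (1 + \<i>) / 2 else (1 - \<i>) / 2)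
        else 0))"

text \<open>A grade lambda in IS^(l,r) is a function nat => IS, with positions
  0..l-1 the left components h_1..h_l, positions l..l+r-1 the right
  components hbar_1..hbar_r, and value Z at all positions >= l+r.\<close>
type_synonym grade = "nat \<Rightarrow> IS"

definition grades :: "nat \<Rightarrow> nat \<Rightarrow> grade set" where
  "grades l r = {m. \<forall>i\<ge>l+r. m i = Z}"

definition zgrade :: grade where "zgrade = (\<lambda>_. Z)"

definition sval :: "nat \<Rightarrow> nat \<Rightarrow> grade \<Rightarrow> real" where
  "sval l r m = (\<Sum>i<l. hval (m i)) - (\<Sum>i\<in>{l..<l+r}. hval (m i))"

definition gfusion :: "nat \<Rightarrow> nat \<Rightarrow> grade \<Rightarrow> grade \<Rightarrow> grade set" where
  "gfusion l r m1 m2 = {m \<in> grades l r. \<forall>i<l+r. m i \<in> fusion (m1 i) (m2 i)}"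

definition gA :: "nat \<Rightarrow> nat \<Rightarrow> grade \<Rightarrow> grade \<Rightarrow> grade \<Rightarrow> grade \<Rightarrow> grade set" where
  "gA l r m0 m1 m2 m3 =
     {m \<in> grades l r. \<forall>i<l+r. m i \<in> Aset (m0 i) (m1 i) (m2 i) (m3 i)}"

definition gB :: "nat \<Rightarrow> nat \<Rightarrow> grade \<Rightarrow> grade \<Rightarrow> grade \<Rightarrow> grade \<Rightarrow> grade \<Rightarrow> grade \<Rightarrow> complex" where
  "gB l r m0 m1 m2 m3 m m' =
     (\<Prod>i<l. Bval (m0 i) (m1 i) (m2 i) (m3 i) (m i) (m' i)) *
     (\<Prod>i\<in>{l..<l+r}. cnj (Bval (m0 i) (m1 i) (m2 i) (m3 i) (m i) (m' i)))"

record 'v galg =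
  carrier :: "'v set"
  vadd :: "'v \<Rightarrow> 'v \<Rightarrow> 'v"
  vzero :: 'v
  vscale :: "complex \<Rightarrow> 'v \<Rightarrow> 'v"
  mult :: "'v \<Rightarrow> 'v \<Rightarrow> 'v"
  unit :: 'v
  piece :: "grade \<Rightarrow> 'v set"

definition vsum :: "'v galg \<Rightarrow> ('a \<Rightarrow> 'v) \<Rightarrow> 'a set \<Rightarrow> 'v" where
  "vsum S f A = Finite_Set.fold (\<lambda>a acc. vadd S (f a) acc) (vzero S) A"

definition cvector_space :: "'v galg \<Rightarrow> bool" where
  "cvector_space S \<longleftrightarrow>
     vzero S \<in> carrier S \<and>
     (\<forall>x\<in>carrier S. \<forall>y\<in>carrier S. vadd S x y \<in> carrier S) \<and>
     (\<forall>c. \<forall>x\<in>carrier S. vscale S c x \<in> carrier S) \<and>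
     (\<forall>x\<in>carrier S. \<forall>y\<in>carrier S. \<forall>z\<in>carrier S. vadd S (vadd S x y) z = vadd S x (vadd S y z)) \<and>
     (\<forall>x\<in>carrier S. \<forall>y\<in>carrier S. vadd S x y = vadd S y x) \<and>
     (\<forall>x\<in>carrier S. vadd S (vzero S) x = x) \<and>
     (\<forall>x\<in>carrier S. \<exists>y\<in>carrier S. vadd S x y = vzero S) \<and>
     (\<forall>c. \<forall>x\<in>carrier S. \<forall>y\<in>carrier S. vscale S c (vadd S x y) = vadd S (vscale S c x) (vscale S c y)) \<and>
     (\<forall>c d. \<forall>x\<in>carrier S. vscale S (c + d) x = vadd S (vscale S c x) (vscale S d x)) \<and>
     (\<forall>c d. \<forall>x\<in>carrier S. vscale S (c * d) x = vscale S c (vscale S d x)) \<and>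
     (\<forall>x\<in>carrier S. vscale S 1 x = x)"

definition fin_dim :: "'v galg \<Rightarrow> bool" where
  "fin_dim S \<longleftrightarrow> (\<exists>B. finite B \<and> B \<subseteq> carrier S \<and>
     (\<forall>x\<in>carrier S. \<exists>k. x = vsum S (\<lambda>b. vscale S (k b) b) B))"

definition vsubspace :: "'v galg \<Rightarrow> 'v set \<Rightarrow> bool" where
  "vsubspace S M \<longleftrightarrow> M \<subseteq> carrier S \<and> vzero S \<in> M \<and>
     (\<forall>x\<in>M. \<forall>y\<in>M. vadd S x y \<in> M) \<and> (\<forall>c. \<forall>x\<in>M. vscale S c x \<in> M)"

definition decomp :: "'v galg \<Rightarrow> nat \<Rightarrow> nat \<Rightarrow> 'v \<Rightarrow> (grade \<Rightarrow> 'v) \<Rightarrow> bool" where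
  "decomp S l r x f \<longleftrightarrow> (\<forall>m\<in>grades l r. f m \<in> piece S m) \<and>
     (\<forall>m. m \<notin> grades l r \<longrightarrow> f m = vzero S) \<and> x = vsum S f (grades l r)"

definition graded :: "'v galg \<Rightarrow> nat \<Rightarrow> nat \<Rightarrow> bool" where
  "graded S l r \<longleftrightarrow> (\<forall>m\<in>grades l r. vsubspace S (piece S m)) \<and>
     (\<forall>x\<in>carrier S. \<exists>!f. decomp S l r x f)"

definition compo :: "'v galg \<Rightarrow> nat \<Rightarrow> nat \<Rightarrow> grade \<Rightarrow> 'v \<Rightarrow> 'v" where
  "compo S l r m x = (THE f. decomp S l r x f) m"

definition bilinear_mult :: "'v galg \<Rightarrow> bool" where
  "bilinear_mult S \<longleftrightarrow>
     (\<forall>x\<in>carrier S. \<forall>y\<in>carrier S. mult S x y \<in> carrier S) \<and>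
     (\<forall>x\<in>carrier S. \<forall>y\<in>carrier S. \<forall>z\<in>carrier S.
        mult S (vadd S x y) z = vadd S (mult S x z) (mult S y z) \<and>
        mult S x (vadd S y z) = vadd S (mult S x y) (mult S x z)) \<and>
     (\<forall>c. \<forall>x\<in>carrier S. \<forall>y\<in>carrier S.
        mult S (vscale S c x) y = vscale S c (mult S x y) \<and>
        mult S x (vscale S c y) = vscale S c (mult S x y))"

definition framed_algebra :: "nat \<Rightarrow> nat \<Rightarrow> 'v galg \<Rightarrow> bool" where
  "framed_algebra l r S \<longleftrightarrow>
     cvector_space S \<and> fin_dim S \<and> graded S l r \<and> bilinear_mult S \<and>
     \<comment> \<open>FA1\<close>
     (\<forall>m\<in>grades l r. sval l r m \<notin> \<int> \<longrightarrow> piece S m = {vzero S}) \<and>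
     \<comment> \<open>FA2\<close>
     unit S \<in> carrier S \<and> unit S \<noteq> vzero S \<and>
     piece S zgrade = range (\<lambda>c. vscale S c (unit S)) \<and>
     (\<forall>a\<in>carrier S. mult S (unit S) a = a \<and> mult S a (unit S) = a) \<and>
     \<comment> \<open>FA3\<close>
     (\<forall>m1\<in>grades l r. \<forall>m2\<in>grades l r. \<forall>a\<in>piece S m1. \<forall>b\<in>piece S m2.
        \<forall>m\<in>grades l r. m \<notin> gfusion l r m1 m2 \<longrightarrow> compo S l r m (mult S a b) = vzero S) \<and>
     \<comment> \<open>FA4\<close>
     (\<forall>m0\<in>grades l r. \<forall>m1\<in>grades l r. \<forall>m2\<in>grades l r. \<forall>m3\<in>grades l r.
      \<forall>a1\<in>piece S m1. \<forall>a2\<in>piece S m2. \<forall>a3\<in>piece S m3.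
      \<forall>m'\<in>gA l r m0 m2 m1 m3.
        compo S l r m0 (mult S a2 (compo S l r m' (mult S a1 a3))) =
        vsum S (\<lambda>m. vscale S (gB l r m0 m1 m2 m3 m m')
                   (compo S l r m0 (mult S a1 (compo S l r m (mult S a2 a3)))))
             (gA l r m0 m1 m2 m3))"

definition ideal :: "nat \<Rightarrow> nat \<Rightarrow> 'v galg \<Rightarrow> 'v set \<Rightarrow> bool" where
  "ideal l r S M \<longleftrightarrow> vsubspace S M \<and>
     (\<forall>x\<in>M. \<forall>m\<in>grades l r. compo S l r m x \<in> M) \<and>
     (\<forall>a\<in>carrier S. \<forall>m\<in>M. mult S a m \<in> M)"

definition simple :: "nat \<Rightarrow> nat \<Rightarrow> 'v galg \<Rightarrow> bool" where
  "simple l r S \<longleftrightarrow> (\<forall>M. ideal l r S M \<longrightarrow> M = {vzero S} \<or> M = carrier S)"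

text \<open>A word in Z_2^n is represented by its support, a subset of {..<n};
  addition is symmetric difference, componentwise product is intersection.\<close>
definition sd :: "nat set \<Rightarrow> nat set \<Rightarrow> nat set" where
  "sd a b = (a - b) \<union> (b - a)"

definition gof :: "nat set \<Rightarrow> nat set \<Rightarrow> grade" where
  "gof d c = (\<lambda>i. if i \<in> d then Q else if i \<in> c then H else Z)"

definition Ccode :: "nat \<Rightarrow> nat \<Rightarrow> 'v galg \<Rightarrow> nat set set" where
  "Ccode l r S = {\<alpha>. \<alpha> \<subseteq> {..<l+r} \<and> piece S (gof {} \<alpha>) \<noteq> {vzero S}}"

definition Dcode :: "nat \<Rightarrow> nat \<Rightarrow> 'v galg \<Rightarrow> nat set set" where
  "Dcode l r S = {d. d \<subseteq> {..<l+r} \<and>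
     (\<exists>c. c \<subseteq> {..<l+r} \<and> d \<inter> c = {} \<and> piece S (gof d c) \<noteq> {vzero S})}"

definition swt :: "nat \<Rightarrow> nat \<Rightarrow> nat set \<Rightarrow> int" where
  "swt l r c = int (card (c \<inter> {..<l})) - int (card (c \<inter> {l..<l+r}))"

definition perp :: "nat \<Rightarrow> nat \<Rightarrow> nat set set \<Rightarrow> nat set set" where
  "perp l r A = {\<beta>. \<beta> \<subseteq> {..<l+r} \<and> (\<forall>a\<in>A. even (swt l r (\<beta> \<inter> a)))}"

definition is_subgroup :: "nat \<Rightarrow> nat set set \<Rightarrow> bool" where
  "is_subgroup r G \<longleftrightarrow> G \<subseteq> Pow {..<r} \<and> {} \<in> G \<and> (\<forall>a\<in>G. \<forall>b\<in>G. sd a b \<in> G)"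

definition Delta :: "nat \<Rightarrow> nat set \<Rightarrow> nat set" where
  "Delta r g = g \<union> (\<lambda>i. i + r) ` g"

definition Ceven :: "nat \<Rightarrow> nat set set" where
  "Ceven r = {\<alpha>. \<alpha> \<subseteq> {..<2*r} \<and> even (swt r r \<alpha>)}"

text \<open>Ordered basis v_0,...,v_{2r-2} (0-based): v_i = Delta e_i for i<r,
  v_{r+j} = e~_j - e~_{j+1} (left coordinates j, j+1) for j<r-1.\<close>
definition vb :: "nat \<Rightarrow> nat \<Rightarrow> nat set" where
  "vb r k = (if k < r then Delta r {k} else {k - r, k - r + 1})"

definition sgn_int :: "int \<Rightarrow> complex" where
  "sgn_int k = (if even k then 1 else -1)"

definition epsval :: "nat \<Rightarrow> nat \<Rightarrow> nat \<Rightarrow> complex" where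
  "epsval r i j =
    (if i = j then sgn_int (swt r r (vb r i) div 2)
     else if i < j then 1
     else sgn_int (swt r r (vb r i \<inter> vb r j)))"

definition eps :: "nat \<Rightarrow> nat set \<Rightarrow> nat set \<Rightarrow> complex" where
  "eps r = (THE e.
     (\<forall>a\<in>Ceven r. \<forall>b\<in>Ceven r. \<forall>c\<in>Ceven r.
        e (sd a b) c = e a c * e b c \<and> e a (sd b c) = e a b * e a c) \<and>
     (\<forall>i<2*r-1. \<forall>j<2*r-1. e (vb r i) (vb r j) = epsval r i j) \<and>
     (\<forall>a b. a \<notin> Ceven r \<or> b \<notin> Ceven r \<longrightarrow> e a b = 0))"

definition DG :: "nat \<Rightarrow> nat set set \<Rightarrow> nat set set" where
  "DG r G = Delta r ` G"

definition CG :: "nat \<Rightarrow> nat set set \<Rightarrow> nat set set" where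
  "CG r G = perp r r (DG r G)"

definition Deltad :: "nat \<Rightarrow> nat set \<Rightarrow> nat set set" where
  "Deltad r d = {\<gamma>. \<gamma> \<subseteq> d \<and> (\<exists>g. g \<subseteq> {..<r} \<and> \<gamma> = Delta r g)}"

text \<open>Ambient space: the free vector space V on symbols e_alpha . t_d
  (d in D_G, alpha in C_G), i.e. finitely supported coefficient functions.\<close>
type_synonym vec = "nat set \<times> nat set \<Rightarrow> complex"

definition Vsp :: "nat \<Rightarrow> nat set set \<Rightarrow> vec set" where
  "Vsp r G = {v. \<forall>x. x \<notin> DG r G \<times> CG r G \<longrightarrow> v x = 0}"

definition delta :: "nat set \<Rightarrow> nat set \<Rightarrow> vec" where
  "delta d \<alpha> = (\<lambda>x. if x = (d, \<alpha>) then 1 else 0)"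

text \<open>Relations of the tensor product over C[Delta^d] with the trivial module:
  (e_alpha e_gamma) t_d - e_alpha t_d, where e_alpha e_gamma = eps(alpha,gamma) e_{alpha+gamma}.\<close>
definition relgen :: "nat \<Rightarrow> nat set \<times> nat set \<times> nat set \<Rightarrow> vec" where
  "relgen r i = (case i of (d, \<alpha>, \<gamma>) \<Rightarrow>
      (\<lambda>x. eps r \<alpha> \<gamma> * delta d (sd \<alpha> \<gamma>) x - delta d \<alpha> x))"

definition relidx :: "nat \<Rightarrow> nat set set \<Rightarrow> (nat set \<times> nat set \<times> nat set) set" where
  "relidx r G = {(d, \<alpha>, \<gamma>). d \<in> DG r G \<and> \<alpha> \<in> CG r G \<and> \<gamma> \<in> Deltad r d}"

definition Nsp :: "nat \<Rightarrow> nat set set \<Rightarrow> vec set" where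
  "Nsp r G = {v. \<exists>k. \<forall>x. v x = (\<Sum>i\<in>relidx r G. k i * relgen r i x)}"

definition coset :: "nat \<Rightarrow> nat set set \<Rightarrow> vec \<Rightarrow> vec set" where
  "coset r G v = {w. \<exists>n\<in>Nsp r G. w = (\<lambda>x. v x + n x)}"

definition rep :: "vec set \<Rightarrow> vec" where
  "rep X = (SOME v. v \<in> X)"

text \<open>Product e_{a1} delta_{d} e_{a2} in the twisted group algebra, coefficient at beta.\<close>
definition tw3 :: "nat \<Rightarrow> nat set \<Rightarrow> nat set \<Rightarrow> nat set \<Rightarrow> nat set \<Rightarrow> complex" where
  "tw3 r a1 d a2 \<beta> = (\<Sum>\<gamma>\<in>Deltad r d.
     (if \<beta> = sd (sd a1 \<gamma>) a2 then eps r a1 \<gamma> * eps r (sd a1 \<gamma>) a2 else 0))"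

definition sign_exp :: "nat \<Rightarrow> nat set \<Rightarrow> nat set \<Rightarrow> nat set \<Rightarrow> nat set \<Rightarrow> int" where
  "sign_exp r d1 a1 d2 a2 =
     swt r r (d1 \<inter> ({..<2*r} - d2) \<inter> a1 \<inter> a2) + swt r r (d1 \<inter> d2 \<inter> a2)
     + swt r r (d1 \<inter> a2) div 2"

definition prodV :: "nat \<Rightarrow> nat set set \<Rightarrow> vec \<Rightarrow> vec \<Rightarrow> vec" where
  "prodV r G u v = (\<lambda>(d, \<beta>).
     \<Sum>(d1, a1)\<in>DG r G \<times> CG r G. \<Sum>(d2, a2)\<in>DG r G \<times> CG r G.
       u (d1, a1) * v (d2, a2) * sgn_int (sign_exp r d1 a1 d2 a2) *
       (if d = sd d1 d2 then tw3 r a1 (d1 \<inter> d2) a2 \<beta> else 0))"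

definition SG :: "nat \<Rightarrow> nat set set \<Rightarrow> vec set galg" where
  "SG r G = \<lparr>
     carrier = coset r G ` Vsp r G,
     vadd = (\<lambda>X Y. coset r G (\<lambda>x. rep X x + rep Y x)),
     vzero = coset r G (\<lambda>_. 0),
     vscale = (\<lambda>c X. coset r G (\<lambda>x. c * rep X x)),
     mult = (\<lambda>X Y. coset r G (prodV r G (rep X) (rep Y))),
     unit = coset r G (delta {} {}),
     piece = (\<lambda>m. coset r G `
        {v \<in> Vsp r G. \<forall>d \<alpha>. v (d, \<alpha>) \<noteq> 0 \<longrightarrow> m = gof d (\<alpha> - d)})
   \<rparr>"

end

theory Submission
  imports Defs "HOL-Library.Function_Algebras"
begin

text \<open>
  The relations defining \<open>A_G(d)\<close> are the kernel of the map \<open>L\<close> which sums a vector over the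
  translates by \<open>\<Delta>\<^sup>d\<close>, twisted by the cocycle, so identities in \<open>S_G\<close> can be tested after applying \<open>L\<close>.
  All that is used of the cocycle is that it is bimultiplicative, that
  \<open>\<epsilon>(\<alpha>,\<beta>) \<epsilon>(\<beta>,\<alpha>) = (-1)^|\<alpha>\<beta>|\<close> and \<open>\<epsilon>(\<alpha>,\<alpha>) = i^|\<alpha>|\<close>, and that it is trivial on diagonal words.

  For (FA4) on basis elements \<open>e_a t_d\<close>, both sides become sums over diagonal words supported where at
  least two of \<open>d\<^sub>1, d\<^sub>2, d\<^sub>3\<close> are nonzero. The part where exactly two are nonzero is matched term by
  term. On the part where all three are nonzero the grade \<open>\<lambda>'\<close> selects at most one term on the
  left, whereas the right side is a sum over all choices. All signs being products over positions,
  the claim factors into an identity for each pair of positions \<open>i\<close>, \<open>i + r\<close>.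

  For simplicity, a vector \<open>v\<close> that is nonzero in \<open>S_G\<close> has a coefficient \<open>L v (d, b) \<noteq> 0\<close>, which
  up to sign is the degree 0 component of \<open>(e_b t_d) v\<close>; so every nonzero ideal contains the unit.
\<close>

subsection \<open>Weights of codewords\<close>

text \<open>The operations of \<open>SG\<close> act on cosets through representatives picked by
  \<open>SOME\<close>, so nothing can be computed before independence of that choice is known.
  \<open>L\<close> settles this: cosets are its fibres, and because one can divide by the order of
  the finite group \<open>Deltad r d\<close>, an averaging argument shows that its kernel contains
  nothing beyond the relations. In (FA4) a single position is not enough. A diagonal word has the
  same bit at i and i + r, so the summation words tie the left half to the right half, and away from
  the triple overlap the one-position quantities agree only up to a phase built from i and e^(-pi
  i/8). Right components enter complex conjugated, so these phases cancel within a pair. Two inputs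
  are global rather than positional: the commutator sign of e_(a_1) and e_(a_2), and the triviality
  of the sign (-1)^|d_2 a_1|, which expresses that C_G is orthogonal to D_G.\<close>

lemma mem_sd [simp]: "i \<in> sd a b \<longleftrightarrow> (i \<in> a) \<noteq> (i \<in> b)"
  by (auto simp: sd_def)

lemma sd_assoc: "sd (sd a b) c = sd a (sd b c)"
  by (rule set_eqI) auto

lemma sd_commute: "sd a b = sd b a"
  by (rule set_eqI) auto

lemma sd_left_commute: "sd a (sd b c) = sd b (sd a c)"
  by (rule set_eqI) auto

lemmas sd_ac = sd_assoc sd_commute sd_left_commute

lemma sd_empty [simp]: "sd a {} = a" "sd {} a = a"
  by (rule set_eqI, auto)+

lemma sd_self [simp]: "sd a a = {}"
  by (rule set_eqI) auto

lemma sd_cancel [simp]: "sd a (sd a b) = b"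
  by (rule set_eqI) auto

lemma sd_cancel_right [simp]: "sd (sd a b) b = a"
  by (rule set_eqI) auto

lemma sd_subset: "a \<subseteq> c \<Longrightarrow> b \<subseteq> c \<Longrightarrow> sd a b \<subseteq> c"
  by auto

text \<open>Pairing position i with i + r makes diagonal words cancel termwise and reduces
  identities for \<open>swt\<close> to one index at a time.\<close>

lemma swt_sum: "swt r r X = (\<Sum>i<r. of_bool (i \<in> X) - of_bool (i + r \<in> X))"
proof -
  have fin: "int (card (X \<inter> A)) = (\<Sum>i\<in>A. of_bool (i \<in> X))" if "finite A" for A :: "nat set"
  proof -
    have "(\<Sum>i\<in>A. if i \<in> X then 1 else 0 :: int) = (\<Sum>i\<in>A \<inter> X. 1)"
      using that by (rule sum.inter_restrict [symmetric])
    then show ?thesis by (simp add: of_bool_def Int_commute)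
  qed
  have "(\<Sum>i\<in>{r..<r + r}. of_bool (i \<in> X) :: int) = (\<Sum>i\<in>{0 + r..<r + r}. of_bool (i \<in> X))"
    by simp
  also have "\<dots> = (\<Sum>i<r. of_bool (i + r \<in> X))"
    by (subst sum.shift_bounds_nat_ivl) (simp add: lessThan_atLeast0)
  finally show ?thesis
    unfolding swt_def by (simp add: fin sum_subtractf)
qed

lemma swt_empty [simp]: "swt l r {} = 0"
  by (simp add: swt_def)

lemma swt_sd: "swt r r (sd a b) = swt r r a + swt r r b - 2 * swt r r (a \<inter> b)"
  unfolding swt_sum sum.distrib [symmetric] sum_distrib_left sum_subtractf [symmetric]
  by (rule sum.cong) auto

lemma sgn_int_add: "sgn_int (a + b) = sgn_int a * sgn_int b"
  by (auto simp: sgn_int_def)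

lemma sgn_int_0 [simp]: "sgn_int 0 = 1"
  by (simp add: sgn_int_def)

lemma sgn_int_diff: "sgn_int (a - b) = sgn_int a * sgn_int b"
  by (auto simp: sgn_int_def)

lemma sgn_int_square [simp]: "sgn_int a * sgn_int a = 1"
  by (auto simp: sgn_int_def)

lemma sgn_int_even: "even k \<Longrightarrow> sgn_int k = 1"
  by (simp add: sgn_int_def)

lemma sgn_int_sum: "sgn_int (sum f A) = (\<Prod>i\<in>A. sgn_int (f i))"
  by (induction A rule: infinite_finite_induct) (simp_all add: sgn_int_add)

text \<open>\<open>iw\<close> is \<open>i^|X|\<close>, hence \<open>(-1)^(|X|/2)\<close> when \<open>|X|\<close> is even. Unlike the halved exponent it is a
  product over positions.\<close>

definition sg :: "nat \<Rightarrow> nat set \<Rightarrow> complex" where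
  "sg r X = sgn_int (swt r r X)"

definition iw :: "nat \<Rightarrow> nat set \<Rightarrow> complex" where
  "iw r X = (\<Prod>i<r. (if i \<in> X then \<i> else 1) * (if i + r \<in> X then - \<i> else 1))"

lemma sg_prod: "sg r X = (\<Prod>i<r. (if i \<in> X then -1 else 1) * (if i + r \<in> X then -1 else 1))"
  unfolding sg_def swt_sum sgn_int_sum by (rule prod.cong) (auto simp: sgn_int_def)

text \<open>The factors at i and i + r are i and its inverse -i, so the product is i^|X|; for even
  |X| this equals (i^2)^(|X|/2).\<close>

lemma iw_half: "even (swt r r X) \<Longrightarrow> sgn_int (swt r r X div 2) = iw r X"
proof -
  assume ev: "even (swt r r X)"
  have "iw r X = (\<Prod>i<r. \<i> powi (of_bool (i \<in> X) - of_bool (i + r \<in> X)))"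
    unfolding iw_def by (rule prod.cong) (auto simp: power_int_minus)
  also have "\<dots> = \<i> powi (swt r r X)"
    unfolding swt_sum
    by (rule sym, induction rule: finite_induct [OF finite_lessThan])
      (simp_all add: power_int_add)
  also have "\<dots> = (\<i> powi 2) powi (swt r r X div 2)"
    using ev by (subst power_int_mult [symmetric]) simp
  also have "\<dots> = sgn_int (swt r r X div 2)"
    by (auto simp: sgn_int_def)
  finally show ?thesis by simp
qed

lemma sg_sd: "sg r (sd a b) = sg r a * sg r b"
  by (simp add: sg_def swt_sd sgn_int_diff sgn_int_add sgn_int_even)

text \<open>\<open>iw\<close> is a quadratic refinement of the pairing \<open>sg\<close>: at a
  common position two factors i, or two factors -i, multiply to -1, and \<open>sg\<close> removes
  this sign.\<close>

lemma iw_sd: "iw r (sd a b) = iw r a * iw r b * sg r (a \<inter> b)"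
  unfolding iw_def sg_prod prod.distrib [symmetric] by (rule prod.cong) auto

subsection \<open>The cocycle\<close>

lemma mem_Delta: "i \<in> Delta r g \<longleftrightarrow> i \<in> g \<or> (r \<le> i \<and> i - r \<in> g)"
  by (auto simp: Delta_def image_iff) (metis le_add_diff_inverse2)

lemma Delta_left: "g \<subseteq> {..<r} \<Longrightarrow> i < r \<Longrightarrow> i \<in> Delta r g \<longleftrightarrow> i \<in> g"
  by (auto simp: mem_Delta)

lemma Delta_right: "g \<subseteq> {..<r} \<Longrightarrow> i + r \<in> Delta r g \<longleftrightarrow> i \<in> g"
  by (auto simp: mem_Delta)

lemma Ceven_empty [simp]: "{} \<in> Ceven r"
  by (simp add: Ceven_def)

lemma Ceven_sd: "a \<in> Ceven r \<Longrightarrow> b \<in> Ceven r \<Longrightarrow> sd a b \<in> Ceven r"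
  by (auto simp: Ceven_def swt_sd)

lemma swt_diag: "(\<And>i. i < r \<Longrightarrow> i \<in> X \<longleftrightarrow> i + r \<in> X) \<Longrightarrow> swt r r X = 0"
  by (simp add: swt_sum)

lemma swt_Delta: "g \<subseteq> {..<r} \<Longrightarrow> swt r r (Delta r g) = 0"
  by (rule swt_diag) (auto simp: mem_Delta)

lemma Delta_in_Ceven: "g \<subseteq> {..<r} \<Longrightarrow> Delta r g \<in> Ceven r"
  by (auto simp: Ceven_def swt_Delta mem_Delta subset_iff)

lemma swt_left: "X \<subseteq> {..<r} \<Longrightarrow> swt r r X = int (card X)"
proof -
  assume a: "X \<subseteq> {..<r}"
  then have "X \<inter> {r..<r + r} = {}" "X \<inter> {..<r} = X" by auto
  then show ?thesis unfolding swt_def by simp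
qed

lemma vb_in_Ceven: "k < 2 * r - 1 \<Longrightarrow> vb r k \<in> Ceven r"
proof (cases "k < r")
  case True
  then show ?thesis by (simp add: vb_def Delta_in_Ceven)
next
  case False
  assume "k < 2 * r - 1"
  with False have "vb r k \<subseteq> {..<r}" "card (vb r k) = 2"
    by (auto simp: vb_def)
  then show ?thesis by (auto simp: Ceven_def swt_left)
qed

text \<open>The vectors \<open>vb r k\<close> generate \<open>Ceven r\<close>: adding a suitable one
  replaces an element m by a smaller n, or removes both, so the sum over the elements decreases.
  Bimultiplicative identities thereby reduce to basis vectors.\<close>

lemma Ceven_induct [consumes 1, case_names empty add]:
  assumes "a \<in> Ceven r"
    and "P {}"
    and "\<And>a k. a \<in> Ceven r \<Longrightarrow> k < 2 * r - 1 \<Longrightarrow> P a \<Longrightarrow> P (sd a (vb r k))"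
  shows "P a"
  using assms(1)
proof (induction "\<Sum>x\<in>a. Suc x" arbitrary: a rule: less_induct)
  case less
  have fin: "finite a" and sub: "a \<subseteq> {..<2 * r}" and ev: "even (swt r r a)"
    using less.prems by (auto simp: Ceven_def intro: finite_subset)
  have dec: "(\<Sum>x\<in>sd a {m, n}. Suc x) < (\<Sum>x\<in>a. Suc x)" if "m \<in> a" "n < m" for m n
  proof -
    have "sd a {m, n} = (if n \<in> a then a - {m} - {n} else insert n (a - {m}))"
      using that by (auto simp: sd_def)
    moreover have "(\<Sum>x\<in>a. Suc x) = Suc m + (\<Sum>x\<in>a - {m}. Suc x)"
      using that fin by (simp add: sum.remove)
    moreover have "(\<Sum>x\<in>a - {m}. Suc x) = Suc n + (\<Sum>x\<in>a - {m} - {n}. Suc x)" if "n \<in> a"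
      using that \<open>n < m\<close> fin by (intro sum.remove) auto
    ultimately show ?thesis using that fin by auto
  qed
  have step: "P a" if "m \<in> a" "n < m" "k < 2 * r - 1" "vb r k = {m, n}" for m n k
  proof -
    have "sd a {m, n} \<in> Ceven r"
      using that less.prems Ceven_sd vb_in_Ceven by metis
    with less.hyps dec [OF that(1,2)] have "P (sd a {m, n})" by blast
    then have "P (sd (sd a {m, n}) (vb r k))"
      using assms(3) \<open>sd a {m, n} \<in> Ceven r\<close> that by blast
    then show ?thesis using that by simp
  qed
  show ?case
  \<comment> \<open>A right position m is moved to the left half by Delta e_(m - r); once none
    remains, the largest left position m is moved down by the basis vector consisting of m - 1 and
    m.\<close>
  proof (cases "\<exists>m\<in>a. r \<le> m")
    case True
    then obtain m where m: "m \<in> a" "r \<le> m" by blast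
    with sub have "m < 2 * r" by auto
    with m show ?thesis
      by (intro step [of m "m - r" "m - r"]) (auto simp: vb_def Delta_def)
  next
    case left: False
    show ?thesis
    proof (cases "a = {}")
      case True
      then show ?thesis using assms(2) by simp
    next
      case False
      define m where "m = Max a"
      have m: "m \<in> a" "m < r" using False fin left by (auto simp: m_def not_le)
      \<comment> \<open>Only \<open>{0}\<close> would resist further reduction, and its weight is
        odd.\<close>
      have "m \<noteq> 0"
      proof
        assume "m = 0"
        then have "a \<subseteq> {0}" using Max_ge [OF fin] by (auto simp: m_def)
        then have "a = {0}" using False by auto
        moreover have "swt r r a = int (card a)" by (rule swt_left) (use left in auto)
        ultimately show False using ev by simp
      qed
      with m show ?thesis
        by (intro step [of m "m - 1" "m - 1 + r"]) (auto simp: vb_def)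
    qed
  qed
qed

text \<open>Of the basis vectors only the \<open>i\<close>-th one contains the right position \<open>i + r\<close>; once these are
  subtracted, the remaining coordinates are parities of prefixes of the left half.\<close>

definition vcoord :: "nat \<Rightarrow> nat \<Rightarrow> nat set \<Rightarrow> bool" where
  "vcoord r k a = (if k < r then k + r \<in> a
     else odd (\<Sum>j\<le>k - r. of_bool (j \<in> a) + of_bool (j + r \<in> a) :: nat))"

lemma vcoord_sd: "vcoord r k (sd a b) \<longleftrightarrow> vcoord r k a \<noteq> vcoord r k b"
proof -
  have "odd (\<Sum>j\<le>m. of_bool (j \<in> sd a b) + of_bool (j + r \<in> sd a b) :: nat) \<longleftrightarrow>
      odd (\<Sum>j\<le>m. of_bool (j \<in> a) + of_bool (j + r \<in> a) :: nat) \<noteq>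
      odd (\<Sum>j\<le>m. of_bool (j \<in> b) + of_bool (j + r \<in> b) :: nat)" for m
    by (induction m) auto
  then show ?thesis by (auto simp: vcoord_def)
qed

text \<open>The functionals \<open>vcoord\<close> are the dual basis. A vector Delta e_j adds 0 or 2
  to the count of every prefix, while two adjacent left positions are separated by exactly one
  prefix, the one that ends at the smaller of them.\<close>

lemma vcoord_vb:
  assumes "j < 2 * r - 1" "k < 2 * r - 1"
  shows "vcoord r k (vb r j) \<longleftrightarrow> k = j"
proof (cases "k < r")
  case True
  then show ?thesis using assms by (auto simp: vcoord_def vb_def Delta_def)
next
  case k: False
  show ?thesis
  proof (cases "j < r")
    case True
    have "even (\<Sum>i\<le>k - r. of_bool (i \<in> vb r j) + of_bool (i + r \<in> vb r j) :: nat)"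
      using True k assms by (intro dvd_sum) (auto simp: vb_def mem_Delta)
    then show ?thesis using k True by (auto simp: vcoord_def)
  next
    case False
    have "(\<Sum>i\<le>k - r. of_bool (i \<in> vb r j) + of_bool (i + r \<in> vb r j) :: nat) =
        (\<Sum>i\<le>k - r. of_bool (i = j - r) + of_bool (i = j - r + 1))"
      using False assms by (intro sum.cong) (auto simp: vb_def)
    also have "\<dots> = of_bool (j - r \<le> k - r) + of_bool (j - r + 1 \<le> k - r)"
      by (simp add: sum.distrib of_bool_def)
    finally show ?thesis using k False by (auto simp: vcoord_def)
  qed
qed

definition bimult :: "nat \<Rightarrow> (nat set \<Rightarrow> nat set \<Rightarrow> complex) \<Rightarrow> bool" where
  "bimult r e \<longleftrightarrow> (\<forall>a\<in>Ceven r. \<forall>b\<in>Ceven r. \<forall>c\<in>Ceven r.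
     e (sd a b) c = e a c * e b c \<and> e a (sd b c) = e a b * e a c)"

lemma bimultD:
  assumes "bimult r e" "a \<in> Ceven r" "b \<in> Ceven r" "c \<in> Ceven r"
  shows "e (sd a b) c = e a c * e b c" "e a (sd b c) = e a b * e a c"
  using assms unfolding bimult_def by blast+

lemma epsval_square: "epsval r i j * epsval r i j = 1"
  by (auto simp: epsval_def)

text \<open>Bimultiplicativity alone also holds for the zero map. One value of square 1 excludes it,
  and since \<open>sd c c = {}\<close> it forces every value to have square 1.\<close>

lemma bimult_unit:
  assumes e: "bimult r e" and sq: "e v v * e v v = 1" and v: "v \<in> Ceven r"
    and a: "a \<in> Ceven r" and b: "b \<in> Ceven r"
  shows "e a {} = 1" "e {} b = 1" "e a b * e a b = 1"
proof -
  note D = bimultD [OF e]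
  have *: "e c {} = 1" if c: "c \<in> Ceven r" for c
    using D(2) [OF c v v] D(1) [OF c c v] D(1) [OF v v v] sq by simp
  have **: "e {} b = 1"
    using D(1) [OF v v b] D(2) [OF v b b] * [OF v] by simp
  show "e a {} = 1" by (rule * [OF a])
  show "e {} b = 1" by (rule **)
  show "e a b * e a b = 1" using D(1) [OF a a b] ** by simp
qed

text \<open>This gives the uniqueness of \<open>eps\<close>. The value of square 1 at the basis
  vector 0 is what starts both inductions at the empty word.\<close>

lemma bimult_eqI:
  assumes r: "r \<ge> 1" and e: "bimult r e" and f: "bimult r f"
    and basis: "\<And>i j. i < 2 * r - 1 \<Longrightarrow> j < 2 * r - 1 \<Longrightarrow> e (vb r i) (vb r j) = f (vb r i) (vb r j)"
    and sq: "e (vb r 0) (vb r 0) * e (vb r 0) (vb r 0) = 1"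
    and a: "a \<in> Ceven r" and b: "b \<in> Ceven r"
  shows "e a b = f a b"
proof -
  have 0: "0 < 2 * r - 1" using r by simp
  have sq': "f (vb r 0) (vb r 0) * f (vb r 0) (vb r 0) = 1"
    using sq basis [OF 0 0] by simp
  note ue = bimult_unit [OF e, OF sq vb_in_Ceven [OF 0]]
  note uf = bimult_unit [OF f, OF sq' vb_in_Ceven [OF 0]]
  have *: "e a (vb r j) = f a (vb r j)" if j: "j < 2 * r - 1" for j
    using a
  proof (induction rule: Ceven_induct)
    case empty
    show ?case using ue(2) uf(2) vb_in_Ceven [OF j] by simp
  next
    case (add a k)
    then show ?case
      using bimultD(1) [OF e] bimultD(1) [OF f] basis j by (simp add: vb_in_Ceven)
  qed
  show ?thesis
    using b
  proof (induction rule: Ceven_induct)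
    case empty
    show ?case using ue(1) uf(1) a by simp
  next
    case (add b k)
    then show ?case
      using bimultD(2) [OF e] bimultD(2) [OF f] * a by (simp add: vb_in_Ceven)
  qed
qed

text \<open>The extension is written in coordinates. Since every \<open>epsval\<close> squares to 1,
  coordinates common to two words cancel, which makes the product multiplicative in each argument.
  The value 0 outside \<open>Ceven r\<close> is the one prescribed in \<open>eps\<close>.\<close>

lemma eps_exists:
  "\<exists>e. bimult r e \<and> (\<forall>i<2*r-1. \<forall>j<2*r-1. e (vb r i) (vb r j) = epsval r i j) \<and>
    (\<forall>a b. a \<notin> Ceven r \<or> b \<notin> Ceven r \<longrightarrow> e a b = 0)"
proof -
  let ?n = "2 * r - 1"
  define h where "h a b = (\<Prod>i<?n. \<Prod>j<?n.
    if vcoord r i a \<and> vcoord r j b then epsval r i j else 1)" for a b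
  have h1: "h (sd a b) c = h a c * h b c" for a b c
    unfolding h_def prod.distrib [symmetric]
    by (intro prod.cong refl) (auto simp: vcoord_sd epsval_square)
  have h2: "h a (sd b c) = h a b * h a c" for a b c
    unfolding h_def prod.distrib [symmetric]
    by (intro prod.cong refl) (auto simp: vcoord_sd epsval_square)
  have h3: "h (vb r k) (vb r l) = epsval r k l" if "k < ?n" "l < ?n" for k l
  proof -
    have "h (vb r k) (vb r l) = (\<Prod>i<?n. \<Prod>j<?n. if i = k \<and> j = l then epsval r i j else 1)"
      unfolding h_def using that by (intro prod.cong refl) (simp add: vcoord_vb)
    also have "\<dots> = (\<Prod>i<?n. if i = k then epsval r k l else 1)"
      by (intro prod.cong refl) (use that in auto)
    finally show ?thesis using that by simp
  qed
  define e where "e a b = (if a \<in> Ceven r \<and> b \<in> Ceven r then h a b else 0)" for a b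
  show ?thesis
    by (intro exI [of _ e] conjI)
      (auto simp: bimult_def e_def h1 h2 h3 Ceven_sd vb_in_Ceven)
qed

text \<open>Existence and uniqueness together make the definite description in \<open>eps\<close>
  meaningful.\<close>

lemma eps_props:
  assumes r: "r \<ge> 1"
  shows "bimult r (eps r) \<and> (\<forall>i<2*r-1. \<forall>j<2*r-1. eps r (vb r i) (vb r j) = epsval r i j)"
proof -
  let ?Q = "\<lambda>e. bimult r e \<and> (\<forall>i<2*r-1. \<forall>j<2*r-1. e (vb r i) (vb r j) = epsval r i j) \<and>
    (\<forall>a b. a \<notin> Ceven r \<or> b \<notin> Ceven r \<longrightarrow> e a b = 0)"
  have 0: "0 < 2 * r - 1" using r by simp
  have "e = f" if e: "?Q e" and f: "?Q f" for e f
  proof (intro ext)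
    fix a b
    show "e a b = f a b"
    proof (cases "a \<in> Ceven r \<and> b \<in> Ceven r")
      case True
      have "e (vb r 0) (vb r 0) * e (vb r 0) (vb r 0) = 1"
        using e 0 epsval_square by simp
      then show ?thesis
        using bimult_eqI [OF r, of e f a b] e f True by simp
    next
      case False
      then show ?thesis using e f by simp
    qed
  qed
  then have "\<exists>!e. ?Q e" using eps_exists [of r] by blast
  then have "?Q (THE e. ?Q e)" by (rule theI')
  then show ?thesis unfolding eps_def bimult_def by blast
qed

section \<open>Commutator, diagonal values and triviality on diagonal words\<close>

context
  fixes r :: nat
  assumes r: "r \<ge> 1"
begin

lemma eps_add_left: "a \<in> Ceven r \<Longrightarrow> b \<in> Ceven r \<Longrightarrow> c \<in> Ceven r \<Longrightarrow>
    eps r (sd a b) c = eps r a c * eps r b c"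
  and eps_add_right: "a \<in> Ceven r \<Longrightarrow> b \<in> Ceven r \<Longrightarrow> c \<in> Ceven r \<Longrightarrow>
    eps r a (sd b c) = eps r a b * eps r a c"
  using eps_props [OF r] bimultD by blast+

lemma eps_basis: "i < 2 * r - 1 \<Longrightarrow> j < 2 * r - 1 \<Longrightarrow> eps r (vb r i) (vb r j) = epsval r i j"
  using eps_props [OF r] by blast

lemma eps_empty_right [simp]: "a \<in> Ceven r \<Longrightarrow> eps r a {} = 1"
  and eps_empty_left [simp]: "a \<in> Ceven r \<Longrightarrow> eps r {} a = 1"
  and eps_square [simp]: "a \<in> Ceven r \<Longrightarrow> b \<in> Ceven r \<Longrightarrow> eps r a b * eps r a b = 1"
proof -
  have 0: "0 < 2 * r - 1" using r by simp
  have sq: "eps r (vb r 0) (vb r 0) * eps r (vb r 0) (vb r 0) = 1"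
    using 0 by (simp add: eps_basis epsval_square)
  note u = bimult_unit [OF conjunct1 [OF eps_props [OF r]], OF sq vb_in_Ceven [OF 0]]
  show "eps r a {} = 1" "eps r {} a = 1" if "a \<in> Ceven r"
    using u [OF that that] by auto
  show "eps r a b * eps r a b = 1" if "a \<in> Ceven r" "b \<in> Ceven r"
    using u [OF that] by auto
qed

lemma sg_Int_sd: "sg r (sd a b \<inter> c) = sg r (a \<inter> c) * sg r (b \<inter> c)"
  and sg_Int_sd': "sg r (c \<inter> sd a b) = sg r (c \<inter> a) * sg r (c \<inter> b)"
proof -
  have "sd a b \<inter> c = sd (a \<inter> c) (b \<inter> c)" "c \<inter> sd a b = sd (c \<inter> a) (c \<inter> b)" by auto
  then show "sg r (sd a b \<inter> c) = sg r (a \<inter> c) * sg r (b \<inter> c)"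
    "sg r (c \<inter> sd a b) = sg r (c \<inter> a) * sg r (c \<inter> b)" by (simp_all add: sg_sd)
qed

lemma sg_vb: "k < 2 * r - 1 \<Longrightarrow> sg r (vb r k) = 1"
  using vb_in_Ceven [of k r] by (simp add: sg_def Ceven_def sgn_int_even)

lemma sg_square [simp]: "sg r a * sg r a = 1" "sg r a * (sg r a * x) = x"
  by (simp_all add: sg_def)

text \<open>Both sides are bimultiplicative, so basis vectors suffice. There \<open>epsval\<close>
  puts the sign on just one of the two orders, and for equal vectors the sign is 1 because basis
  vectors have even weight.\<close>

lemma eps_commute:
  assumes a: "a \<in> Ceven r" and b: "b \<in> Ceven r"
  shows "eps r a b = sg r (a \<inter> b) * eps r b a"
proof -
  have vv: "eps r (vb r k) (vb r j) = sg r (vb r k \<inter> vb r j) * eps r (vb r j) (vb r k)"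
    if "k < 2 * r - 1" "j < 2 * r - 1" for k j
    using that by (auto simp: eps_basis epsval_def sg_vb sg_def [symmetric] Int_commute)
  have va: "eps r a (vb r j) = sg r (a \<inter> vb r j) * eps r (vb r j) a" if j: "j < 2 * r - 1" for j
    using a
  proof (induction rule: Ceven_induct)
    case empty
    then show ?case using j by (simp add: vb_in_Ceven sg_def)
  next
    case (add a k)
    then show ?case
      using j vv [of k j] by (simp add: eps_add_left eps_add_right vb_in_Ceven sg_Int_sd)
  qed
  show ?thesis
    using b
  proof (induction rule: Ceven_induct)
    case empty
    then show ?case using a by (simp add: sg_def)
  next
    case (add b k)
    then show ?case
      using a va [of k] by (simp add: eps_add_left eps_add_right vb_in_Ceven sg_Int_sd')
  qed
qed

text \<open>Expanding \<open>eps r (sd a v) (sd a v)\<close> produces the cross terms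
  \<open>eps r a v * eps r v a\<close>, which is the commutator sign; hence the left side obeys the
  same quadratic law \<open>iw_sd\<close> as the right.\<close>

lemma eps_diag: "a \<in> Ceven r \<Longrightarrow> eps r a a = iw r a"
proof (induction rule: Ceven_induct)
  case empty
  then show ?case by (simp add: iw_def)
next
  case (add a k)
  have "eps r (vb r k) (vb r k) = iw r (vb r k)"
    using add vb_in_Ceven [of k r] by (simp add: eps_basis epsval_def iw_half Ceven_def)
  then show ?case
    using add eps_commute [of "vb r k" a]
    by (simp add: eps_add_left eps_add_right vb_in_Ceven Ceven_sd iw_sd Int_commute)
qed

text \<open>The first r basis vectors generate the diagonal words, are pairwise disjoint and have
  weight 0, so every \<open>epsval\<close> among them is 1. This is what makes the e_\<gamma> span
  an untwisted group algebra.\<close>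

lemma eps_Delta: "g \<subseteq> {..<r} \<Longrightarrow> h \<subseteq> {..<r} \<Longrightarrow> eps r (Delta r g) (Delta r h) = 1"
proof -
  assume g: "g \<subseteq> {..<r}" and h: "h \<subseteq> {..<r}"
  have ins: "Delta r (insert i f) = sd (vb r i) (Delta r f)"
    if "insert i f \<subseteq> {..<r}" "i \<notin> f" for i f
    using that by (intro set_eqI) (auto simp: vb_def mem_Delta)
  have vC: "vb r i \<in> Ceven r" if "i < r" for i
    using that r by (intro vb_in_Ceven) simp
  have vv: "eps r (vb r i) (vb r j) = 1" if "i < r" "j < r" for i j
  proof -
    have "vb r i \<inter> vb r j = {}" if "i \<noteq> j"
      using that \<open>i < r\<close> \<open>j < r\<close> by (auto simp: vb_def mem_Delta)
    moreover have "swt r r (vb r i) = 0"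
      using \<open>i < r\<close> by (simp add: vb_def swt_Delta)
    ultimately show ?thesis
      using that by (auto simp: eps_basis epsval_def)
  qed
  have vD: "eps r (vb r i) (Delta r h) = 1" if i: "i < r" for i
    using finite_subset [OF h finite_lessThan] h
  proof (induction h rule: finite_induct)
    case empty
    show ?case using i by (simp add: Delta_def vC)
  next
    case (insert j f)
    then show ?case
      using i vv by (simp add: ins eps_add_right vC Delta_in_Ceven)
  qed
  show ?thesis
    using finite_subset [OF g finite_lessThan] g
  proof (induction g rule: finite_induct)
    case empty
    show ?case using h by (simp add: Delta_def [of r "{}"] Delta_in_Ceven)
  next
    case (insert j f)
    then show ?case
      using h vD by (simp add: ins eps_add_left vC Delta_in_Ceven)
  qed
qed

end

subsection \<open>Linear maps on coefficient functions\<close>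

definition sc :: "complex \<Rightarrow> vec \<Rightarrow> vec" where
  "sc c v = (\<lambda>x. c * v x)"

lemma sc_apply [simp]: "sc c v x = c * v x"
  by (simp add: sc_def)

lemma sum_fun_apply: "(sum f A) x = (\<Sum>a\<in>A. f a x)"
  by (induction A rule: infinite_finite_induct) simp_all

lemma sc_sc [simp]: "sc a (sc b v) = sc (a * b) v"
  by (rule ext) simp

lemma sc_one [simp]: "sc 1 v = v"
  by (rule ext) simp

lemma sc_zero [simp]: "sc 0 v = 0" "sc c 0 = 0"
  by (rule ext, simp)+

lemma sc_sum: "sc c (sum f A) = (\<Sum>a\<in>A. sc c (f a))"
  by (rule ext) (simp add: sum_fun_apply sum_distrib_left)

definition vlin :: "(vec \<Rightarrow> vec) \<Rightarrow> bool" where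
  "vlin F \<longleftrightarrow> (\<forall>u v. F (u + v) = F u + F v) \<and> (\<forall>c v. F (sc c v) = sc c (F v))"

lemma vlinI:
  "(\<And>u v. F (u + v) = F u + F v) \<Longrightarrow> (\<And>c v. F (sc c v) = sc c (F v)) \<Longrightarrow> vlin F"
  by (simp add: vlin_def)

lemma vlin_add: "vlin F \<Longrightarrow> F (u + v) = F u + F v"
  and vlin_sc: "vlin F \<Longrightarrow> F (sc c v) = sc c (F v)"
  by (simp_all add: vlin_def)

lemma vlin_zero: "vlin F \<Longrightarrow> F 0 = 0"
  using vlin_sc [of F 0 0] by simp

lemma vlin_minus: "vlin F \<Longrightarrow> F (u - v) = F u - F v"
proof -
  assume F: "vlin F"
  have "u - v = u + sc (- 1) v" by (rule ext) simp
  then have "F (u - v) = F (u + sc (- 1) v)" by (rule arg_cong)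
  also have "\<dots> = F u + sc (- 1) (F v)" using vlin_add [OF F] vlin_sc [OF F] by metis
  finally show ?thesis by (intro ext) simp
qed

lemma vlin_sum: "vlin F \<Longrightarrow> F (sum f A) = (\<Sum>a\<in>A. F (f a))"
  by (induction A rule: infinite_finite_induct) (simp_all add: vlin_zero [of F] vlin_add [of F])

lemma vlin_comp: "vlin F \<Longrightarrow> vlin F' \<Longrightarrow> vlin (\<lambda>v. F (F' v))"
  by (simp add: vlin_def)

lemma vlin_const_zero: "vlin (\<lambda>v. 0)"
  by (simp add: vlin_def)

lemma vlin_sum_fun: "(\<And>i. i \<in> I \<Longrightarrow> vlin (F i)) \<Longrightarrow> vlin (\<lambda>v. \<Sum>i\<in>I. sc (c i) (F i v))"
  by (intro vlinI ext) (simp_all add: vlin_def sum_fun_apply sum.distrib distrib_left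
      sum_distrib_left mult_ac)

section \<open>Basis vectors, the sign of the product and grade projections\<close>

lemma delta_apply: "delta d a x = (if x = (d, a) then 1 else 0)"
  by (simp add: delta_def)

text \<open>The sign of the product with the halved exponent replaced by \<open>iw\<close>, so that
  it splits over positions; on codewords it agrees with \<open>sign_exp\<close>.\<close>

definition ss :: "nat \<Rightarrow> nat set \<Rightarrow> nat set \<Rightarrow> nat set \<Rightarrow> nat set \<Rightarrow> complex" where
  "ss r d1 a1 d2 a2 = sg r ((d1 - d2) \<inter> a1 \<inter> a2) * sg r (d1 \<inter> d2 \<inter> a2) * iw r (d1 \<inter> a2)"

definition pr :: "grade \<Rightarrow> vec \<Rightarrow> vec" where
  "pr m v = (\<lambda>(d, a). if m = gof d (a - d) then v (d, a) else 0)"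

lemma pr_apply: "pr m v (d, a) = (if m = gof d (a - d) then v (d, a) else 0)"
  by (simp add: pr_def)

lemma pr_delta: "pr m (delta d a) = (if m = gof d (a - d) then delta d a else 0)"
  by (rule ext) (auto simp: pr_def delta_apply split: prod.splits)

lemma vlin_pr: "vlin (pr m)"
  by (intro vlinI ext) (auto simp: pr_def)

lemma pr_pr: "pr m (pr m' v) = (if m = m' then pr m v else 0)"
  by (intro ext) (auto simp: pr_def)

section \<open>The codes \<open>D\<close> and \<open>C\<close> and the diagonal words
  \<open>P d\<close>\<close>

locale code_setup =
  fixes r :: nat and G :: "nat set set"
  assumes r: "r \<ge> 1" and G: "is_subgroup r G" and top: "{..<r} \<in> G"
begin

abbreviation "D \<equiv> DG r G"
abbreviation "C \<equiv> CG r G"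
abbreviation "P \<equiv> Deltad r"
abbreviation "V \<equiv> Vsp r G"

lemma D_E: "d \<in> D \<Longrightarrow> (\<And>g. g \<in> G \<Longrightarrow> g \<subseteq> {..<r} \<Longrightarrow> d = Delta r g \<Longrightarrow> thesis) \<Longrightarrow> thesis"
  using G by (auto simp: DG_def is_subgroup_def)

lemma D_sub: "d \<in> D \<Longrightarrow> d \<subseteq> {..<2 * r}"
  by (erule D_E) (auto simp: mem_Delta subset_iff)

lemma D_diag: "d \<in> D \<Longrightarrow> i < r \<Longrightarrow> i + r \<in> d \<longleftrightarrow> i \<in> d"
  by (erule D_E) (auto simp: mem_Delta)

lemma D_empty [simp]: "{} \<in> D"
  using G by (force simp: DG_def is_subgroup_def Delta_def)

lemma Delta_sd: "sd (Delta r g) (Delta r h) = Delta r (sd g h)" if "g \<subseteq> {..<r}" "h \<subseteq> {..<r}"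
  using that by (intro set_eqI) (auto simp: mem_Delta)

lemma D_sd: "d \<in> D \<Longrightarrow> d' \<in> D \<Longrightarrow> sd d d' \<in> D"
  by (elim D_E) (use G in \<open>auto simp: Delta_sd DG_def is_subgroup_def\<close>)

lemma D_top: "{..<2 * r} \<in> D"
proof -
  have "{..<2 * r} = Delta r {..<r}" by (rule set_eqI) (auto simp: mem_Delta)
  then show ?thesis using top by (auto simp: DG_def)
qed

lemma C_sub: "a \<in> C \<Longrightarrow> a \<subseteq> {..<2 * r}"
  by (simp add: CG_def perp_def mult_2)

lemma C_even: "a \<in> C \<Longrightarrow> d \<in> D \<Longrightarrow> even (swt r r (a \<inter> d))"
  by (simp add: CG_def perp_def)

lemma C_Ceven: "a \<in> C \<Longrightarrow> a \<in> Ceven r"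
  using C_even [OF _ D_top, of a] C_sub [of a] by (simp add: Ceven_def Int_absorb2)

lemma sg_CD: "a \<in> C \<Longrightarrow> d \<in> D \<Longrightarrow> sg r (d \<inter> a) = 1"
  using C_even [of a d] by (simp add: sg_def sgn_int_even Int_commute)

lemma C_empty [simp]: "{} \<in> C"
  by (simp add: CG_def perp_def)

lemma C_sd: "a \<in> C \<Longrightarrow> b \<in> C \<Longrightarrow> sd a b \<in> C"
proof -
  assume a: "a \<in> C" and b: "b \<in> C"
  have "even (swt r r (sd a b \<inter> d))" if "d \<in> D" for d
  proof -
    have "sd a b \<inter> d = sd (a \<inter> d) (b \<inter> d)" by auto
    then show ?thesis using C_even [OF a that] C_even [OF b that] by (simp add: swt_sd)
  qed
  then show ?thesis
    using a b sd_subset [of a "{..<r+r}" b] by (simp add: CG_def perp_def)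
qed

lemma finite_D: "finite D" and finite_C: "finite C"
  using D_sub C_sub finite_subset [of _ "Pow {..<2 * r}"] by blast+

lemma finite_DC: "finite (D \<times> C)"
  by (simp add: finite_D finite_C)

lemma P_diag: "x \<in> P d \<Longrightarrow> i < r \<Longrightarrow> i + r \<in> x \<longleftrightarrow> i \<in> x"
  by (auto simp: Deltad_def mem_Delta)

lemma P_sub: "x \<in> P d \<Longrightarrow> x \<subseteq> d"
  by (simp add: Deltad_def)

lemma P_iff: "x \<in> P d \<longleftrightarrow> x \<subseteq> d \<and> x \<in> P {..<2 * r}"
proof -
  have "Delta r g \<subseteq> {..<2 * r}" if "g \<subseteq> {..<r}" for g
    using that by (auto simp: mem_Delta subset_iff)
  then show ?thesis by (auto simp: Deltad_def)
qed

lemma P_lim: "x \<in> P d \<Longrightarrow> x \<in> P {..<2 * r}"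
  unfolding P_iff [of x d] by (rule conjunct2)

lemma P_empty [simp]: "{} \<in> P d"
  by (auto simp: Deltad_def Delta_def)

lemma P_sd: "x \<in> P d \<Longrightarrow> y \<in> P d \<Longrightarrow> sd x y \<in> P d"
proof -
  assume x: "x \<in> P d" and y: "y \<in> P d"
  then obtain g h where gh: "g \<subseteq> {..<r}" "h \<subseteq> {..<r}" "x = Delta r g" "y = Delta r h"
    by (auto simp: Deltad_def)
  then have "sd x y = Delta r (sd g h)" "sd g h \<subseteq> {..<r}"
    by (simp_all add: Delta_sd sd_subset)
  moreover have "sd x y \<subseteq> d" using x y by (auto simp: Deltad_def)
  ultimately show ?thesis unfolding Deltad_def by blast
qed

lemma P_Int_D:
  assumes x: "x \<in> P d" and d': "d' \<in> D"
  shows "x \<inter> d' \<in> P (d \<inter> d')"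
proof -
  obtain g where g: "g \<subseteq> {..<r}" "d' = Delta r g" using d' by (rule D_E)
  obtain h where h: "h \<subseteq> {..<r}" "x = Delta r h" "x \<subseteq> d" using x by (auto simp: Deltad_def)
  have "x \<inter> d' = Delta r (h \<inter> g)"
    unfolding g h(2) using g(1) h(1) by (intro set_eqI) (auto simp: mem_Delta)
  moreover have "h \<inter> g \<subseteq> {..<r}" "x \<inter> d' \<subseteq> d \<inter> d'" using h by auto
  ultimately show ?thesis by (auto simp: Deltad_def)
qed

lemma P_Diff_D: "x \<in> P d \<Longrightarrow> d' \<in> D \<Longrightarrow> x - d' \<in> P (d - d')"
proof -
  assume x: "x \<in> P d" and d': "d' \<in> D"
  have "x - d' = sd x (x \<inter> d')" by auto
  moreover have "x \<inter> d' \<in> P d"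
    using P_Int_D [OF x d'] unfolding P_iff [of _ "d \<inter> d'"] P_iff [of _ d] by blast
  ultimately have "x - d' \<in> P d" using P_sd [OF x] by simp
  then show ?thesis unfolding P_iff [of _ "d - d'"] P_iff [of _ d] by blast
qed

lemma P_Delta: "x \<in> P d \<Longrightarrow> \<exists>g\<subseteq>{..<r}. x = Delta r g"
  by (auto simp: Deltad_def)

lemma finite_P: "finite (P d)"
proof -
  have "x \<subseteq> {..<2 * r}" if "x \<in> P d" for x
    using P_sub [OF P_lim [OF that]] .
  then have "P d \<subseteq> Pow {..<2 * r}" by blast
  then show ?thesis by (rule finite_subset) simp
qed

text \<open>A diagonal word meets each word of \<open>D\<close> in a diagonal word, whose signed
  weight is 0.\<close>

lemma P_C: "x \<in> P d \<Longrightarrow> x \<in> C"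
proof -
  assume x: "x \<in> P d"
  have "x \<subseteq> {..<r + r}" using P_sub [OF P_lim [OF x]] by (simp add: mult_2)
  moreover have "even (swt r r (x \<inter> d'))" if "d' \<in> D" for d'
    using P_diag [OF x] D_diag [OF that] by (subst swt_diag) auto
  ultimately show ?thesis by (simp add: CG_def perp_def)
qed

lemma eps_PP: "x \<in> P d \<Longrightarrow> y \<in> P d' \<Longrightarrow> eps r x y = 1"
  using eps_Delta [OF r] P_Delta by metis

lemmas eps_addl = eps_add_left [OF r C_Ceven C_Ceven C_Ceven]
lemmas eps_addr = eps_add_right [OF r C_Ceven C_Ceven C_Ceven]
lemmas eps_sq = eps_square [OF r C_Ceven C_Ceven]
lemmas eps_comm = eps_commute [OF r C_Ceven C_Ceven]
lemmas eps_er = eps_empty_right [OF r C_Ceven]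
lemmas eps_el = eps_empty_left [OF r C_Ceven]

lemma eps_sq_left: "a \<in> C \<Longrightarrow> b \<in> C \<Longrightarrow> eps r a b * (eps r a b * x) = x"
  using eps_sq [of a b] by (simp add: mult.assoc [symmetric])

lemma sum_P_shift:
  assumes "y \<in> P d"
  shows "(\<Sum>x\<in>P d. f (sd x y)) = (\<Sum>x\<in>P d. f x)"
  by (rule sum.reindex_bij_witness [where i = "\<lambda>x. sd x y" and j = "\<lambda>x. sd x y"])
    (use assms P_sd in auto)

subsection \<open>The relations as a kernel\<close>

text \<open>Off \<open>D \<times> C\<close> the map is the identity, so its kernel is automatically
  supported on \<open>D \<times> C\<close> and can equal the span of the relations without any
  restriction to \<open>V\<close>.\<close>

definition L :: "vec \<Rightarrow> vec" where
  "L v = (\<lambda>(d, a). if d \<in> D \<and> a \<in> C then \<Sum>x\<in>P d. eps r a x * v (d, sd a x) else v (d, a))"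

lemma L_apply: "d \<in> D \<Longrightarrow> a \<in> C \<Longrightarrow> L v (d, a) = (\<Sum>x\<in>P d. eps r a x * v (d, sd a x))"
  by (simp add: L_def)

lemma L_out: "x \<notin> D \<times> C \<Longrightarrow> L v x = v x"
  by (auto simp: L_def split: prod.splits)

lemma vlin_L: "vlin L"
  by (intro vlinI ext)
    (simp_all add: L_def distrib_left sum.distrib sum_distrib_left mult.left_commute split: prod.split)

text \<open>Translating the summation word by x moves the support from \<open>sd a x\<close> back to
  \<open>a\<close>; the cocycle contributes only \<open>eps r a x\<close>, being trivial between
  diagonal words. Since this factor squares to 1, the relations lie in the kernel.\<close>

lemma L_delta_shift:
  assumes d: "d \<in> D" and a: "a \<in> C" and x: "x \<in> P d"
  shows "L (delta d (sd a x)) = sc (eps r a x) (L (delta d a))"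
proof (rule ext)
  fix z :: "nat set \<times> nat set"
  obtain d' b where z: "z = (d', b)" by (cases z)
  have ax: "sd a x \<in> C" using a x P_C C_sd by blast
  show "L (delta d (sd a x)) z = sc (eps r a x) (L (delta d a)) z"
  proof (cases "d' = d \<and> b \<in> C")
    case True
    have "L (delta d (sd a x)) z = (\<Sum>y\<in>P d. eps r b y * delta d (sd a x) (d, sd b y))"
      using z True d by (simp add: L_apply)
    also have "\<dots> = (\<Sum>y\<in>P d. eps r b (sd y x) * delta d (sd a x) (d, sd b (sd y x)))"
      by (rule sum_P_shift [OF x, symmetric])
    also have "\<dots> = (\<Sum>y\<in>P d. eps r a x * (eps r b y * delta d a (d, sd b y)))"
    proof (rule sum.cong [OF refl])
      fix y assume y: "y \<in> P d"
      have eq: "sd b (sd y x) = sd a x \<longleftrightarrow> sd b y = a"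
        by (metis sd_assoc sd_cancel_right)
      show "eps r b (sd y x) * delta d (sd a x) (d, sd b (sd y x)) =
          eps r a x * (eps r b y * delta d a (d, sd b y))"
      proof (cases "sd b y = a")
        case ba: True
        then have "eps r a x = eps r b x"
          using True P_C [OF x] P_C [OF y] eps_PP [OF y x] by (auto simp: eps_addl)
        then show ?thesis
          using eq ba True P_C [OF x] P_C [OF y] by (simp add: delta_apply eps_addr)
      next
        case False
        then show ?thesis using eq by (simp add: delta_apply)
      qed
    qed
    also have "\<dots> = sc (eps r a x) (L (delta d a)) z"
      using z True d by (simp add: L_apply sum_distrib_left)
    finally show ?thesis .
  next
    case False
    have "L (delta d c) (d', b) = 0" if c: "c \<in> C" for c
    proof (cases "d' \<in> D \<and> b \<in> C")
      case True
      then have "d' \<noteq> d" using False by simp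
      then show ?thesis using True by (simp add: L_apply delta_apply)
    next
      case out: False
      then have "L (delta d c) (d', b) = delta d c (d', b)" by (intro L_out) simp
      then show ?thesis using out d c by (auto simp: delta_apply)
    qed
    then show ?thesis using z a ax by simp
  qed
qed

lemma relgen_eq: "relgen r (d, a, x) = sc (eps r a x) (delta d (sd a x)) - delta d a"
  by (rule ext) (simp add: relgen_def)

lemma L_relgen: "i \<in> relidx r G \<Longrightarrow> L (relgen r i) = 0"
  by (cases i) (auto simp: relidx_def relgen_eq vlin_minus [OF vlin_L] vlin_sc [OF vlin_L]
      L_delta_shift eps_sq P_C)

lemma Nsp_iff_sum: "v \<in> Nsp r G \<longleftrightarrow> (\<exists>k. v = (\<Sum>i\<in>relidx r G. sc (k i) (relgen r i)))"
  unfolding Nsp_def by (simp add: fun_eq_iff sum_fun_apply)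

lemma Nsp_eq: "Nsp r G = {v. L v = 0}"
proof (intro equalityI subsetI)
  fix v assume "v \<in> Nsp r G"
  then obtain k where "v = (\<Sum>i\<in>relidx r G. sc (k i) (relgen r i))"
    using Nsp_iff_sum by blast
  then have "L v = 0"
    by (simp add: vlin_sum [OF vlin_L] vlin_sc [OF vlin_L] L_relgen)
  then show "v \<in> {v. L v = 0}" by simp
next
  fix v assume "v \<in> {v. L v = 0}"
  then have Lv: "L v z = 0" for z by simp
  \<comment> \<open>Averaging over \<open>P d\<close>: the relations with these coefficients add up
    to v - L v / |P d|, which is v itself on the kernel of \<open>L\<close>.\<close>
  define k where "k = (\<lambda>(d, a, x :: nat set). - v (d, a) / of_nat (card (P d)))"
  have rel: "relidx r G = (SIGMA d:D. C \<times> P d)" by (auto simp: relidx_def)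
  have split: "(\<Sum>i\<in>relidx r G. k i * relgen r i z) =
      (\<Sum>d\<in>D. \<Sum>a\<in>C. \<Sum>x\<in>P d. k (d, a, x) * relgen r (d, a, x) z)" for z
    unfolding rel by (simp add: sum.Sigma finite_D finite_C finite_P)
  have "v z = (\<Sum>i\<in>relidx r G. k i * relgen r i z)" for z
  proof (cases "z \<in> D \<times> C")
    case False
    then have "relgen r i z = 0" if "i \<in> relidx r G" for i
      using that P_C C_sd by (auto simp: relgen_def relidx_def delta_apply)
    then show ?thesis using Lv [of z] L_out [OF False] by simp
  next
    case True
    then obtain d b where z: "z = (d, b)" and d: "d \<in> D" and b: "b \<in> C" by auto
    have "\<exists>x. x \<in> P d" using P_empty by (rule exI)
    then have "card (P d) \<noteq> 0" using finite_P [of d] by (metis card_0_eq empty_iff)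
    then have c0: "of_nat (card (P d)) \<noteq> (0 :: complex)" by simp
    have "(\<Sum>i\<in>relidx r G. k i * relgen r i z) =
        (\<Sum>d'\<in>D. if d' = d then \<Sum>a\<in>C. \<Sum>x\<in>P d. k (d, a, x) * relgen r (d, a, x) z else 0)"
      unfolding split
      by (rule sum.cong [OF refl]) (auto simp: z relgen_def delta_apply intro!: sum.neutral)
    also have "\<dots> = (\<Sum>a\<in>C. \<Sum>x\<in>P d. k (d, a, x) * relgen r (d, a, x) z)"
      using d finite_D by simp
    also have "\<dots> = (\<Sum>x\<in>P d. \<Sum>a\<in>C. k (d, a, x) * relgen r (d, a, x) z)"
      by (rule sum.swap)
    also have "\<dots> = (\<Sum>x\<in>P d. v (d, b) / of_nat (card (P d))
        - eps r b x * v (d, sd b x) / of_nat (card (P d)))"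
    proof (rule sum.cong [OF refl])
      fix x assume x: "x \<in> P d"
      have bx: "sd b x \<in> C" using b x P_C C_sd by blast
      have "eps r (sd b x) x = eps r b x"
        using b x P_C eps_PP [OF x x] by (simp add: eps_addl)
      have eq: "b = sd a x \<longleftrightarrow> a = sd b x" for a
        by (metis sd_cancel_right)
      have rg: "relgen r (d, a, x) z =
          (if a = sd b x then eps r a x else 0) - (if a = b then 1 else 0)" for a
        unfolding relgen_def z delta_apply prod.case prod.inject eq by auto
      have "(\<Sum>a\<in>C. k (d, a, x) * relgen r (d, a, x) z) =
          (\<Sum>a\<in>C. if a = sd b x then - (eps r b x * v (d, sd b x) / of_nat (card (P d))) else 0)
          + (\<Sum>a\<in>C. if a = b then v (d, b) / of_nat (card (P d)) else 0)"
        unfolding sum.distrib [symmetric]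
        by (rule sum.cong [OF refl])
          (auto simp: rg k_def \<open>eps r (sd b x) x = eps r b x\<close> add_divide_distrib right_diff_distrib)
      also have "\<dots> = v (d, b) / of_nat (card (P d)) - eps r b x * v (d, sd b x) / of_nat (card (P d))"
        using b bx finite_C by simp
      finally show "(\<Sum>a\<in>C. k (d, a, x) * relgen r (d, a, x) z) = \<dots>" .
    qed
    also have "\<dots> = v (d, b) - L v (d, b) / of_nat (card (P d))"
      using c0 by (simp add: sum_subtractf sum_divide_distrib L_apply d b)
    also have "\<dots> = v z" using Lv z by simp
    finally show ?thesis by simp
  qed
  then show "v \<in> Nsp r G" unfolding Nsp_def by blast
qed

lemma coset_eq: "coset r G v = {w. L w = L v}"
proof -
  have "w \<in> coset r G v \<longleftrightarrow> L w = L v" for w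
  proof -
    have "w \<in> coset r G v \<longleftrightarrow> (\<exists>n. L n = 0 \<and> w = v + n)"
      unfolding coset_def Nsp_eq by (auto simp: plus_fun_def)
    also have "\<dots> \<longleftrightarrow> L (w - v) = 0"
    proof
      assume "L (w - v) = 0"
      then show "\<exists>n. L n = 0 \<and> w = v + n" by (intro exI [of _ "w - v"]) simp
    qed auto
    also have "\<dots> \<longleftrightarrow> L w = L v" by (simp add: vlin_minus [OF vlin_L])
    finally show ?thesis .
  qed
  then show ?thesis by blast
qed

lemma coset_cong: "coset r G v = coset r G w \<longleftrightarrow> L v = L w"
  unfolding coset_eq by auto

text \<open>The representative chosen by \<open>SOME\<close> is unknown, but it lies in the same
  fibre of \<open>L\<close>, and nothing more about it is ever used.\<close>

lemma L_rep: "L (rep (coset r G v)) = L v"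
proof -
  have "rep (coset r G v) \<in> coset r G v"
    unfolding rep_def by (rule someI [of _ v]) (simp add: coset_eq)
  then show ?thesis by (simp add: coset_eq)
qed

lemma V_L: "L v = L w \<Longrightarrow> v \<in> V \<longleftrightarrow> w \<in> V"
proof -
  assume *: "L v = L w"
  have "v x = w x" if "x \<notin> D \<times> C" for x
    using fun_cong [OF *, of x] L_out [OF that] by simp
  then show ?thesis by (auto simp: Vsp_def)
qed

lemma rep_V: "v \<in> V \<Longrightarrow> rep (coset r G v) \<in> V"
  using V_L [OF L_rep] by blast

lemma V_iff: "v \<in> V \<longleftrightarrow> (\<forall>x. x \<notin> D \<times> C \<longrightarrow> v x = 0)"
  by (simp add: Vsp_def)

lemma V_zero: "0 \<in> V" and V_add: "u \<in> V \<Longrightarrow> v \<in> V \<Longrightarrow> u + v \<in> V"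
  and V_sc: "v \<in> V \<Longrightarrow> sc c v \<in> V" and V_sum: "(\<And>i. i \<in> I \<Longrightarrow> f i \<in> V) \<Longrightarrow> sum f I \<in> V"
  and V_pr: "v \<in> V \<Longrightarrow> pr m v \<in> V"
  and V_delta: "d \<in> D \<Longrightarrow> a \<in> C \<Longrightarrow> delta d a \<in> V"
  by (auto simp: V_iff sum_fun_apply pr_apply delta_apply)

lemma V_expand: "v \<in> V \<Longrightarrow> v = (\<Sum>x\<in>D \<times> C. sc (v x) (delta (fst x) (snd x)))"
proof (rule ext)
  fix z assume v: "v \<in> V"
  have "(\<Sum>x\<in>D \<times> C. sc (v x) (delta (fst x) (snd x))) z = (\<Sum>x\<in>D \<times> C. if x = z then v z else 0)"
    unfolding sum_fun_apply by (rule sum.cong) (auto simp: delta_apply)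
  also have "\<dots> = v z"
  proof (cases "z \<in> D \<times> C")
    case False
    then have "v z = 0" using v unfolding V_iff by blast
    then show ?thesis by (auto intro: sum.neutral)
  qed (use finite_DC in simp)
  finally show "v z = (\<Sum>x\<in>D \<times> C. sc (v x) (delta (fst x) (snd x))) z" by simp
qed

text \<open>Agreement is required only where the coefficient of \<open>v\<close> is nonzero; this is
  how the homogeneity of \<open>v\<close> later determines the grades of the basis vectors.\<close>

lemma vlin_ext:
  assumes "vlin F" "vlin F'" "v \<in> V"
    and "\<And>d a. d \<in> D \<Longrightarrow> a \<in> C \<Longrightarrow> v (d, a) \<noteq> 0 \<Longrightarrow> F (delta d a) = F' (delta d a)"
  shows "F v = F' v"
proof -
  have ex: "H v = (\<Sum>x\<in>D \<times> C. sc (v x) (H (delta (fst x) (snd x))))" if H: "vlin H" for H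
    using arg_cong [OF V_expand [OF assms(3)], of H]
    unfolding vlin_sum [OF H] vlin_sc [OF H] .
  have "F v = (\<Sum>x\<in>D \<times> C. sc (v x) (F (delta (fst x) (snd x))))"
    by (rule ex [OF assms(1)])
  also have "\<dots> = (\<Sum>x\<in>D \<times> C. sc (v x) (F' (delta (fst x) (snd x))))"
  proof (rule sum.cong [OF refl])
    fix x assume "x \<in> D \<times> C"
    then show "sc (v x) (F (delta (fst x) (snd x))) = sc (v x) (F' (delta (fst x) (snd x)))"
      using assms(4) [of "fst x" "snd x"] by (cases "v x = 0") auto
  qed
  also have "\<dots> = F' v"
    by (rule ex [OF assms(2), symmetric])
  finally show ?thesis .
qed

text \<open>A linear map that kills the relations factors through the quotient, hence depends only
  on \<open>L\<close>.\<close>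

lemma vlin_ker:
  assumes F: "vlin F" and rel: "\<And>i. i \<in> relidx r G \<Longrightarrow> F (relgen r i) = 0"
    and uv: "L u = L v"
  shows "F u = F v"
proof -
  have "u - v \<in> Nsp r G" using uv by (simp add: Nsp_eq vlin_minus [OF vlin_L])
  then obtain k where "u - v = (\<Sum>i\<in>relidx r G. sc (k i) (relgen r i))"
    using Nsp_iff_sum by blast
  then have "F (u - v) = 0" by (simp add: vlin_sum [OF F] vlin_sc [OF F] rel)
  then show ?thesis by (simp add: vlin_minus [OF F])
qed

text \<open>A translation by x inside d leaves \<open>a - d\<close>, and so the grade, unchanged.
  Hence the grade projections descend to the quotient.\<close>

lemma L_pr: "L (pr m v) = pr m (L v)"
proof (rule ext)
  fix z :: "nat set \<times> nat set"
  obtain d a where z: "z = (d, a)" by (cases z)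
  show "L (pr m v) z = pr m (L v) z"
  proof (cases "d \<in> D \<and> a \<in> C")
    case True
    have *: "gof d (sd a x - d) = gof d (a - d)" if "x \<in> P d" for x
    proof -
      have "sd a x - d = a - d" using P_sub [OF that] by auto
      then show ?thesis by simp
    qed
    have "L (pr m v) z = (\<Sum>x\<in>P d. eps r a x * pr m v (d, sd a x))"
      using True z by (simp add: L_apply)
    also have "\<dots> = (\<Sum>x\<in>P d. if m = gof d (a - d) then eps r a x * v (d, sd a x) else 0)"
      by (rule sum.cong [OF refl]) (simp add: pr_apply *)
    also have "\<dots> = pr m (L v) z"
      using True z by (simp add: pr_apply L_apply)
    finally show ?thesis .
  next
    case False
    then have "z \<notin> D \<times> C" using z by simp
    then show ?thesis using L_out [of "(d, a)" v] L_out [of "(d, a)" "pr m v"]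
      unfolding z pr_apply by simp
  qed
qed

subsection \<open>The product modulo the relations\<close>

text \<open>The halved weight of \<open>d1 \<inter> a2\<close> is an honest half because a2 is
  orthogonal to d1.\<close>

lemma ss_sign:
  assumes "d1 \<in> D" "a1 \<in> C" "a2 \<in> C"
  shows "sgn_int (sign_exp r d1 a1 d2 a2) = ss r d1 a1 d2 a2"
proof -
  have "d1 \<inter> ({..<2 * r} - d2) = d1 - d2" using D_sub [OF assms(1)] by auto
  moreover have "sgn_int (swt r r (d1 \<inter> a2) div 2) = iw r (d1 \<inter> a2)"
    using C_even [OF assms(3,1)] by (simp add: iw_half Int_commute)
  ultimately show ?thesis
    by (simp add: sign_exp_def ss_def sgn_int_add sg_def)
qed

definition pk :: "nat set \<times> nat set \<Rightarrow> nat set \<times> nat set \<Rightarrow> nat set \<times> nat set \<Rightarrow> complex" where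
  "pk x y z = sgn_int (sign_exp r (fst x) (snd x) (fst y) (snd y)) *
    (if fst z = sd (fst x) (fst y) then tw3 r (snd x) (fst x \<inter> fst y) (snd y) (snd z) else 0)"

lemma prodV_apply:
  "prodV r G u v z = (\<Sum>x\<in>D \<times> C. \<Sum>y\<in>D \<times> C. u x * v y * pk x y z)"
  by (cases z) (simp add: prodV_def pk_def case_prod_beta mult.assoc cong: if_cong)

lemma vlin_prod_left: "vlin (\<lambda>u. prodV r G u v)"
  by (intro vlinI ext)
    (simp_all add: prodV_apply distrib_right sum.distrib sum_distrib_left mult.assoc)

lemma vlin_prod_right: "vlin (prodV r G u)"
  by (intro vlinI ext)
    (simp_all add: prodV_apply distrib_right distrib_left sum.distrib sum_distrib_left
      mult.assoc mult.left_commute)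

lemma prod_delta:
  assumes "d1 \<in> D" "a1 \<in> C" "d2 \<in> D" "a2 \<in> C"
  shows "prodV r G (delta d1 a1) (delta d2 a2) = sc (ss r d1 a1 d2 a2)
    (\<Sum>x\<in>P (d1 \<inter> d2). sc (eps r a1 x * eps r (sd a1 x) a2) (delta (sd d1 d2) (sd (sd a1 x) a2)))"
proof (rule ext)
  fix z :: "nat set \<times> nat set"
  have "prodV r G (delta d1 a1) (delta d2 a2) z =
      (\<Sum>x\<in>D \<times> C. if x = (d1, a1) then \<Sum>y\<in>D \<times> C. if y = (d2, a2) then pk x y z else 0 else 0)"
    unfolding prodV_apply delta_apply by (intro sum.cong refl) (auto intro!: sum.cong)
  also have "\<dots> = pk (d1, a1) (d2, a2) z"
    using assms finite_DC by simp
  also have "\<dots> = sc (ss r d1 a1 d2 a2) (\<Sum>x\<in>P (d1 \<inter> d2).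
      sc (eps r a1 x * eps r (sd a1 x) a2) (delta (sd d1 d2) (sd (sd a1 x) a2))) z"
    using assms by (cases z)
      (auto simp: pk_def tw3_def sum_fun_apply delta_apply ss_sign intro!: sum.cong)
  finally show "prodV r G (delta d1 a1) (delta d2 a2) z = \<dots>" .
qed

lemma V_prod: "u \<in> V \<Longrightarrow> v \<in> V \<Longrightarrow> prodV r G u v \<in> V"
proof -
  have "pk x y z = 0" if "x \<in> D \<times> C" "y \<in> D \<times> C" "z \<notin> D \<times> C" for x y z
  proof (cases "fst z = sd (fst x) (fst y)")
    case True
    then have "fst z \<in> D" using that D_sd by auto
    then have "snd z \<notin> C" using that by (cases z) auto
    moreover have "sd (sd (snd x) g) (snd y) \<in> C" if "g \<in> P d" for g d
      using \<open>x \<in> D \<times> C\<close> \<open>y \<in> D \<times> C\<close> P_C [OF that] by (auto intro!: C_sd)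
    ultimately have "tw3 r (snd x) (fst x \<inter> fst y) (snd y) (snd z) = 0"
      unfolding tw3_def by (intro sum.neutral) auto
    then show ?thesis by (simp add: pk_def)
  qed (simp add: pk_def)
  then show ?thesis by (auto simp: V_iff prodV_apply intro!: sum.neutral)
qed

text \<open>\<open>Ff d a x\<close> stands for \<open>e_a e_x t_d\<close>.\<close>

definition Ff :: "nat set \<Rightarrow> nat set \<Rightarrow> nat set \<Rightarrow> vec" where
  "Ff d a x = sc (eps r a x) (L (delta d (sd a x)))"

text \<open>The module C t_d is trivial, so e_y fixes t_d, and e_x e_y = e_(x+y) carries no sign for
  diagonal words.\<close>

lemma Ff_absorb:
  assumes "d \<in> D" "a \<in> C" "x \<in> P d'" "y \<in> P d"
  shows "Ff d a (sd x y) = Ff d a x"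
proof -
  have C: "x \<in> C" "y \<in> C" using assms P_C by blast+
  have "L (delta d (sd (sd a x) y)) = sc (eps r (sd a x) y) (L (delta d (sd a x)))"
    using assms C C_sd by (intro L_delta_shift) auto
  then show ?thesis
    unfolding Ff_def using assms C eps_PP [OF assms(3,4)]
    by (simp add: eps_addl eps_addr sd_assoc eps_sq mult.assoc)
qed

lemma Ff_shift:
  assumes "a \<in> C" "x \<in> P d'" "y \<in> P d''"
  shows "Ff d (sd a y) x = sc (eps r a y) (Ff d a (sd y x))"
proof -
  have C: "x \<in> C" "y \<in> C" using assms P_C by blast+
  show ?thesis
    unfolding Ff_def using assms C eps_PP [OF assms(3,2)]
    by (simp add: eps_addl eps_addr sd_assoc eps_sq_left)
qed

text \<open>The middle factor e_x is moved to the right past e_(a_2), next to t; the commutator is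
  the sign \<open>sg r (x \<inter> a2)\<close>.\<close>

lemma L_prod_delta:
  assumes d1: "d1 \<in> D" and a1: "a1 \<in> C" and d2: "d2 \<in> D" and a2: "a2 \<in> C"
  shows "L (prodV r G (delta d1 a1) (delta d2 a2)) = sc (ss r d1 a1 d2 a2 * eps r a1 a2)
    (\<Sum>x\<in>P (d1 \<inter> d2). sc (sg r (x \<inter> a2)) (Ff (sd d1 d2) (sd a1 a2) x))"
proof -
  have *: "sc (eps r a1 x * eps r (sd a1 x) a2) (L (delta (sd d1 d2) (sd (sd a1 x) a2))) =
      sc (eps r a1 a2) (sc (sg r (x \<inter> a2)) (Ff (sd d1 d2) (sd a1 a2) x))"
    if x: "x \<in> P (d1 \<inter> d2)" for x
  proof -
    have xC: "x \<in> C" using x P_C by blast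
    have 1: "sd (sd a1 x) a2 = sd (sd a1 a2) x" by (simp only: sd_ac)
    have 2: "eps r (sd a1 x) a2 = eps r a1 a2 * sg r (x \<inter> a2) * eps r a2 x"
      using a1 a2 xC by (simp add: eps_addl eps_comm [of x a2])
    show ?thesis
      unfolding 1 2 Ff_def using a1 a2 xC by (simp add: eps_addl mult_ac)
  qed
  show ?thesis
    unfolding prod_delta [OF assms] vlin_sc [OF vlin_L] vlin_sum [OF vlin_L]
      sc_sc [symmetric] sc_sum [of "eps r a1 a2"] using * by simp
qed

text \<open>Well-definedness in the left factor. The part y1 of y inside d2 lies in the summation
  group and is absorbed by reindexing; the part y2 outside d2 lies in \<open>sd d1 d2\<close> and
  fixes t. Moving y2 past a2 costs \<open>sg r (y2 \<inter> a2)\<close>, which is what the first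
  term of the sign exponent compensates.\<close>

lemma prod_relgen_left:
  assumes d1: "d1 \<in> D" and a1: "a1 \<in> C" and y: "y \<in> P d1" and d2: "d2 \<in> D" and a2: "a2 \<in> C"
  shows "sc (eps r a1 y) (L (prodV r G (delta d1 (sd a1 y)) (delta d2 a2))) =
    L (prodV r G (delta d1 a1) (delta d2 a2))"
proof -
  let ?d = "sd d1 d2" and ?a = "sd a1 a2"
  have yC: "y \<in> C" using y P_C by blast
  have aC: "?a \<in> C" using a1 a2 C_sd by blast
  have d: "?d \<in> D" using d1 d2 D_sd by blast
  define y1 where "y1 = y \<inter> d2"
  define y2 where "y2 = y - d2"
  have y1: "y1 \<in> P (d1 \<inter> d2)" unfolding y1_def by (rule P_Int_D [OF y d2])
  have "y2 \<in> P (d1 - d2)" unfolding y2_def by (rule P_Diff_D [OF y d2])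
  then have y2: "y2 \<in> P ?d" unfolding P_iff [of y2 "d1 - d2"] P_iff [of y2 ?d] by auto
  have y12: "y = sd y1 y2" by (auto simp: y1_def y2_def)
  have sgy: "sg r (y \<inter> a2) = sg r (y1 \<inter> a2) * sg r (y2 \<inter> a2)"
    unfolding y12 by (rule sg_Int_sd [OF r])
  have s: "ss r d1 (sd a1 y) d2 a2 = ss r d1 a1 d2 a2 * sg r (y2 \<inter> a2)"
  proof -
    have "(d1 - d2) \<inter> sd a1 y \<inter> a2 = sd ((d1 - d2) \<inter> a1 \<inter> a2) (y2 \<inter> a2)"
      using P_sub [OF y] by (auto simp: y2_def)
    then show ?thesis by (simp add: ss_def sg_sd mult_ac)
  qed
  have e: "eps r a1 y * eps r (sd a1 y) a2 * eps r ?a y = eps r a1 a2 * sg r (y \<inter> a2)"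
    using a1 a2 yC by (simp add: eps_addl eps_comm [of y a2] mult_ac eps_sq_left eps_sq)
  have F: "Ff ?d (sd (sd a1 y) a2) x = sc (eps r ?a y) (Ff ?d ?a (sd x y1))"
    if x: "x \<in> P (d1 \<inter> d2)" for x
  proof -
    have "sd (sd a1 y) a2 = sd ?a y" by (simp only: sd_ac)
    then have "Ff ?d (sd (sd a1 y) a2) x = sc (eps r ?a y) (Ff ?d ?a (sd y x))"
      using Ff_shift [OF aC x y] by simp
    also have "sd y x = sd (sd x y1) y2" unfolding y12 by (simp only: sd_ac)
    also have "Ff ?d ?a \<dots> = Ff ?d ?a (sd x y1)"
      by (rule Ff_absorb [OF d aC P_sd [OF x y1] y2])
    finally show ?thesis .
  qed
  have "sc (eps r a1 y) (L (prodV r G (delta d1 (sd a1 y)) (delta d2 a2))) =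
      sc (eps r a1 y * ss r d1 (sd a1 y) d2 a2 * eps r (sd a1 y) a2)
        (\<Sum>x\<in>P (d1 \<inter> d2). sc (sg r (x \<inter> a2)) (Ff ?d (sd (sd a1 y) a2) x))"
    by (simp add: L_prod_delta d1 d2 a1 a2 C_sd yC mult.assoc)
  also have "\<dots> = (\<Sum>x\<in>P (d1 \<inter> d2). sc (ss r d1 a1 d2 a2 * eps r a1 a2 * sg r (y1 \<inter> a2) * sg r (x \<inter> a2))
      (Ff ?d ?a (sd x y1)))"
    unfolding sc_sum
  proof (rule sum.cong [OF refl])
    fix x assume x: "x \<in> P (d1 \<inter> d2)"
    have "eps r a1 y * ss r d1 (sd a1 y) d2 a2 * eps r (sd a1 y) a2 * (sg r (x \<inter> a2) * eps r ?a y) =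
       (eps r a1 y * eps r (sd a1 y) a2 * eps r ?a y) * ss r d1 a1 d2 a2 * sg r (y2 \<inter> a2) * sg r (x \<inter> a2)"
      by (simp add: s mult_ac)
    also have "\<dots> = ss r d1 a1 d2 a2 * eps r a1 a2 * sg r (y1 \<inter> a2) * sg r (x \<inter> a2)"
      unfolding e sgy by (simp add: mult_ac sg_square [OF r])
    finally show "sc (eps r a1 y * ss r d1 (sd a1 y) d2 a2 * eps r (sd a1 y) a2)
        (sc (sg r (x \<inter> a2)) (Ff ?d (sd (sd a1 y) a2) x)) =
      sc (ss r d1 a1 d2 a2 * eps r a1 a2 * sg r (y1 \<inter> a2) * sg r (x \<inter> a2)) (Ff ?d ?a (sd x y1))"
      unfolding F [OF x] sc_sc by (rule arg_cong)
  qed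
  also have "\<dots> = (\<Sum>x\<in>P (d1 \<inter> d2). sc (ss r d1 a1 d2 a2 * eps r a1 a2 * sg r (sd x y1 \<inter> a2))
      (Ff ?d ?a (sd x y1)))"
    by (simp add: sg_Int_sd [OF r] mult_ac)
  also have "\<dots> = (\<Sum>x\<in>P (d1 \<inter> d2). sc (ss r d1 a1 d2 a2 * eps r a1 a2 * sg r (x \<inter> a2)) (Ff ?d ?a x))"
    by (rule sum_P_shift [OF y1])
  also have "\<dots> = L (prodV r G (delta d1 a1) (delta d2 a2))"
    by (simp add: L_prod_delta assms sc_sum mult_ac)
  finally show ?thesis .
qed

text \<open>Well-definedness in the right factor, with y split along d1. Here the compensating sign
  comes from the halved exponent: by the quadratic law of \<open>iw\<close> it changes by
  \<open>sg r (y1 \<inter> a2)\<close>, the same sign that reindexing by y1 produces.\<close>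

lemma prod_relgen_right:
  assumes d1: "d1 \<in> D" and a1: "a1 \<in> C" and d2: "d2 \<in> D" and a2: "a2 \<in> C" and y: "y \<in> P d2"
  shows "sc (eps r a2 y) (L (prodV r G (delta d1 a1) (delta d2 (sd a2 y)))) =
    L (prodV r G (delta d1 a1) (delta d2 a2))"
proof -
  let ?d = "sd d1 d2" and ?a = "sd a1 a2"
  have yC: "y \<in> C" using y P_C by blast
  have aC: "?a \<in> C" using a1 a2 C_sd by blast
  have d: "?d \<in> D" using d1 d2 D_sd by blast
  define y1 where "y1 = y \<inter> d1"
  define y2 where "y2 = y - d1"
  have "y1 \<in> P (d2 \<inter> d1)" unfolding y1_def by (rule P_Int_D [OF y d1])
  then have y1: "y1 \<in> P (d1 \<inter> d2)" by (simp add: Int_commute)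
  have "y2 \<in> P (d2 - d1)" unfolding y2_def by (rule P_Diff_D [OF y d1])
  then have y2: "y2 \<in> P ?d" unfolding P_iff [of y2 "d2 - d1"] P_iff [of y2 ?d] by auto
  have y12: "y = sd y1 y2" by (auto simp: y1_def y2_def)
  have diag: "sg r (u \<inter> v) = 1" "iw r u = 1" if "u \<in> P e" "v \<in> P f" for u v e f
    using P_diag [OF that(1)] P_diag [OF that(2)] by (auto simp: sg_def swt_diag iw_def intro: prod.neutral)
  have s: "ss r d1 a1 d2 (sd a2 y) = ss r d1 a1 d2 a2 * sg r (y1 \<inter> a2)"
  proof -
    have 1: "(d1 - d2) \<inter> a1 \<inter> sd a2 y = (d1 - d2) \<inter> a1 \<inter> a2" using P_sub [OF y] by auto
    have 2: "d1 \<inter> d2 \<inter> sd a2 y = sd (d1 \<inter> d2 \<inter> a2) y1"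
      using P_sub [OF y] by (auto simp: y1_def)
    have 3: "d1 \<inter> sd a2 y = sd (d1 \<inter> a2) y1" by (auto simp: y1_def)
    have 4: "d1 \<inter> a2 \<inter> y1 = y1 \<inter> a2" by (auto simp: y1_def)
    have 5: "sg r y1 = 1" using diag(1) [OF y1 y1] by simp
    show ?thesis
      unfolding ss_def 1 2 3 by (simp add: sg_sd iw_sd 4 5 diag(2) [OF y1 y1] mult_ac)
  qed
  have e: "eps r a2 y * eps r a1 (sd a2 y) * eps r ?a y = eps r a1 a2"
    using a1 a2 yC by (simp add: eps_addl eps_addr mult_ac eps_sq_left eps_sq)
  have F: "Ff ?d (sd a1 (sd a2 y)) x = sc (eps r ?a y) (Ff ?d ?a (sd x y1))"
    if x: "x \<in> P (d1 \<inter> d2)" for x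
  proof -
    have "sd a1 (sd a2 y) = sd ?a y" by (simp only: sd_ac)
    then have "Ff ?d (sd a1 (sd a2 y)) x = sc (eps r ?a y) (Ff ?d ?a (sd y x))"
      using Ff_shift [OF aC x y] by simp
    also have "sd y x = sd (sd x y1) y2" unfolding y12 by (simp only: sd_ac)
    also have "Ff ?d ?a \<dots> = Ff ?d ?a (sd x y1)"
      by (rule Ff_absorb [OF d aC P_sd [OF x y1] y2])
    finally show ?thesis .
  qed
  have "sc (eps r a2 y) (L (prodV r G (delta d1 a1) (delta d2 (sd a2 y)))) =
      sc (eps r a2 y * ss r d1 a1 d2 (sd a2 y) * eps r a1 (sd a2 y))
        (\<Sum>x\<in>P (d1 \<inter> d2). sc (sg r (x \<inter> sd a2 y)) (Ff ?d (sd a1 (sd a2 y)) x))"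
    by (simp add: L_prod_delta d1 d2 a1 a2 C_sd yC mult.assoc)
  also have "\<dots> = (\<Sum>x\<in>P (d1 \<inter> d2). sc (ss r d1 a1 d2 a2 * eps r a1 a2 * sg r (sd x y1 \<inter> a2))
      (Ff ?d ?a (sd x y1)))"
    unfolding sc_sum
  proof (rule sum.cong [OF refl])
    fix x assume x: "x \<in> P (d1 \<inter> d2)"
    have "sg r (x \<inter> sd a2 y) = sg r (x \<inter> a2)"
      by (simp add: sg_Int_sd' [OF r] diag(1) [OF x y])
    then have "eps r a2 y * ss r d1 a1 d2 (sd a2 y) * eps r a1 (sd a2 y) *
        (sg r (x \<inter> sd a2 y) * eps r ?a y) =
       (eps r a2 y * eps r a1 (sd a2 y) * eps r ?a y) * ss r d1 a1 d2 a2 * sg r (y1 \<inter> a2) * sg r (x \<inter> a2)"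
      by (simp add: s mult_ac)
    also have "\<dots> = ss r d1 a1 d2 a2 * eps r a1 a2 * sg r (sd x y1 \<inter> a2)"
      unfolding e by (simp add: mult_ac sg_Int_sd [OF r])
    finally show "sc (eps r a2 y * ss r d1 a1 d2 (sd a2 y) * eps r a1 (sd a2 y))
        (sc (sg r (x \<inter> sd a2 y)) (Ff ?d (sd a1 (sd a2 y)) x)) =
      sc (ss r d1 a1 d2 a2 * eps r a1 a2 * sg r (sd x y1 \<inter> a2)) (Ff ?d ?a (sd x y1))"
      unfolding F [OF x] sc_sc by (rule arg_cong)
  qed
  also have "\<dots> = (\<Sum>x\<in>P (d1 \<inter> d2). sc (ss r d1 a1 d2 a2 * eps r a1 a2 * sg r (x \<inter> a2)) (Ff ?d ?a x))"
    by (rule sum_P_shift [OF y1])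
  also have "\<dots> = L (prodV r G (delta d1 a1) (delta d2 a2))"
    by (simp add: L_prod_delta assms sc_sum mult_ac)
  finally show ?thesis .
qed

lemma L_prod_cong_left:
  assumes "L u = L u'" "v \<in> V"
  shows "L (prodV r G u v) = L (prodV r G u' v)"
proof -
  have lin: "vlin (\<lambda>u. L (prodV r G u v))" for v
    by (rule vlin_comp [OF vlin_L vlin_prod_left])
  have "L (prodV r G (relgen r i) v) = 0" if i: "i \<in> relidx r G" for i
  proof (rule vlin_ext [OF vlin_comp [OF vlin_L vlin_prod_right] vlin_const_zero assms(2)])
    fix d2 a2 assume d2: "d2 \<in> D" and a2: "a2 \<in> C"
    obtain d a x where i': "i = (d, a, x)" by (cases i)
    then have "d \<in> D" "a \<in> C" "x \<in> P d" using i by (auto simp: relidx_def)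
    then have "sc (eps r a x) (L (prodV r G (delta d (sd a x)) (delta d2 a2))) =
        L (prodV r G (delta d a) (delta d2 a2))"
      using d2 a2 by (intro prod_relgen_left)
    then show "L (prodV r G (relgen r i) (delta d2 a2)) = 0"
      unfolding i' relgen_eq vlin_minus [OF lin] vlin_sc [OF lin] by simp
  qed
  then show ?thesis using vlin_ker [OF lin _ assms(1)] by blast
qed

lemma L_prod_cong_right:
  assumes "L v = L v'" "u \<in> V"
  shows "L (prodV r G u v) = L (prodV r G u v')"
proof -
  have lin: "vlin (\<lambda>v. L (prodV r G u v))" for u
    by (rule vlin_comp [OF vlin_L vlin_prod_right])
  have "L (prodV r G u (relgen r i)) = 0" if i: "i \<in> relidx r G" for i
  proof (rule vlin_ext [OF vlin_comp [OF vlin_L vlin_prod_left] vlin_const_zero assms(2)])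
    fix d1 a1 assume d1: "d1 \<in> D" and a1: "a1 \<in> C"
    obtain d a x where i': "i = (d, a, x)" by (cases i)
    then have "d \<in> D" "a \<in> C" "x \<in> P d" using i by (auto simp: relidx_def)
    then have "sc (eps r a x) (L (prodV r G (delta d1 a1) (delta d (sd a x)))) =
        L (prodV r G (delta d1 a1) (delta d a))"
      using d1 a1 by (intro prod_relgen_right)
    then show "L (prodV r G (delta d1 a1) (relgen r i)) = 0"
      unfolding i' relgen_eq vlin_minus [OF lin] vlin_sc [OF lin] by simp
  qed
  then show ?thesis using vlin_ker [OF lin _ assms(1)] by blast
qed

end

lemma finite_grades: "finite (grades l r)"
proof (rule finite_subset)
  show "grades l r \<subseteq> {f. \<forall>i. (i \<in> {..<l + r} \<longrightarrow> f i \<in> {Z, H, Q}) \<and> (i \<notin> {..<l + r} \<longrightarrow> f i = Z)}"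
  proof -
    have "h \<in> {Z, H, Q}" for h by (cases h) auto
    then show ?thesis by (auto simp: grades_def simp del: insert_iff)
  qed
  show "finite {f. \<forall>i. (i \<in> {..<l + r} \<longrightarrow> f i \<in> {Z, H, Q}) \<and> (i \<notin> {..<l + r} \<longrightarrow> f i = Z)}"
    by (rule finite_set_of_finite_funs) auto
qed

lemma sc_distrib: "sc c (u + v) = sc c u + sc c v" "sc (c + d) u = sc c u + sc d u"
  by (rule ext, simp add: algebra_simps)+

context code_setup
begin

subsection \<open>The graded algebra\<close>

abbreviation "S \<equiv> SG r G"
abbreviation "cs \<equiv> coset r G"

lemma carrier_S: "carrier S = cs ` V"
  and unit_S: "unit S = cs (delta {} {})"
  and vzero_S: "vzero S = cs 0"
  by (simp_all add: SG_def zero_fun_def)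

lemma vadd_rep: "vadd S X Y = cs (rep X + rep Y)"
  by (simp add: SG_def plus_fun_def)

lemma vadd_S: "vadd S (cs u) (cs v) = cs (u + v)"
  unfolding vadd_rep coset_cong by (simp add: vlin_add [OF vlin_L] L_rep)

lemma vscale_S: "vscale S c (cs v) = cs (sc c v)"
proof -
  have "vscale S c (cs v) = cs (sc c (rep (cs v)))" by (simp add: SG_def sc_def)
  then show ?thesis by (simp add: coset_cong vlin_sc [OF vlin_L] L_rep)
qed

lemma mult_S:
  assumes "u \<in> V" "v \<in> V"
  shows "mult S (cs u) (cs v) = cs (prodV r G u v)"
proof -
  have "L (prodV r G (rep (cs u)) (rep (cs v))) = L (prodV r G u (rep (cs v)))"
    by (intro L_prod_cong_left L_rep rep_V assms)
  also have "\<dots> = L (prodV r G u v)"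
    by (intro L_prod_cong_right L_rep rep_V assms)
  finally show ?thesis by (simp add: SG_def coset_cong)
qed

lemma piece_S: "piece S m = cs ` {v \<in> V. pr m v = v}"
proof -
  have "(\<forall>d a. v (d, a) \<noteq> 0 \<longrightarrow> m = gof d (a - d)) \<longleftrightarrow> pr m v = v" for v :: vec
    unfolding fun_eq_iff split_paired_All pr_apply by auto
  then show ?thesis by (simp add: SG_def)
qed

lemma vzero_piece: "vzero S \<in> piece S m"
proof -
  have "0 \<in> {v \<in> V. pr m v = v}" by (simp add: V_zero vlin_zero [OF vlin_pr])
  then show ?thesis unfolding vzero_S piece_S by (rule imageI)
qed

text \<open>The fold needs commutation at every set X, also at sets that are not cosets; it holds
  because \<open>vadd\<close> sees X only through \<open>rep X\<close>.\<close>

lemma vsum_S: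
  assumes "finite A" and "\<And>a. a \<in> A \<Longrightarrow> f a = cs (w a)"
  shows "vsum S f A = cs (sum w A)"
proof -
  interpret comp_fun_commute "\<lambda>a. vadd S (f a)"
  proof
    fix a b
    show "vadd S (f b) \<circ> vadd S (f a) = vadd S (f a) \<circ> vadd S (f b)"
    proof
      fix X
      have "vadd S (f b) (vadd S (f a) X) = vadd S (f a) (vadd S (f b) X)"
        unfolding vadd_rep coset_cong by (simp add: vlin_add [OF vlin_L] L_rep)
      then show "(vadd S (f b) \<circ> vadd S (f a)) X = (vadd S (f a) \<circ> vadd S (f b)) X" by simp
    qed
  qed
  show ?thesis
    using assms
  proof (induction A rule: finite_induct)
    case empty
    then show ?case by (simp add: vsum_def vzero_S zero_fun_def)
  next
    case (insert a A)
    then have "vsum S f (insert a A) = vadd S (f a) (vsum S f A)"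
      by (simp add: vsum_def)
    then show ?case using insert by (simp add: vadd_S plus_fun_def)
  qed
qed

lemma cs_in_carrier: "cs v \<in> carrier S \<longleftrightarrow> v \<in> V"
  unfolding carrier_S using V_L coset_cong by blast

lemma cvector_space_S: "cvector_space S"
proof -
  have inv: "\<exists>y\<in>V. cs (u + y) = cs 0" if "u \<in> V" for u
  proof
    show "sc (- 1) u \<in> V" using that by (rule V_sc)
    have "u + sc (- 1) u = 0" by (rule ext) simp
    then show "cs (u + sc (- 1) u) = cs 0" by simp
  qed
  show ?thesis
    unfolding cvector_space_def vzero_S carrier_S ball_simps bex_simps
    by (auto simp: vadd_S vscale_S V_add V_sc V_zero sc_distrib add.assoc inv)
      (simp_all add: add.commute)
qed

lemma fin_dim_S: "fin_dim S"
proof -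
  define f where "f z = cs (delta (fst z) (snd z))" for z
  define B where "B = f ` (D \<times> C)"
  have fin: "finite B" using finite_DC by (simp add: B_def)
  have sub: "B \<subseteq> carrier S" by (auto simp: B_def f_def cs_in_carrier V_delta)
  have rB: "b = cs (rep b)" if b: "b \<in> B" for b
  proof -
    obtain z where "b = f z" using b by (auto simp: B_def)
    then show ?thesis by (simp add: f_def coset_cong L_rep)
  qed
  have rf: "L (rep (f z)) = L (delta (fst z) (snd z))" for z
    by (simp add: f_def L_rep)
  have "\<exists>k. cs v = vsum S (\<lambda>b. vscale S (k b) b) B" if v: "v \<in> V" for v
  proof (intro exI)
    \<comment> \<open>Different symbols e_\<alpha> t_d may have the same class, so the coefficient
      of a class collects the whole fibre of \<open>f\<close>.\<close>
    define k where "k b = (\<Sum>z\<in>{z \<in> D \<times> C. f z = b}. v z)" for b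
    have scsum: "sc (\<Sum>z\<in>A. v z) w = (\<Sum>z\<in>A. sc (v z) w)" for A w
      by (rule ext) (simp add: sum_fun_apply sum_distrib_right)
    have "vsum S (\<lambda>b. vscale S (k b) b) B = cs (\<Sum>b\<in>B. sc (k b) (rep b))"
    proof (rule vsum_S [OF fin])
      fix b assume "b \<in> B"
      then have "vscale S (k b) b = vscale S (k b) (cs (rep b))" using rB by metis
      then show "vscale S (k b) b = cs (sc (k b) (rep b))" by (simp add: vscale_S)
    qed
    also have "\<dots> = cs v"
    proof -
      have "L (\<Sum>b\<in>B. sc (k b) (rep b)) = (\<Sum>b\<in>B. \<Sum>z\<in>{z \<in> D \<times> C. f z = b}. sc (v z) (L (rep b)))"
        by (simp add: vlin_sum [OF vlin_L] vlin_sc [OF vlin_L] k_def scsum)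
      also have "\<dots> = (\<Sum>b\<in>f ` (D \<times> C). \<Sum>z\<in>{z \<in> D \<times> C. f z = b}. sc (v z) (L (rep (f z))))"
        unfolding B_def by (intro sum.cong refl) auto
      also have "\<dots> = (\<Sum>z\<in>D \<times> C. sc (v z) (L (rep (f z))))"
        by (rule sum.image_gen [symmetric]) (rule finite_DC)
      also have "\<dots> = L v"
        unfolding rf
        using arg_cong [OF V_expand [OF v], of L, symmetric]
        unfolding vlin_sum [OF vlin_L] vlin_sc [OF vlin_L] .
      finally show ?thesis by (simp add: coset_cong)
    qed
    finally show "cs v = vsum S (\<lambda>b. vscale S (k b) b) B" by simp
  qed
  then show ?thesis unfolding fin_dim_def carrier_S using fin sub by (auto simp: carrier_S)
qed

lemma gof_grades: "d \<in> D \<Longrightarrow> a \<in> C \<Longrightarrow> gof d (a - d) \<in> grades r r"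
  using D_sub [of d] C_sub [of a] by (fastforce simp: gof_def grades_def)

lemma V_nz: "v \<in> V \<Longrightarrow> v (d, a) \<noteq> 0 \<Longrightarrow> d \<in> D \<and> a \<in> C"
  by (auto simp: V_iff)

lemma sum_pr: "v \<in> V \<Longrightarrow> (\<Sum>m\<in>grades r r. pr m v) = v"
proof (rule ext)
  fix z :: "nat set \<times> nat set"
  assume v: "v \<in> V"
  obtain d a where z: "z = (d, a)" by (cases z)
  show "(\<Sum>m\<in>grades r r. pr m v) z = v z"
    using gof_grades V_nz [OF v, of d a] finite_grades
    by (cases "v z = 0") (auto simp: z sum_fun_apply pr_apply intro: sum.neutral)
qed

text \<open>For uniqueness, \<open>pr m\<close> is applied to the image of the sum under
  \<open>L\<close>: it commutes with \<open>L\<close>, keeps the summand of grade m and kills the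
  others.\<close>

lemma decomp_S:
  assumes v: "v \<in> V"
  shows "decomp S r r (cs v) f \<longleftrightarrow> f = (\<lambda>m. if m \<in> grades r r then cs (pr m v) else vzero S)"
    (is "_ \<longleftrightarrow> f = ?f")
proof
  have "vsum S ?f (grades r r) = cs (\<Sum>m\<in>grades r r. pr m v)"
    by (rule vsum_S [OF finite_grades]) simp
  then have sum: "cs v = vsum S ?f (grades r r)" by (simp add: sum_pr [OF v])
  have "cs (pr m v) \<in> piece S m" for m
    unfolding piece_S by (intro imageI CollectI conjI V_pr [OF v]) (simp add: pr_pr)
  then have "decomp S r r (cs v) ?f"
    unfolding decomp_def using sum by simp
  then show "f = ?f \<Longrightarrow> decomp S r r (cs v) f" by simp
next
  assume f: "decomp S r r (cs v) f"
  then have "\<forall>m\<in>grades r r. \<exists>w. f m = cs w \<and> pr m w = w"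
    unfolding decomp_def piece_S by blast
  then obtain w where "\<forall>m\<in>grades r r. f m = cs (w m) \<and> pr m (w m) = w m"
    using bchoice [of "grades r r" "\<lambda>m w. f m = cs w \<and> pr m w = w"] by blast
  then have w: "\<And>m. m \<in> grades r r \<Longrightarrow> f m = cs (w m)"
    "\<And>m. m \<in> grades r r \<Longrightarrow> pr m (w m) = w m" by blast+
  have "cs v = cs (sum w (grades r r))"
    using f vsum_S [OF finite_grades w(1)] unfolding decomp_def by simp
  then have Lv: "L v = (\<Sum>m\<in>grades r r. L (w m))"
    by (simp add: coset_cong vlin_sum [OF vlin_L])
  have "L (pr m v) = L (w m)" if m: "m \<in> grades r r" for m
  proof -
    have "L (pr m v) = (\<Sum>m'\<in>grades r r. pr m (L (w m')))"
      by (simp add: L_pr Lv vlin_sum [OF vlin_pr])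
    also have "\<dots> = (\<Sum>m'\<in>grades r r. if m' = m then L (w m) else 0)"
    proof (rule sum.cong [OF refl])
      fix m' assume m': "m' \<in> grades r r"
      have *: "pr m (L (w m')) = L (pr m (pr m' (w m')))" by (simp only: L_pr w(2) [OF m'])
      then show "pr m (L (w m')) = (if m' = m then L (w m) else 0)"
      proof (cases "m' = m")
        case False
        then have "pr m (pr m' (w m')) = 0" by (simp add: pr_pr)
        then show ?thesis using False * vlin_zero [OF vlin_L] by simp
      qed (use * w(2) [OF m'] in simp)
    qed
    also have "\<dots> = L (w m)" using m finite_grades by simp
    finally show ?thesis .
  qed
  then have "cs (pr m v) = f m" if "m \<in> grades r r" for m
    using that by (simp add: w(1) coset_cong)
  then show "f = ?f" using f unfolding decomp_def by (intro ext) simp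
qed

lemma compo_S: "v \<in> V \<Longrightarrow> m \<in> grades r r \<Longrightarrow> compo S r r m (cs v) = cs (pr m v)"
  by (simp add: compo_def decomp_S)

lemma graded_S: "graded S r r"
proof -
  have "vsubspace S (piece S m)" for m
    unfolding vsubspace_def
  proof (intro conjI ballI allI)
    show "piece S m \<subseteq> carrier S" by (auto simp: piece_S carrier_S)
    show "vzero S \<in> piece S m" by (rule vzero_piece)
    show "vadd S x y \<in> piece S m" if "x \<in> piece S m" "y \<in> piece S m" for x y
      using that by (auto simp: piece_S vadd_S V_add vlin_add [OF vlin_pr])
    show "vscale S c x \<in> piece S m" if "x \<in> piece S m" for c x
      using that by (auto simp: piece_S vscale_S V_sc vlin_sc [OF vlin_pr])
  qed
  moreover have "\<exists>!f. decomp S r r x f" if "x \<in> carrier S" for x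
    using that by (auto simp: carrier_S decomp_S)
  ultimately show ?thesis by (simp add: graded_def)
qed

lemma bilinear_S: "bilinear_mult S"
  unfolding bilinear_mult_def carrier_S ball_simps
  by (auto simp: mult_S vadd_S vscale_S V_add V_sc V_prod vlin_add [OF vlin_prod_left]
      vlin_add [OF vlin_prod_right] vlin_sc [OF vlin_prod_left] vlin_sc [OF vlin_prod_right])

lemma cs_eq_zero: "cs v = vzero S \<longleftrightarrow> L v = 0"
  by (simp add: vzero_S coset_cong vlin_zero [OF vlin_L])

lemma L_delta_nz:
  assumes "d \<in> D" "a \<in> C"
  shows "L (delta d a) \<noteq> 0"
proof -
  have "L (delta d a) (d, a) = (\<Sum>x\<in>P d. if x = {} then 1 else 0)"
    unfolding L_apply [OF assms]
  proof (rule sum.cong [OF refl])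
    fix x
    have "sd a x = a \<longleftrightarrow> x = {}" by auto
    then show "eps r a x * delta d a (d, sd a x) = (if x = {} then 1 else 0)"
      using assms by (simp add: delta_apply eps_er)
  qed
  then have "L (delta d a) (d, a) = 1" using finite_P by simp
  then show ?thesis by auto
qed

lemma piece_nontrivial:
  "piece S m \<noteq> {vzero S} \<longleftrightarrow> (\<exists>d\<in>D. \<exists>a\<in>C. m = gof d (a - d))"
proof
  assume "piece S m \<noteq> {vzero S}"
  moreover have "vzero S \<in> piece S m" by (rule vzero_piece)
  ultimately obtain v where v: "v \<in> V" "pr m v = v" "cs v \<noteq> vzero S"
    unfolding piece_S by blast
  then have "v \<noteq> 0" by (auto simp: vzero_S)
  then obtain d a where da: "v (d, a) \<noteq> 0" by (auto simp: fun_eq_iff)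
  then have "m = gof d (a - d)" using fun_cong [OF v(2), of "(d, a)"] by (auto simp: pr_apply split: if_splits)
  then show "\<exists>d\<in>D. \<exists>a\<in>C. m = gof d (a - d)" using V_nz [OF v(1) da] by blast
next
  assume "\<exists>d\<in>D. \<exists>a\<in>C. m = gof d (a - d)"
  then obtain d a where da: "d \<in> D" "a \<in> C" "m = gof d (a - d)" by blast
  then have "cs (delta d a) \<in> piece S m" by (auto simp: piece_S V_delta pr_delta)
  moreover have "cs (delta d a) \<noteq> vzero S" using da L_delta_nz by (simp add: cs_eq_zero)
  ultimately show "piece S m \<noteq> {vzero S}" by blast
qed

section \<open>Integrality of spins, unit and fusion\<close>

lemma sval_gof:
  assumes d: "d \<in> D" and a: "a \<in> C"
  shows "sval r r (gof d (a - d)) \<in> \<int>"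
proof -
  let ?m = "gof d (a - d)"
  have "(\<Sum>i\<in>{r..<r + r}. hval (?m i)) = (\<Sum>i\<in>{0 + r..<r + r}. hval (?m i))"
    by simp
  also have "\<dots> = (\<Sum>i<r. hval (?m (i + r)))"
    by (subst sum.shift_bounds_nat_ivl) (simp add: lessThan_atLeast0)
  finally have "sval r r ?m = (\<Sum>i<r. hval (?m i) - hval (?m (i + r)))"
    by (simp add: sval_def sum_subtractf)
  \<comment> \<open>The entries 1/16 occur at i and i + r together, because d is diagonal, and
    cancel.\<close>
  also have "\<dots> = (\<Sum>i<r. real_of_int (of_bool (i \<in> a - d) - of_bool (i + r \<in> a - d)) / 2)"
    using D_diag [OF d] by (intro sum.cong) (auto simp: gof_def)
  also have "\<dots> = real_of_int (swt r r (a - d)) / 2"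
    unfolding swt_sum of_int_sum by (simp add: sum_divide_distrib)
  finally have "sval r r ?m = real_of_int (swt r r (a - d)) / 2" .
  \<comment> \<open>The complement of d is the word 1 + d, which is in \<open>D\<close> because 1^r
    is in G; orthogonality to it makes the remaining weight even.\<close>
  moreover have "a - d = a \<inter> sd {..<2 * r} d"
    using C_sub [OF a] D_sub [OF d] by auto
  moreover have "even (swt r r (a \<inter> sd {..<2 * r} d))"
    by (rule C_even [OF a D_sd [OF D_top d]])
  ultimately show ?thesis by (metis Ints_of_int evenE nonzero_mult_div_cancel_left of_int_mult of_int_numeral zero_neq_numeral)
qed

lemma gof_eq_zgrade: "gof d (a - d) = zgrade \<longleftrightarrow> d = {} \<and> a = {}"
proof
  assume "gof d (a - d) = zgrade"
  then have *: "gof d (a - d) i = Z" for i by (simp add: zgrade_def)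
  have "i \<notin> d" "i \<notin> a" for i
    using * [of i] by (auto simp: gof_def split: if_splits)
  then show "d = {} \<and> a = {}" by blast
qed (auto simp: gof_def zgrade_def)

lemma piece_zgrade: "piece S zgrade = range (\<lambda>c. vscale S c (unit S))"
proof (intro equalityI subsetI)
  fix x assume "x \<in> piece S zgrade"
  then obtain v where v: "x = cs v" "pr zgrade v = v" by (auto simp: piece_S)
  have "v = sc (v ({}, {})) (delta {} {})"
  proof (rule ext)
    fix z :: "nat set \<times> nat set"
    show "v z = sc (v ({}, {})) (delta {} {}) z"
      using fun_cong [OF v(2), of z] gof_eq_zgrade [of "fst z" "snd z"]
      by (cases z) (auto simp: pr_apply delta_apply eq_commute [of zgrade] split: if_splits)
  qed
  then have "x = vscale S (v ({}, {})) (unit S)" using v by (metis unit_S vscale_S)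
  then show "x \<in> range (\<lambda>c. vscale S c (unit S))" by blast
next
  fix x assume "x \<in> range (\<lambda>c. vscale S c (unit S))"
  then obtain c where "x = cs (sc c (delta {} {}))" by (auto simp: unit_S vscale_S)
  moreover have "pr zgrade (delta {} {}) = delta {} {}"
    using gof_eq_zgrade [of "{}" "{}"] by (simp add: pr_delta)
  ultimately show "x \<in> piece S zgrade"
    by (auto simp: piece_S V_sc V_delta vlin_sc [OF vlin_pr])
qed

lemma P_none [simp]: "P {} = {{}}"
  by (auto simp: Deltad_def Delta_def)

lemma iw_empty [simp]: "iw r {} = 1"
  by (simp add: iw_def)

lemma sg_empty [simp]: "sg r {} = 1"
  by (simp add: sg_def)

lemma unit_mult: 
  assumes "v \<in> V"
  shows "prodV r G (delta {} {}) v = v" "prodV r G v (delta {} {}) = v"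
proof -
  have id: "vlin (\<lambda>v. v)" by (simp add: vlin_def)
  show "prodV r G (delta {} {}) v = v"
    by (rule vlin_ext [OF vlin_prod_right id assms])
      (simp add: prod_delta ss_def eps_el)
  show "prodV r G v (delta {} {}) = v"
    by (rule vlin_ext [OF vlin_prod_left id assms])
      (simp add: prod_delta ss_def eps_er)
qed

text \<open>The word x is supported where both grades are 1/16, and there fusion admits both 0 and
  1/2.\<close>

lemma gof_fusion:
  assumes "d1 \<in> D" "a1 \<in> C" "d2 \<in> D" "a2 \<in> C" "x \<in> P (d1 \<inter> d2)"
  shows "gof (sd d1 d2) (sd (sd a1 x) a2 - sd d1 d2) \<in> gfusion r r (gof d1 (a1 - d1)) (gof d2 (a2 - d2))"
proof -
  have "gof (sd d1 d2) (sd (sd a1 x) a2 - sd d1 d2) \<in> grades r r"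
    using assms P_C [OF assms(5)] by (intro gof_grades D_sd C_sd)
  moreover have "gof (sd d1 d2) (sd (sd a1 x) a2 - sd d1 d2) i
      \<in> fusion (gof d1 (a1 - d1) i) (gof d2 (a2 - d2) i)" for i
    using P_sub [OF assms(5)] by (auto simp: gof_def)
  ultimately show ?thesis by (simp add: gfusion_def)
qed

lemma pr_prod_fusion:
  assumes u: "u \<in> V" "pr m1 u = u" and v: "v \<in> V" "pr m2 v = v" and m: "m \<notin> gfusion r r m1 m2"
  shows "pr m (prodV r G u v) = 0"
proof (rule vlin_ext [OF vlin_comp [OF vlin_pr vlin_prod_left] vlin_const_zero u(1)])
  fix d1 a1 assume 1: "d1 \<in> D" "a1 \<in> C" "u (d1, a1) \<noteq> 0"
  then have m1: "m1 = gof d1 (a1 - d1)"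
    using fun_cong [OF u(2), of "(d1, a1)"] by (auto simp: pr_apply split: if_splits)
  show "pr m (prodV r G (delta d1 a1) v) = 0"
  proof (rule vlin_ext [OF vlin_comp [OF vlin_pr vlin_prod_right] vlin_const_zero v(1)])
    fix d2 a2 assume 2: "d2 \<in> D" "a2 \<in> C" "v (d2, a2) \<noteq> 0"
    then have m2: "m2 = gof d2 (a2 - d2)"
      using fun_cong [OF v(2), of "(d2, a2)"] by (auto simp: pr_apply split: if_splits)
    have "pr m (delta (sd d1 d2) (sd (sd a1 x) a2)) = 0" if "x \<in> P (d1 \<inter> d2)" for x
      using gof_fusion [OF 1(1,2) 2(1,2) that] m by (auto simp: pr_delta m1 m2)
    then show "pr m (prodV r G (delta d1 a1) (delta d2 a2)) = 0"
      by (simp add: prod_delta 1 2 vlin_sc [OF vlin_pr] vlin_sum [OF vlin_pr])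
  qed
qed

section \<open>The structure codes\<close>

lemma Dcode_S: "Dcode r r S = D"
proof (intro equalityI subsetI)
  fix d assume "d \<in> Dcode r r S"
  then obtain c where "piece S (gof d c) \<noteq> {vzero S}" "d \<inter> c = {}" by (auto simp: Dcode_def)
  then obtain d' a where d': "d' \<in> D" "gof d c = gof d' (a - d')" by (auto simp: piece_nontrivial)
  have "i \<in> d \<longleftrightarrow> i \<in> d'" for i
    using fun_cong [OF d'(2), of i] by (auto simp: gof_def split: if_splits)
  then show "d \<in> D" using d'(1) by (metis set_eqI)
next
  fix d assume d: "d \<in> D"
  then have "piece S (gof d {}) \<noteq> {vzero S}"
    unfolding piece_nontrivial by (intro bexI [of _ d] bexI [of _ "{}"]) auto
  then show "d \<in> Dcode r r S"
    using D_sub [OF d] by (auto simp: Dcode_def mult_2)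
qed

lemma Ccode_S: "Ccode r r S = perp r r D"
proof -
  have "piece S (gof {} \<alpha>) \<noteq> {vzero S} \<longleftrightarrow> \<alpha> \<in> C" for \<alpha>
  proof
    assume "piece S (gof {} \<alpha>) \<noteq> {vzero S}"
    then obtain d a where da: "a \<in> C" "gof {} \<alpha> = gof d (a - d)" by (auto simp: piece_nontrivial)
    have "i \<notin> d \<and> (i \<in> \<alpha> \<longleftrightarrow> i \<in> a)" for i
      using fun_cong [OF da(2), of i] by (auto simp: gof_def split: if_splits)
    then show "\<alpha> \<in> C" using da(1) by (metis set_eqI)
  next
    assume "\<alpha> \<in> C"
    then show "piece S (gof {} \<alpha>) \<noteq> {vzero S}"
      unfolding piece_nontrivial by (intro bexI [of _ "{}"] bexI [of _ \<alpha>]) auto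
  qed
  then show ?thesis using C_sub by (auto simp: Ccode_def CG_def mult_2)
qed

section \<open>The pairing into degree 0 and simplicity\<close>

lemma pr_prod_zgrade:
  assumes d: "d \<in> D" and b: "b \<in> C" and v: "v \<in> V"
  shows "pr zgrade (prodV r G (delta d b) v) =
    sc (iw r (d \<inter> b) * iw r b * L v (d, b)) (delta {} {})"
proof -
  have lin: "vlin (\<lambda>v. sc (iw r (d \<inter> b) * iw r b * L v (d, b)) (delta {} {}))"
    by (intro vlinI ext) (simp_all add: vlin_add [OF vlin_L] vlin_sc [OF vlin_L] algebra_simps)
  show ?thesis
  proof (rule vlin_ext [OF vlin_comp [OF vlin_pr vlin_prod_right] lin v])
    fix d2 a2 assume d2: "d2 \<in> D" and a2: "a2 \<in> C"
    have pd: "pr zgrade (delta (sd d d2) (sd (sd b x) a2)) =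
        (if d2 = d \<and> a2 = sd b x then delta {} {} else 0)" for x
    proof -
      have "sd d d2 = {} \<longleftrightarrow> d2 = d" "sd (sd b x) a2 = {} \<longleftrightarrow> a2 = sd b x"
        by (metis sd_cancel sd_empty(1) sd_self)+
      then show ?thesis
        using gof_eq_zgrade [of "sd d d2" "sd (sd b x) a2"] by (auto simp: pr_delta eq_commute)
    qed
    have "pr zgrade (prodV r G (delta d b) (delta d2 a2)) =
       sc (ss r d b d2 a2) (\<Sum>x\<in>P (d \<inter> d2). sc (eps r b x * eps r (sd b x) a2)
         (if d2 = d \<and> a2 = sd b x then delta {} {} else 0))"
      by (simp add: prod_delta d b d2 a2 vlin_sc [OF vlin_pr] vlin_sum [OF vlin_pr] pd)
    also have "\<dots> = sc (iw r (d \<inter> b) * iw r b * L (delta d2 a2) (d, b)) (delta {} {})"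
    proof (cases "d2 = d")
      case False
      then show ?thesis by (simp add: L_apply d b delta_apply)
    next
      case True
      \<comment> \<open>The sign \<open>sg r (b \<inter> x)\<close> arises twice, from
        \<open>iw\<close> in the product sign and from the diagonal value of the cocycle, and
        cancels. What remains is \<open>eps r b x\<close>, the weight used in \<open>L\<close>,
        times a constant independent of x.\<close>
      have *: "ss r d b d (sd b x) * (eps r b x * eps r (sd b x) (sd b x)) =
          iw r (d \<inter> b) * iw r b * eps r b x" if x: "x \<in> P d" for x
      proof -
        have xC: "x \<in> C" using x P_C by blast
        have bx: "sd b x \<in> C" using b xC C_sd by blast
        have diag: "iw r x = 1"
          using P_diag [OF x] unfolding iw_def by (auto intro: prod.neutral)
        have "d \<inter> sd b x = sd (d \<inter> b) x" "d \<inter> b \<inter> x = b \<inter> x" using P_sub [OF x] by auto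
        then have "ss r d b d (sd b x) = iw r (d \<inter> b) * sg r (b \<inter> x)"
          using sg_CD [OF bx d] by (simp add: ss_def iw_sd diag)
        moreover have "eps r (sd b x) (sd b x) = iw r b * sg r (b \<inter> x)"
          using eps_diag [OF r C_Ceven [OF bx]] by (simp add: iw_sd diag)
        ultimately show ?thesis by (simp add: mult_ac sg_square [OF r])
      qed
      have "sc (ss r d b d2 a2) (\<Sum>x\<in>P (d \<inter> d2). sc (eps r b x * eps r (sd b x) a2)
            (if d2 = d \<and> a2 = sd b x then delta {} {} else 0)) =
          (\<Sum>x\<in>P d. sc (iw r (d \<inter> b) * iw r b * (eps r b x * delta d2 a2 (d, sd b x))) (delta {} {}))"
        unfolding sc_sum using True
        by (intro sum.cong) (auto simp: delta_apply * [simplified mult.assoc] mult.assoc)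
      also have "\<dots> = sc (iw r (d \<inter> b) * iw r b * L (delta d2 a2) (d, b)) (delta {} {})"
        by (rule ext) (simp add: L_apply d b sum_fun_apply sum_distrib_left sum_distrib_right)
      finally show ?thesis .
    qed
    finally show "pr zgrade (prodV r G (delta d b) (delta d2 a2)) =
        sc (iw r (d \<inter> b) * iw r b * L (delta d2 a2) (d, b)) (delta {} {})" .
  qed
qed

lemma iw_nonzero: "iw r X \<noteq> 0"
  by (simp add: iw_def)

lemma simple_S: "simple r r S"
  unfolding simple_def
proof (intro allI impI)
  fix M assume M: "ideal r r S M"
  then have sub: "M \<subseteq> carrier S" and z: "vzero S \<in> M"
    and scl: "\<And>c x. x \<in> M \<Longrightarrow> vscale S c x \<in> M"
    and comp: "\<And>x m. x \<in> M \<Longrightarrow> m \<in> grades r r \<Longrightarrow> compo S r r m x \<in> M"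
    and mul: "\<And>a x. a \<in> carrier S \<Longrightarrow> x \<in> M \<Longrightarrow> mult S a x \<in> M"
    by (auto simp: ideal_def vsubspace_def)
  show "M = {vzero S} \<or> M = carrier S"
  proof (cases "M = {vzero S}")
    case False
    then obtain x where x: "x \<in> M" "x \<noteq> vzero S" using z by (metis singletonI subsetI subset_singletonD empty_iff)
    then obtain v where "v \<in> V" "x = cs v" using sub unfolding carrier_S by blast
    with x have v: "v \<in> V" "cs v \<in> M" "cs v \<noteq> vzero S" by simp_all
    then have "L v \<noteq> 0" by (simp add: cs_eq_zero)
    then obtain d b where Lv: "L v (d, b) \<noteq> 0" by (metis ext surj_pair zero_fun_apply)
    have "(d, b) \<in> D \<times> C"
    proof (rule ccontr)
      assume *: "(d, b) \<notin> D \<times> C"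
      then have "v (d, b) = 0" using v(1) unfolding V_iff by blast
      then show False using Lv L_out [OF *, of v] by simp
    qed
    then have db: "d \<in> D" "b \<in> C" by auto
    let ?k = "iw r (d \<inter> b) * iw r b * L v (d, b)"
    have k: "?k \<noteq> 0" using Lv iw_nonzero by simp
    have zg: "zgrade \<in> grades r r" by (simp add: zgrade_def grades_def)
    have "mult S (cs (delta d b)) (cs v) \<in> M"
      using v db by (intro mul) (auto simp: cs_in_carrier V_delta)
    then have "compo S r r zgrade (cs (prodV r G (delta d b) v)) \<in> M"
      using v db zg by (intro comp) (simp_all add: mult_S V_delta)
    then have "cs (sc ?k (delta {} {})) \<in> M"
      using v db zg by (simp add: compo_S V_prod V_delta pr_prod_zgrade)
    then have "vscale S (1 / ?k) (cs (sc ?k (delta {} {}))) \<in> M" by (rule scl)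
    then have u: "cs (delta {} {}) \<in> M"
      using k by (simp add: vscale_S)
    have "carrier S \<subseteq> M"
    proof
      fix x assume x: "x \<in> carrier S"
      then obtain w where w: "w \<in> V" "x = cs w" by (auto simp: carrier_S)
      have "mult S x (cs (delta {} {})) \<in> M" by (rule mul [OF x u])
      then show "x \<in> M" using w by (simp add: mult_S V_delta unit_mult)
    qed
    then show ?thesis using sub by blast
  qed simp
qed

end

subsection \<open>The braiding identity at a single position\<close>

text \<open>One entry of \<open>gof d (a - d)\<close>; the second bit is ignored where the first is
  set, so codewords need not be reduced modulo d.\<close>

definition gr :: "bool \<Rightarrow> bool \<Rightarrow> IS" where
  "gr d c = (if d then Q else if c then H else Z)"

lemma gof_gr: "gof d (a - d) i = gr (i \<in> d) (i \<in> a)"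
  by (simp add: gof_def gr_def)

definition lsg :: "bool \<Rightarrow> complex" where
  "lsg b = (if b then -1 else 1)"

definition lss :: "bool \<Rightarrow> bool \<Rightarrow> bool \<Rightarrow> bool \<Rightarrow> complex" where
  "lss d1 a1 d2 a2 = lsg ((d1 \<and> \<not> d2) \<and> a1 \<and> a2) * lsg ((d1 \<and> d2) \<and> a2) * (if d1 \<and> a2 then \<i> else 1)"

text \<open>One position of the sign of a nested product a_1 (a_2 a_3): x is the summation bit of
  the inner product, y that of the outer one.\<close>

definition ltr :: "bool \<Rightarrow> bool \<Rightarrow> bool \<Rightarrow> bool \<Rightarrow> bool \<Rightarrow> bool \<Rightarrow> bool \<Rightarrow> bool \<Rightarrow> complex" where
  "ltr d1 a1 d2 a2 d3 a3 x y = lss d2 a2 d3 a3 * lss d1 a1 (d2 \<noteq> d3) ((a2 \<noteq> x) \<noteq> a3) *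
    lsg (x \<and> a3) * lsg (y \<and> (a2 \<noteq> a3))"

lemma cnj_lsg [simp]: "cnj (lsg b) = lsg b"
  by (simp add: lsg_def)

abbreviation "zeta \<equiv> exp (- (of_real pi / 8) * \<i>)"

lemma zeta_norm: "zeta * cnj zeta = 1"
proof -
  have "zeta = cis (- pi / 8)" by (simp add: cis_conv_exp mult.commute)
  then show ?thesis by (simp add: cis_cnj cis_mult)
qed

text \<open>The two sides of (FA4) at one position; on a right component all factors are conjugated.
  The bits \<open>x\<close>, \<open>y\<close>, \<open>z\<close> live where exactly two of the three words \<open>d\<^sub>i\<close> are nonzero,
  \<open>w\<close> and \<open>n\<close> where all three are.\<close>

definition lbL :: "bool \<Rightarrow> bool \<Rightarrow> bool \<Rightarrow> bool \<Rightarrow> bool \<Rightarrow> bool \<Rightarrow> bool \<Rightarrow> bool \<Rightarrow> bool \<Rightarrow> bool \<Rightarrow> complex" where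
  "lbL d1 a1 d2 a2 d3 a3 x y z w = ltr d2 a2 d1 a1 d3 a3 (x \<noteq> w) (y \<noteq> z) * lsg (d2 \<and> a1)"

definition lbR :: "bool \<Rightarrow> bool \<Rightarrow> bool \<Rightarrow> bool \<Rightarrow> bool \<Rightarrow> bool \<Rightarrow> bool \<Rightarrow> bool \<Rightarrow> bool \<Rightarrow> IS \<Rightarrow> IS \<Rightarrow> bool \<Rightarrow> complex" where
  "lbR d1 a1 d2 a2 d3 a3 x y z h0 h' n =
    Bval h0 (gr d1 a1) (gr d2 a2) (gr d3 a3) (gr (d2 \<noteq> d3) ((a2 \<noteq> (z \<noteq> n)) \<noteq> a3)) h' *
    ltr d1 a1 d2 a2 d3 a3 (z \<noteq> n) (x \<noteq> y) * lsg (a1 \<and> a2)"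

text \<open>Without three entries 1/16 there is no choice for the intermediate grade: either h_1 and
  h_3 are not both 1/16 and their fusion is a single value, or h_2 is 0 or 1/2 and fusion with it is
  invertible.\<close>

lemma local_grade:
  assumes "\<not> (d1 \<and> d2 \<and> d3)" "x \<Longrightarrow> d1 \<and> d3" "y \<Longrightarrow> d1 \<and> d2" "z \<Longrightarrow> d2 \<and> d3"
    and "h' \<in> Aset (gr (d1 \<noteq> (d2 \<noteq> d3)) ((a1 \<noteq> (a2 \<noteq> a3)) \<noteq> (x \<noteq> (y \<noteq> z)))) (gr d2 a2) (gr d1 a1) (gr d3 a3)"
  shows "h' = gr (d1 \<noteq> d3) ((a1 \<noteq> x) \<noteq> a3)"
proof -
  have *: "h' \<in> fusion (gr d1 a1) (gr d3 a3)"
    "gr (d1 \<noteq> (d2 \<noteq> d3)) ((a1 \<noteq> (a2 \<noteq> a3)) \<noteq> (x \<noteq> (y \<noteq> z))) \<in> fusion (gr d2 a2) h'"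
    using assms(5) by (auto simp: Aset_def)
  show ?thesis
  proof (cases "d1 \<and> d3")
    case False
    then have "\<not> x" using assms(2) by blast
    then show ?thesis
      using False *(1) by (cases d1; cases d3; cases a1; cases a3) (simp_all add: gr_def)
  next
    case True
    then have "\<not> d2" "\<not> y" "\<not> z" using assms(1,3,4) by blast+
    then show ?thesis
      using True * by (cases a1; cases a2; cases a3; cases x; cases h') (simp_all add: gr_def)
  qed
qed

text \<open>Each pair of nonzero d's leaves one free bit among x, y, z, so there are 1 + 3 + 3 * 2 =
  10 cases.\<close>

lemma two_of_three_cases:
  assumes "\<not> (d1 \<and> d2 \<and> d3)" "x \<Longrightarrow> d1 \<and> d3" "y \<Longrightarrow> d1 \<and> d2" "z \<Longrightarrow> d2 \<and> d3"
    and "R False False False False False False" "R False False True False False False"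
    "R False True False False False False" "R True False False False False False"
    "R False True True False False False" "R False True True False False True"
    "R True False True False False False" "R True False True True False False"
    "R True True False False False False" "R True True False False True False"
  shows "R d1 d2 d3 x y z"
  using assms by (cases d1; cases d2; cases d3; cases x; cases y; cases z) simp_all

text \<open>The two sides differ by a phase that depends only on d_1, d_2 and y. These words are
  diagonal, so the conjugate phase appears at the partner position.\<close>

lemma local_generic:
  assumes "\<not> (d1 \<and> d2 \<and> d3)" "x \<Longrightarrow> d1 \<and> d3" "y \<Longrightarrow> d1 \<and> d2" "z \<Longrightarrow> d2 \<and> d3"
  shows "lbR d1 a1 d2 a2 d3 a3 x y z (gr (d1 \<noteq> (d2 \<noteq> d3)) ((a1 \<noteq> (a2 \<noteq> a3)) \<noteq> (x \<noteq> (y \<noteq> z))))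
      (gr (d1 \<noteq> d3) ((a1 \<noteq> x) \<noteq> a3)) False =
    (if y then \<i> else 1) * (if d1 \<and> d2 then zeta else 1) * lbL d1 a1 d2 a2 d3 a3 x y z False"
    (is "?E d1 d2 d3 x y z")
proof -
  have ii: "c * \<i> * \<i> = - c" "\<i> * c * \<i> = - c" for c :: complex
    by (simp_all add: mult.assoc mult.left_commute [of _ c])
  note defs = lbR_def lbL_def ltr_def lss_def lsg_def gr_def Bval_def ii
  show ?thesis
    by (rule two_of_three_cases [where R = ?E, OF assms]; assumption?; cases a1; cases a2; cases a3)
      (simp_all add: defs)
qed

text \<open>In \<open>h\<close> and \<open>n\<close> the factors \<open>(1 + i)/2 * lsg (h \<and> \<not> n)\<close> form a unitary matrix; so after
  pairing a left with a right position, summation over \<open>n\<close> leaves only the terms with equal \<open>h\<close>.\<close>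

lemma local_QQQ:
  assumes "h' \<in> Aset Q Q Q Q"
  shows "h' = gr False ((a1 \<noteq> h) \<noteq> a3) \<longleftrightarrow> h = ((h' = H) \<noteq> (a1 \<noteq> a3))"
    and "h = ((h' = H) \<noteq> (a1 \<noteq> a3)) \<Longrightarrow> lbR True a1 True a2 True a3 False False False Q h' n =
      zeta * ((1 + \<i>) / 2) * lsg (h \<and> \<not> n) * lbL True a1 True a2 True a3 False False False h"
proof -
  have h': "h' = Z \<or> h' = H" using assms by (auto simp: Aset_def)
  show "h' = gr False ((a1 \<noteq> h) \<noteq> a3) \<longleftrightarrow> h = ((h' = H) \<noteq> (a1 \<noteq> a3))"
    using h' by (auto simp: gr_def)
  assume h: "h = ((h' = H) \<noteq> (a1 \<noteq> a3))"
  show "lbR True a1 True a2 True a3 False False False Q h' n =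
      zeta * ((1 + \<i>) / 2) * lsg (h \<and> \<not> n) * lbL True a1 True a2 True a3 False False False h"
    unfolding h using h'
    by (elim disjE; cases a1; cases a2; cases a3; cases n;
        simp add: lbR_def lbL_def ltr_def lss_def lsg_def gr_def Bval_def field_simps)
qed

section \<open>From single positions to whole words\<close>

lemma sum_Pow_prod:
  fixes f :: "nat \<Rightarrow> bool \<Rightarrow> complex"
  assumes "g \<subseteq> {..<n}"
  shows "(\<Sum>w\<in>Pow g. \<Prod>i<n. f i (i \<in> w)) = (\<Prod>i<n. f i False + (if i \<in> g then f i True else 0))"
proof -
  have fin: "finite g" using assms finite_subset by blast
  \<comment> \<open>Expanding the product gives a sum over all subsets of \<open>{..<n}\<close>; a
    subset not inside g picks up a factor 0.\<close>
  have "(\<Prod>i<n. (if i \<in> g then f i True else 0) + f i False) =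
      (\<Sum>X\<in>Pow {..<n}. (\<Prod>i\<in>X. if i \<in> g then f i True else 0) * (\<Prod>i\<in>{..<n} - X. f i False))"
    by (rule prod_add) simp
  also have "\<dots> = (\<Sum>X\<in>Pow g. (\<Prod>i\<in>X. if i \<in> g then f i True else 0) * (\<Prod>i\<in>{..<n} - X. f i False))"
  proof (rule sum.mono_neutral_right)
    show "\<forall>X\<in>Pow {..<n} - Pow g.
        (\<Prod>i\<in>X. if i \<in> g then f i True else 0) * (\<Prod>i\<in>{..<n} - X. f i False) = 0"
    proof
      fix X assume X: "X \<in> Pow {..<n} - Pow g"
      then obtain i where "i \<in> X" "i \<notin> g" by blast
      moreover have "finite X" using X finite_subset by blast
      ultimately have "(\<Prod>i\<in>X. if i \<in> g then f i True else 0) = 0"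
        by (intro prod_zero) auto
      then show "(\<Prod>i\<in>X. if i \<in> g then f i True else 0) * (\<Prod>i\<in>{..<n} - X. f i False) = 0"
        by simp
    qed
  qed (use assms in auto)
  also have "\<dots> = (\<Sum>w\<in>Pow g. \<Prod>i<n. f i (i \<in> w))"
  proof (rule sum.cong [OF refl])
    fix w assume w: "w \<in> Pow g"
    then have sub: "w \<subseteq> {..<n}" using assms by blast
    have "(\<Prod>i<n. f i (i \<in> w)) = (\<Prod>i\<in>{..<n} - w. f i (i \<in> w)) * (\<Prod>i\<in>w. f i (i \<in> w))"
      by (rule prod.subset_diff [OF sub]) simp
    also have "(\<Prod>i\<in>{..<n} - w. f i (i \<in> w)) = (\<Prod>i\<in>{..<n} - w. f i False)"
      by (rule prod.cong) auto
    also have "(\<Prod>i\<in>w. f i (i \<in> w)) = (\<Prod>i\<in>w. if i \<in> g then f i True else 0)"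
      using w by (intro prod.cong) auto
    finally show "(\<Prod>i\<in>w. if i \<in> g then f i True else 0) * (\<Prod>i\<in>{..<n} - w. f i False) =
        (\<Prod>i<n. f i (i \<in> w))" by simp
  qed
  finally show ?thesis by (simp add: add.commute)
qed

lemma sum_rotate4:
  "(\<Sum>z\<in>A. \<Sum>n\<in>B. \<Sum>x\<in>C. \<Sum>y\<in>E. h z n x y) = (\<Sum>x\<in>C. \<Sum>y\<in>E. \<Sum>z\<in>A. \<Sum>n\<in>B. h z n x y)"
proof -
  have "(\<Sum>z\<in>A. \<Sum>n\<in>B. \<Sum>x\<in>C. \<Sum>y\<in>E. h z n x y) = (\<Sum>z\<in>A. \<Sum>x\<in>C. \<Sum>n\<in>B. \<Sum>y\<in>E. h z n x y)"
    by (rule sum.cong [OF refl], rule sum.swap)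
  also have "\<dots> = (\<Sum>x\<in>C. \<Sum>z\<in>A. \<Sum>n\<in>B. \<Sum>y\<in>E. h z n x y)"
    by (rule sum.swap)
  also have "\<dots> = (\<Sum>x\<in>C. \<Sum>z\<in>A. \<Sum>y\<in>E. \<Sum>n\<in>B. h z n x y)"
    by (rule sum.cong [OF refl], rule sum.cong [OF refl], rule sum.swap)
  also have "\<dots> = (\<Sum>x\<in>C. \<Sum>y\<in>E. \<Sum>z\<in>A. \<Sum>n\<in>B. h z n x y)"
    by (rule sum.cong [OF refl], rule sum.swap)
  finally show ?thesis .
qed

text \<open>The conjugate of a real sign is written out so that all factors have the shape used in
  \<open>gB\<close>, where right components are conjugated.\<close>

lemma sg_lsg: "sg r X = (\<Prod>i<r. lsg (i \<in> X) * cnj (lsg (i + r \<in> X)))"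
  unfolding sg_prod cnj_lsg by (simp add: lsg_def)

lemma iw_cnj: "iw r X = (\<Prod>i<r. (if i \<in> X then \<i> else 1) * cnj (if i + r \<in> X then \<i> else 1))"
  unfolding iw_def by (rule prod.cong) auto

lemma ss_prod: "ss r d1 a1 d2 a2 = (\<Prod>i<r. lss (i \<in> d1) (i \<in> a1) (i \<in> d2) (i \<in> a2) *
    cnj (lss (i + r \<in> d1) (i + r \<in> a1) (i + r \<in> d2) (i + r \<in> a2)))"
  unfolding ss_def sg_lsg iw_cnj prod.distrib [symmetric]
  by (rule prod.cong [OF refl]) (simp add: lss_def mult_ac)

text \<open>The sign of e_(a_1) t_(d_1) times the product of e_(a_2) t_(d_2) and e_(a_3) t_(d_3), in
  the term with inner word x and outer word y; cocycle factors that do not involve x and y are kept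
  apart.\<close>

definition tr :: "nat \<Rightarrow> nat set \<Rightarrow> nat set \<Rightarrow> nat set \<Rightarrow> nat set \<Rightarrow> nat set \<Rightarrow> nat set \<Rightarrow> nat set \<Rightarrow> nat set \<Rightarrow> complex" where
  "tr r d1 a1 d2 a2 d3 a3 x y = ss r d2 a2 d3 a3 * ss r d1 a1 (sd d2 d3) (sd (sd a2 x) a3) *
    sg r (x \<inter> a3) * sg r (y \<inter> sd a2 a3)"

lemma tr_prod: "tr r d1 a1 d2 a2 d3 a3 x y = (\<Prod>i<r.
    ltr (i \<in> d1) (i \<in> a1) (i \<in> d2) (i \<in> a2) (i \<in> d3) (i \<in> a3) (i \<in> x) (i \<in> y) *
    cnj (ltr (i + r \<in> d1) (i + r \<in> a1) (i + r \<in> d2) (i + r \<in> a2) (i + r \<in> d3) (i + r \<in> a3)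
      (i + r \<in> x) (i + r \<in> y)))"
  unfolding tr_def ss_prod sg_lsg prod.distrib [symmetric] mem_sd Int_iff
  by (rule prod.cong [OF refl]) (simp add: ltr_def mult_ac)

lemma gB_prod: "gB r r m0 m1 m2 m3 m m' = (\<Prod>i<r. Bval (m0 i) (m1 i) (m2 i) (m3 i) (m i) (m' i) *
    cnj (Bval (m0 (i + r)) (m1 (i + r)) (m2 (i + r)) (m3 (i + r)) (m (i + r)) (m' (i + r))))"
proof -
  have "(\<Prod>i\<in>{r..<r + r}. f i) = (\<Prod>i<r. f (i + r))" for f :: "nat \<Rightarrow> complex"
  proof -
    have "(\<Prod>i\<in>{r..<r + r}. f i) = (\<Prod>i\<in>{0 + r..<r + r}. f i)" by simp
    also have "\<dots> = (\<Prod>i<r. f (i + r))"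
      by (subst prod.shift_bounds_nat_ivl) (simp add: lessThan_atLeast0)
    finally show ?thesis .
  qed
  then show ?thesis unfolding gB_def by (simp only: prod.distrib)
qed

lemma grade_eq_iff:
  assumes "m \<in> grades r r" "m' \<in> grades r r"
  shows "m = m' \<longleftrightarrow> (\<forall>i<r. m i = m' i \<and> m (i + r) = m' (i + r))"
proof
  assume *: "\<forall>i<r. m i = m' i \<and> m (i + r) = m' (i + r)"
  have "m i = m' i" for i
  proof -
    consider "i < r" | "i - r < r" "i = i - r + r" | "r + r \<le> i" by linarith
    then show ?thesis using * assms by cases (metis, metis, simp add: grades_def)
  qed
  then show "m = m'" by blast
qed simp

section \<open>The braiding axiom on basis elements\<close>

context code_setup
begin

lemma P_char: "x \<in> P d \<longleftrightarrow> x \<subseteq> d \<and> x \<subseteq> {..<2 * r} \<and> (\<forall>i<r. i + r \<in> x \<longleftrightarrow> i \<in> x)"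
proof
  assume x: "x \<in> P d"
  then show "x \<subseteq> d \<and> x \<subseteq> {..<2 * r} \<and> (\<forall>i<r. i + r \<in> x \<longleftrightarrow> i \<in> x)"
    using P_sub [OF x] P_sub [OF P_lim [OF x]] P_diag [OF x] by simp
next
  assume x: "x \<subseteq> d \<and> x \<subseteq> {..<2 * r} \<and> (\<forall>i<r. i + r \<in> x \<longleftrightarrow> i \<in> x)"
  have "x = Delta r (x \<inter> {..<r})"
  proof (rule set_eqI)
    fix i
    show "i \<in> x \<longleftrightarrow> i \<in> Delta r (x \<inter> {..<r})"
    proof (cases "i < r")
      case False
      then obtain j where j: "i = j + r" by (metis le_add_diff_inverse2 not_less)
      have "j + r \<in> x \<longleftrightarrow> j < r \<and> j \<in> x"
      proof (cases "j < r")
        case False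
        then have "j + r \<notin> x" using x by auto
        then show ?thesis using False by simp
      qed (use x in simp)
      then show ?thesis unfolding j by (auto simp: mem_Delta)
    qed (auto simp: mem_Delta)
  qed
  moreover have "x \<subseteq> d" using x by simp
  ultimately show "x \<in> P d" unfolding Deltad_def by (metis (mono_tags, lifting) Int_lower2 mem_Collect_eq)
qed

lemma sum_P_split:
  assumes A: "A \<in> P {..<2 * r}" and B: "B \<in> P {..<2 * r}" and AB: "A \<inter> B = {}" and d: "d = A \<union> B"
  shows "(\<Sum>x\<in>P d. f x) = (\<Sum>u\<in>P A. \<Sum>v\<in>P B. f (sd u v))"
proof -
  have "(\<Sum>x\<in>P d. f x) = (\<Sum>(u, v)\<in>P A \<times> P B. f (sd u v))"
  proof (rule sum.reindex_bij_witness [where j = "\<lambda>x. (x \<inter> A, x \<inter> B)" and i = "\<lambda>(u, v). sd u v"])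
    fix x assume x: "x \<in> P d"
    have "sd (x \<inter> A) (x \<inter> B) = x" using AB P_sub [OF x] d by (auto simp: disjoint_iff)
    then show "(case (x \<inter> A, x \<inter> B) of (u, v) \<Rightarrow> sd u v) = x"
      "(case (x \<inter> A, x \<inter> B) of (u, v) \<Rightarrow> f (sd u v)) = f x" by simp_all
    have "x \<inter> A \<in> P A" using x A unfolding P_char [of x] P_char [of A] P_char [of "x \<inter> A"] by blast
    moreover have "x \<inter> B \<in> P B" using x B unfolding P_char [of x] P_char [of B] P_char [of "x \<inter> B"] by blast
    ultimately show "(x \<inter> A, x \<inter> B) \<in> P A \<times> P B" by simp
  next
    fix b assume b: "b \<in> P A \<times> P B"
    obtain u v where uv: "b = (u, v)" by (cases b)
    have u: "u \<in> P A" and v: "v \<in> P B" using b uv by auto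
    have "sd u v \<inter> A = u" "sd u v \<inter> B = v"
      using P_sub [OF u] P_sub [OF v] AB unfolding sd_def by blast+
    then show "((case b of (u, v) \<Rightarrow> sd u v) \<inter> A, (case b of (u, v) \<Rightarrow> sd u v) \<inter> B) = b"
      by (simp add: uv)
    have "u \<in> P d" using u unfolding P_char [of u] d by blast
    moreover have "v \<in> P d" using v unfolding P_char [of v] d by blast
    ultimately show "(case b of (u, v) \<Rightarrow> sd u v) \<in> P d" by (simp add: uv P_sd)
  qed
  then show ?thesis by (simp add: sum.cartesian_product)
qed

text \<open>A diagonal word is free only in its left half. One summation bit therefore governs
  positions i and i + r at once, which is why the product over positions is taken over
  pairs.\<close>

lemma sum_P_Pow:
  assumes p: "p \<in> P {..<2 * r}"
  shows "(\<Sum>w\<in>P p. f w) = (\<Sum>u\<in>Pow (p \<inter> {..<r}). f (Delta r u))"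
proof (rule sum.reindex_bij_witness [where i = "Delta r" and j = "\<lambda>w. w \<inter> {..<r}"])
  have DP: "Delta r (w \<inter> {..<r}) = w" if w: "w \<in> P p" for w
  proof -
    obtain g where "g \<subseteq> {..<r}" "w = Delta r g" using P_Delta [OF w] by blast
    moreover from this have "w \<inter> {..<r} = g" by (auto simp: mem_Delta)
    ultimately show ?thesis by simp
  qed
  show "Delta r (w \<inter> {..<r}) = w" "f (Delta r (w \<inter> {..<r})) = f w" if "w \<in> P p" for w
    using DP [OF that] by simp_all
  show "w \<inter> {..<r} \<in> Pow (p \<inter> {..<r})" if "w \<in> P p" for w
    using P_sub [OF that] by blast
  show "Delta r u \<inter> {..<r} = u" if "u \<in> Pow (p \<inter> {..<r})" for u
    using that by (auto simp: mem_Delta)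
  show "Delta r u \<in> P p" if "u \<in> Pow (p \<inter> {..<r})" for u
  proof -
    have u: "u \<subseteq> {..<r}" "u \<subseteq> p" using that by auto
    then have "Delta r u \<subseteq> p"
      using P_diag [OF p] by (fastforce simp: Delta_def)
    then show ?thesis using u(1) unfolding Deltad_def by blast
  qed
qed

lemma D_P: "d \<in> D \<Longrightarrow> d \<in> P {..<2 * r}"
  unfolding P_char using D_sub D_diag by blast

lemma pr_Ff: "pr m (Ff d a x) = (if m = gof d (sd a x - d) then Ff d a x else 0)"
  by (simp add: Ff_def vlin_sc [OF vlin_pr] L_pr [symmetric] pr_delta vlin_zero [OF vlin_L])

lemma gof_absorb: "y \<subseteq> d \<Longrightarrow> gof d (sd a (sd x y) - d) = gof d (sd a x - d)"
  by (rule arg_cong [where f = "gof d"]) auto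

text \<open>The inner word x is pulled out to the right as well, at the cost of
  \<open>sg r (x \<inter> a3)\<close>, so that x and y affect the resulting vector only through
  \<open>sd x y\<close>.\<close>

lemma L_triple:
  assumes d1: "d1 \<in> D" and a1: "a1 \<in> C" and d2: "d2 \<in> D" and a2: "a2 \<in> C"
    and d3: "d3 \<in> D" and a3: "a3 \<in> C"
  defines "d \<equiv> sd d1 (sd d2 d3)" and "a \<equiv> sd a1 (sd a2 a3)"
  shows "L (pr m0 (prodV r G (delta d1 a1) (pr m (prodV r G (delta d2 a2) (delta d3 a3))))) =
    (\<Sum>x\<in>P (d2 \<inter> d3). \<Sum>y\<in>P (d1 \<inter> sd d2 d3).
      sc (eps r a2 a3 * eps r a1 a2 * eps r a1 a3 * tr r d1 a1 d2 a2 d3 a3 x y)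
       (if m = gof (sd d2 d3) (sd (sd a2 x) a3 - sd d2 d3) \<and> m0 = gof d (sd a (sd x y) - d)
        then Ff d a (sd x y) else 0))"
proof -
  let ?b = "\<lambda>x. sd (sd a2 x) a3" and ?e = "sd d2 d3"
  have e: "?e \<in> D" using d2 d3 by (rule D_sd)
  have aC: "a \<in> C" unfolding a_def using a1 a2 a3 C_sd by blast
  define F where "F = (\<lambda>v. L (pr m0 (prodV r G (delta d1 a1) v)))"
  have F: "vlin F"
    unfolding F_def by (intro vlin_comp [OF vlin_L] vlin_comp [OF vlin_pr] vlin_prod_right)
  have tm: "sc (ss r d2 a2 d3 a3 * (eps r a2 x * eps r (sd a2 x) a3)) (F (delta ?e (?b x))) =
      (\<Sum>y\<in>P (d1 \<inter> ?e). sc (eps r a2 a3 * eps r a1 a2 * eps r a1 a3 * tr r d1 a1 d2 a2 d3 a3 x y)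
         (if m0 = gof d (sd a (sd x y) - d) then Ff d a (sd x y) else 0))"
    if x: "x \<in> P (d2 \<inter> d3)" for x
  proof -
    have xC: "x \<in> C" using x P_C by blast
    have bC: "?b x \<in> C" using a2 a3 xC C_sd by blast
    have ab: "sd a1 (?b x) = sd a x" unfolding a_def by (simp only: sd_ac)
    have eq: "eps r a2 x * eps r (sd a2 x) a3 * eps r a1 (?b x) * eps r a x =
        eps r a2 a3 * eps r a1 a2 * eps r a1 a3 * sg r (x \<inter> a3)"
      unfolding a_def using a1 a2 a3 xC
      by (simp add: eps_addl eps_addr C_sd eps_comm [of x a3] mult_ac eps_sq_left eps_sq)
    have "F (delta ?e (?b x)) = pr m0 (sc (ss r d1 a1 ?e (?b x) * eps r a1 (?b x))
        (\<Sum>y\<in>P (d1 \<inter> ?e). sc (sg r (y \<inter> ?b x)) (Ff d (sd a x) y)))"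
      unfolding F_def L_pr L_prod_delta [OF d1 a1 e bC] ab d_def by simp
    also have "\<dots> = (\<Sum>y\<in>P (d1 \<inter> ?e). sc (ss r d1 a1 ?e (?b x) * eps r a1 (?b x) * (sg r (y \<inter> ?b x) * eps r a x))
        (pr m0 (Ff d a (sd x y))))"
      by (simp add: vlin_sc [OF vlin_pr] vlin_sum [OF vlin_pr] sc_sum
          Ff_shift [OF aC _ x] mult.assoc cong: sum.cong)
    finally have 1: "F (delta ?e (?b x)) = \<dots>" .
    show ?thesis
      unfolding 1 sc_sum sc_sc pr_Ff
    proof (rule sum.cong [OF refl])
      fix y assume y: "y \<in> P (d1 \<inter> ?e)"
      \<comment> \<open>Two diagonal words meet in a diagonal word, of weight 0, so x drops out of
        this sign.\<close>
      have "sg r (y \<inter> x) = 1"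
        using P_diag [OF x] P_diag [OF y] by (simp add: sg_def swt_diag)
      then have 2: "sg r (y \<inter> ?b x) = sg r (y \<inter> sd a2 a3)"
        by (simp add: sg_Int_sd' [OF r])
      have "ss r d2 a2 d3 a3 * (eps r a2 x * eps r (sd a2 x) a3) *
          (ss r d1 a1 ?e (?b x) * eps r a1 (?b x) * (sg r (y \<inter> ?b x) * eps r a x)) =
        (eps r a2 x * eps r (sd a2 x) a3 * eps r a1 (?b x) * eps r a x) *
          (ss r d2 a2 d3 a3 * ss r d1 a1 ?e (?b x) * sg r (y \<inter> sd a2 a3))"
        unfolding 2 by (simp add: mult_ac)
      also have "\<dots> = eps r a2 a3 * eps r a1 a2 * eps r a1 a3 * tr r d1 a1 d2 a2 d3 a3 x y"
        unfolding eq tr_def by (simp add: mult_ac)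
      finally have 3: "ss r d2 a2 d3 a3 * (eps r a2 x * eps r (sd a2 x) a3) *
          (ss r d1 a1 ?e (?b x) * eps r a1 (?b x) * (sg r (y \<inter> ?b x) * eps r a x)) = \<dots>" .
      show "sc (ss r d2 a2 d3 a3 * (eps r a2 x * eps r (sd a2 x) a3) *
          (ss r d1 a1 ?e (?b x) * eps r a1 (?b x) * (sg r (y \<inter> ?b x) * eps r a x)))
          (if m0 = gof d (sd a (sd x y) - d) then Ff d a (sd x y) else 0) =
        sc (eps r a2 a3 * eps r a1 a2 * eps r a1 a3 * tr r d1 a1 d2 a2 d3 a3 x y)
          (if m0 = gof d (sd a (sd x y) - d) then Ff d a (sd x y) else 0)"
        unfolding 3 ..
    qed
  qed
  have "L (pr m0 (prodV r G (delta d1 a1) (pr m (prodV r G (delta d2 a2) (delta d3 a3))))) =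
      F (pr m (prodV r G (delta d2 a2) (delta d3 a3)))"
    by (simp add: F_def)
  also have "\<dots> = (\<Sum>x\<in>P (d2 \<inter> d3). if m = gof ?e (?b x - ?e) then
      sc (ss r d2 a2 d3 a3 * (eps r a2 x * eps r (sd a2 x) a3)) (F (delta ?e (?b x))) else 0)"
    unfolding prod_delta [OF d2 a2 d3 a3] vlin_sc [OF vlin_pr] vlin_sum [OF vlin_pr]
      vlin_sc [OF F] vlin_sum [OF F] sc_sum sc_sc
    by (rule sum.cong [OF refl]) (simp add: pr_delta vlin_zero [OF F])
  also have "\<dots> = (\<Sum>x\<in>P (d2 \<inter> d3). \<Sum>y\<in>P (d1 \<inter> sd d2 d3).
      sc (eps r a2 a3 * eps r a1 a2 * eps r a1 a3 * tr r d1 a1 d2 a2 d3 a3 x y)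
       (if m = gof ?e (?b x - ?e) \<and> m0 = gof d (sd a (sd x y) - d)
        then Ff d a (sd x y) else 0))"
  proof (rule sum.cong [OF refl])
    fix x assume x: "x \<in> P (d2 \<inter> d3)"
    show "(if m = gof ?e (?b x - ?e) then
        sc (ss r d2 a2 d3 a3 * (eps r a2 x * eps r (sd a2 x) a3)) (F (delta ?e (?b x))) else 0) =
      (\<Sum>y\<in>P (d1 \<inter> sd d2 d3).
        sc (eps r a2 a3 * eps r a1 a2 * eps r a1 a3 * tr r d1 a1 d2 a2 d3 a3 x y)
         (if m = gof ?e (?b x - ?e) \<and> m0 = gof d (sd a (sd x y) - d)
          then Ff d a (sd x y) else 0))"
      unfolding tm [OF x] by (cases "m = gof ?e (?b x - ?e)") simp_all
  qed
  finally show ?thesis .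
qed

text \<open>This compares the coefficients of one vector \<open>Ff\<close>. With x, y, z fixed, the
  words w and n range over the triple overlap; that overlap is contained in the total d, so they
  change neither the vector nor its grade, and their contributions are summed.\<close>

lemma FA4_scalar:
  assumes d1: "d1 \<in> D" and a1: "a1 \<in> C" and d2: "d2 \<in> D" and a2: "a2 \<in> C"
    and d3: "d3 \<in> D" and a3: "a3 \<in> C"
    and x: "x \<in> P (d1 \<inter> d3 - d2)" and y: "y \<in> P (d1 \<inter> d2 - d3)" and z: "z \<in> P (d2 \<inter> d3 - d1)"
    and m0: "m0 = gof (sd d1 (sd d2 d3)) (sd (sd a1 (sd a2 a3)) (sd x (sd y z)) - sd d1 (sd d2 d3))"
    and m': "m' \<in> gA r r m0 (gof d2 (a2 - d2)) (gof d1 (a1 - d1)) (gof d3 (a3 - d3))"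
  shows "(\<Sum>w\<in>P (d1 \<inter> d2 \<inter> d3). if m' = gof (sd d1 d3) (sd (sd a1 (sd x w)) a3 - sd d1 d3)
      then tr r d2 a2 d1 a1 d3 a3 (sd x w) (sd y z) else 0) =
    sg r (a1 \<inter> a2) * (\<Sum>n\<in>P (d1 \<inter> d2 \<inter> d3).
      gB r r m0 (gof d1 (a1 - d1)) (gof d2 (a2 - d2)) (gof d3 (a3 - d3))
        (gof (sd d2 d3) (sd (sd a2 (sd z n)) a3 - sd d2 d3)) m' *
      tr r d1 a1 d2 a2 d3 a3 (sd z n) (sd x y))"
proof -
  let ?p = "d1 \<inter> d2 \<inter> d3"
  let ?g = "?p \<inter> {..<r}"
  have p: "?p \<in> P {..<2 * r}" using D_P [OF d1] D_P [OF d2] D_P [OF d3] unfolding P_char by blast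
  have m'g: "m' \<in> grades r r" using m' by (simp add: gA_def)
  have m0i: "m0 i = gr ((i \<in> d1) \<noteq> ((i \<in> d2) \<noteq> (i \<in> d3)))
      (((i \<in> a1) \<noteq> ((i \<in> a2) \<noteq> (i \<in> a3))) \<noteq> ((i \<in> x) \<noteq> ((i \<in> y) \<noteq> (i \<in> z))))" for i
    unfolding m0 gof_gr mem_sd ..
  \<comment> \<open>The condition on \<open>m'\<close> is itself positionwise and moves into the
    factors; one violated position makes the product 0.\<close>
  define hL where "hL i b = (if m' i = gr ((i \<in> d1) \<noteq> (i \<in> d3)) (((i \<in> a1) \<noteq> ((i \<in> x) \<noteq> b)) \<noteq> (i \<in> a3))
    then lbL (i \<in> d1) (i \<in> a1) (i \<in> d2) (i \<in> a2) (i \<in> d3) (i \<in> a3) (i \<in> x) (i \<in> y) (i \<in> z) b else 0)" for i b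
  define hR where "hR i b = lbR (i \<in> d1) (i \<in> a1) (i \<in> d2) (i \<in> a2) (i \<in> d3) (i \<in> a3)
    (i \<in> x) (i \<in> y) (i \<in> z) (m0 i) (m' i) b" for i b
  have L: "(if m' = gof (sd d1 d3) (sd (sd a1 (sd x (Delta r u))) a3 - sd d1 d3)
      then tr r d2 a2 d1 a1 d3 a3 (sd x (Delta r u)) (sd y z) else 0) =
      (\<Prod>i<r. hL i (i \<in> u) * cnj (hL (i + r) (i \<in> u)))" if u: "u \<subseteq> {..<r}" for u
  proof -
    let ?m = "gof (sd d1 d3) (sd (sd a1 (sd x (Delta r u))) a3 - sd d1 d3)"
    have uC: "Delta r u \<in> C" using u P_C [of "Delta r u" "Delta r u"] by (auto simp: Deltad_def)
    have mg: "?m \<in> grades r r"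
      by (intro gof_grades D_sd C_sd d1 d3 a1 a3 uC P_C [OF x])
    have mi: "?m i = gr ((i \<in> d1) \<noteq> (i \<in> d3)) (((i \<in> a1) \<noteq> ((i \<in> x) \<noteq> (i \<in> Delta r u))) \<noteq> (i \<in> a3))" for i
      unfolding gof_gr mem_sd ..
    note Du = Delta_left [OF u] Delta_right [OF u]
    show ?thesis
    proof (cases "m' = ?m")
      case True
      \<comment> \<open>The inserted factor is globally 1 by orthogonality of a1 and d2. Position by
        position it supplies a sign that the local identity needs, for instance where h_1 = 1/2, h_2
        = 1/16 and h_3 = 0.\<close>
      have "tr r d2 a2 d1 a1 d3 a3 (sd x (Delta r u)) (sd y z) =
          tr r d2 a2 d1 a1 d3 a3 (sd x (Delta r u)) (sd y z) * sg r (d2 \<inter> a1)"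
        by (simp add: sg_CD [OF a1 d2])
      also have "\<dots> = (\<Prod>i<r. hL i (i \<in> u) * cnj (hL (i + r) (i \<in> u)))"
        unfolding tr_prod sg_lsg prod.distrib [symmetric]
      proof (rule prod.cong [OF refl])
        fix i assume "i \<in> {..<r}"
        then have i: "i < r" by simp
        have h: "m' i = gr ((i \<in> d1) \<noteq> (i \<in> d3)) (((i \<in> a1) \<noteq> ((i \<in> x) \<noteq> (i \<in> u))) \<noteq> (i \<in> a3))"
          "m' (i + r) = gr ((i + r \<in> d1) \<noteq> (i + r \<in> d3))
            (((i + r \<in> a1) \<noteq> ((i + r \<in> x) \<noteq> (i \<in> u))) \<noteq> (i + r \<in> a3))"
          unfolding True mi Du(1) [OF i] Du(2) by (rule refl)+
        show "ltr (i \<in> d2) (i \<in> a2) (i \<in> d1) (i \<in> a1) (i \<in> d3) (i \<in> a3)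
           (i \<in> sd x (Delta r u)) (i \<in> sd y z) *
          cnj (ltr (i + r \<in> d2) (i + r \<in> a2) (i + r \<in> d1) (i + r \<in> a1) (i + r \<in> d3)
            (i + r \<in> a3) (i + r \<in> sd x (Delta r u)) (i + r \<in> sd y z)) *
          (lsg (i \<in> d2 \<inter> a1) * cnj (lsg (i + r \<in> d2 \<inter> a1))) =
          hL i (i \<in> u) * cnj (hL (i + r) (i \<in> u))"
          unfolding hL_def if_P [OF h(1)] if_P [OF h(2)] lbL_def mem_sd Int_iff Du(1) [OF i] Du(2)
            complex_cnj_mult
          by (simp only: mult_ac)
      qed
      finally show ?thesis using True by simp
    next
      case False
      then obtain i where i: "i < r" "m' i \<noteq> ?m i \<or> m' (i + r) \<noteq> ?m (i + r)"
        unfolding grade_eq_iff [OF m'g mg] by blast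
      have "hL i (i \<in> u) * cnj (hL (i + r) (i \<in> u)) = 0"
        using i(2) unfolding mi Du(1) [OF i(1)] Du(2) hL_def by auto
      then have "(\<Prod>i<r. hL i (i \<in> u) * cnj (hL (i + r) (i \<in> u))) = 0"
        using i(1) by (intro prod_zero) auto
      then show ?thesis using False by simp
    qed
  qed
  have R: "sg r (a1 \<inter> a2) * (gB r r m0 (gof d1 (a1 - d1)) (gof d2 (a2 - d2)) (gof d3 (a3 - d3))
        (gof (sd d2 d3) (sd (sd a2 (sd z (Delta r u))) a3 - sd d2 d3)) m' *
      tr r d1 a1 d2 a2 d3 a3 (sd z (Delta r u)) (sd x y)) =
      (\<Prod>i<r. hR i (i \<in> u) * cnj (hR (i + r) (i \<in> u)))" if u: "u \<subseteq> {..<r}" for u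
    unfolding gB_prod tr_prod sg_lsg prod.distrib [symmetric]
  proof (rule prod.cong [OF refl])
    fix i assume "i \<in> {..<r}"
    then have i: "i < r" by simp
    note Du = Delta_left [OF u i] Delta_right [OF u, of i]
    show "lsg (i \<in> a1 \<inter> a2) * cnj (lsg (i + r \<in> a1 \<inter> a2)) *
        (Bval (m0 i) (gof d1 (a1 - d1) i) (gof d2 (a2 - d2) i) (gof d3 (a3 - d3) i)
          (gof (sd d2 d3) (sd (sd a2 (sd z (Delta r u))) a3 - sd d2 d3) i) (m' i) *
         cnj (Bval (m0 (i + r)) (gof d1 (a1 - d1) (i + r)) (gof d2 (a2 - d2) (i + r)) (gof d3 (a3 - d3) (i + r))
          (gof (sd d2 d3) (sd (sd a2 (sd z (Delta r u))) a3 - sd d2 d3) (i + r)) (m' (i + r))) *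
         (ltr (i \<in> d1) (i \<in> a1) (i \<in> d2) (i \<in> a2) (i \<in> d3) (i \<in> a3)
           (i \<in> sd z (Delta r u)) (i \<in> sd x y) *
          cnj (ltr (i + r \<in> d1) (i + r \<in> a1) (i + r \<in> d2) (i + r \<in> a2) (i + r \<in> d3)
            (i + r \<in> a3) (i + r \<in> sd z (Delta r u)) (i + r \<in> sd x y)))) =
        hR i (i \<in> u) * cnj (hR (i + r) (i \<in> u))"
      unfolding hR_def lbR_def gof_gr mem_sd Int_iff Du complex_cnj_mult
      by (simp only: mult_ac)
  qed
  have loc: "hL i False * cnj (hL (i + r) False) +
        (if i \<in> ?g then hL i True * cnj (hL (i + r) True) else 0) =
      hR i False * cnj (hR (i + r) False) +
        (if i \<in> ?g then hR i True * cnj (hR (i + r) True) else 0)" if i: "i < r" for i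
  proof -
    have A: "m' j \<in> Aset (m0 j) (gr (j \<in> d2) (j \<in> a2)) (gr (j \<in> d1) (j \<in> a1)) (gr (j \<in> d3) (j \<in> a3))"
      if "j < r + r" for j
      using m' that by (simp add: gA_def gof_gr)
    have dd: "i + r \<in> d1 \<longleftrightarrow> i \<in> d1" "i + r \<in> d2 \<longleftrightarrow> i \<in> d2" "i + r \<in> d3 \<longleftrightarrow> i \<in> d3"
      "i + r \<in> x \<longleftrightarrow> i \<in> x" "i + r \<in> y \<longleftrightarrow> i \<in> y" "i + r \<in> z \<longleftrightarrow> i \<in> z"
      using D_diag [OF d1 i] D_diag [OF d2 i] D_diag [OF d3 i] P_diag [OF x i] P_diag [OF y i] P_diag [OF z i]
      by simp_all
    have xs: "j \<in> x \<Longrightarrow> j \<in> d1 \<and> j \<in> d3" "j \<in> y \<Longrightarrow> j \<in> d1 \<and> j \<in> d2" "j \<in> z \<Longrightarrow> j \<in> d2 \<and> j \<in> d3"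
      for j using P_sub [OF x] P_sub [OF y] P_sub [OF z] by auto
    show ?thesis
    proof (cases "i \<in> ?p")
      case False
      \<comment> \<open>The phase of \<open>local_generic\<close>. It is the same at i and i + r,
        and the factor at i + r is conjugated, so it enters as |c|^2 = 1.\<close>
      define c where "c = (if i \<in> y then \<i> else 1) * (if i \<in> d1 \<and> i \<in> d2 then zeta else 1)"
      have cc: "c * cnj c = 1"
      proof -
        have 1: "(if b then \<i> else 1) * cnj (if b then \<i> else 1) = 1" for b by simp
        have 2: "(if b then zeta else 1) * cnj (if b then zeta else 1) = 1" for b
          by (cases b) (simp_all only: if_True if_False zeta_norm complex_cnj_one mult_1)
        have "s * t * (cnj s * cnj t) = s * cnj s * (t * cnj t)" for s t :: complex
          by (simp only: mult_ac)
        then show ?thesis unfolding c_def complex_cnj_mult by (simp only: 1 2 mult_1)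
      qed
      have h: "hR j False = (if j \<in> y then \<i> else 1) * (if j \<in> d1 \<and> j \<in> d2 then zeta else 1) * hL j False"
        if j: "j < r + r" "\<not> (j \<in> d1 \<and> j \<in> d2 \<and> j \<in> d3)" for j
      proof -
        have 1: "m' j = gr ((j \<in> d1) \<noteq> (j \<in> d3)) (((j \<in> a1) \<noteq> (j \<in> x)) \<noteq> (j \<in> a3))"
          by (rule local_grade [OF j(2) xs A [OF j(1), unfolded m0i]])
        then have 2: "hL j False = lbL (j \<in> d1) (j \<in> a1) (j \<in> d2) (j \<in> a2) (j \<in> d3) (j \<in> a3)
            (j \<in> x) (j \<in> y) (j \<in> z) False"
          by (simp add: hL_def)
        show ?thesis unfolding hR_def m0i 1 2 by (rule local_generic [OF j(2) xs])
      qed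
      have hi: "hR i False = c * hL i False"
        unfolding c_def using False i by (intro h) auto
      have hir: "hR (i + r) False = c * hL (i + r) False"
        using h [of "i + r"] False i unfolding c_def dd by simp
      have eq: "hR i False * cnj (hR (i + r) False) = c * cnj c * (hL i False * cnj (hL (i + r) False))"
        unfolding hi hir by (simp only: complex_cnj_mult mult_ac)
      have ng: "i \<notin> ?g" using False by blast
      show ?thesis unfolding if_not_P [OF ng] eq cc by simp
    next
      case True
      then have no: "j \<in> d1" "j \<in> d2" "j \<in> d3" "j \<notin> x" "j \<notin> y" "j \<notin> z" if "j = i \<or> j = i + r" for j
        using P_sub [OF x] P_sub [OF y] P_sub [OF z] that dd by auto
      \<comment> \<open>The bit that \<open>m'\<close> prescribes at position j; \<open>m'\<close>
        need not be symmetric, so i and i + r may prescribe different bits.\<close>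
      define h where "h j = ((m' j = H) \<noteq> ((j \<in> a1) \<noteq> (j \<in> a3)))" for j
      define B where "B j = lbL True (j \<in> a1) True (j \<in> a2) True (j \<in> a3) False False False (h j)" for j
      have hL: "hL j b = (if b = h j then B j else 0)"
        and hR: "hR j b = zeta * ((1 + \<i>) / 2) * lsg (h j \<and> \<not> b) * B j"
        if j: "j = i \<or> j = i + r" for j b
      proof -
        have "j < r + r" using j i by auto
        from A [OF this] have AQ: "m' j \<in> Aset Q Q Q Q"
          using no [OF j] by (simp add: m0i gr_def)
        have iff: "m' j = gr False (((j \<in> a1) \<noteq> b) \<noteq> (j \<in> a3)) \<longleftrightarrow> b = h j"
          unfolding h_def by (rule local_QQQ(1) [OF AQ])
        have "hL j b = (if m' j = gr False (((j \<in> a1) \<noteq> b) \<noteq> (j \<in> a3))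
            then lbL True (j \<in> a1) True (j \<in> a2) True (j \<in> a3) False False False b else 0)"
          using no [OF j] by (simp add: hL_def)
        also have "\<dots> = (if b = h j then B j else 0)"
          unfolding iff B_def by (cases "b = h j") (simp_all only: if_True if_False simp_thms)
        finally show "hL j b = (if b = h j then B j else 0)" .
        have "hR j b = lbR True (j \<in> a1) True (j \<in> a2) True (j \<in> a3) False False False Q (m' j) b"
          using no [OF j] by (simp add: hR_def m0i gr_def)
        also have "\<dots> = zeta * ((1 + \<i>) / 2) * lsg (h j \<and> \<not> b) * B j"
          unfolding B_def by (rule local_QQQ(2) [OF AQ]) (rule h_def)
        finally show "hR j b = zeta * ((1 + \<i>) / 2) * lsg (h j \<and> \<not> b) * B j" .
      qed
      have half: "(1 + \<i>) / 2 * cnj ((1 + \<i>) / 2) = 1 / 2"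
        by (simp add: field_simps)
      have RR: "hR i b * cnj (hR (i + r) b) =
          1 / 2 * (lsg (h i \<and> \<not> b) * lsg (h (i + r) \<and> \<not> b)) * (B i * cnj (B (i + r)))" for b
      proof -
        have "hR i b * cnj (hR (i + r) b) = (zeta * cnj zeta) * ((1 + \<i>) / 2 * cnj ((1 + \<i>) / 2)) *
            (lsg (h i \<and> \<not> b) * lsg (h (i + r) \<and> \<not> b)) * (B i * cnj (B (i + r)))"
          unfolding hR [OF disjI1 [OF refl]] hR [OF disjI2 [OF refl]] complex_cnj_mult cnj_lsg
          by (simp only: mult_ac)
        then show ?thesis unfolding zeta_norm half by simp
      qed
      \<comment> \<open>On the left a term survives only for a bit equal to both \<open>h i\<close>
        and \<open>h (i + r)\<close>. On the right the two terms have absolute coefficient 1/2: they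
        add up if these bits agree and cancel if they differ.\<close>
      have "i \<in> ?g" using True i by simp
      then show ?thesis
        unfolding RR hL [OF disjI1 [OF refl]] hL [OF disjI2 [OF refl]]
        by (cases "h i"; cases "h (i + r)") (simp_all add: lsg_def)
    qed
  qed
  have "(\<Sum>w\<in>P ?p. if m' = gof (sd d1 d3) (sd (sd a1 (sd x w)) a3 - sd d1 d3)
      then tr r d2 a2 d1 a1 d3 a3 (sd x w) (sd y z) else 0) =
      (\<Sum>u\<in>Pow ?g. \<Prod>i<r. hL i (i \<in> u) * cnj (hL (i + r) (i \<in> u)))"
    unfolding sum_P_Pow [OF p] by (rule sum.cong [OF refl], rule L) auto
  also have "\<dots> = (\<Prod>i<r. hL i False * cnj (hL (i + r) False) +
        (if i \<in> ?g then hL i True * cnj (hL (i + r) True) else 0))"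
    by (rule sum_Pow_prod [where f = "\<lambda>i b. hL i b * cnj (hL (i + r) b)"]) simp
  also have "\<dots> = (\<Prod>i<r. hR i False * cnj (hR (i + r) False) +
        (if i \<in> ?g then hR i True * cnj (hR (i + r) True) else 0))"
    by (rule prod.cong [OF refl], rule loc) simp
  also have "\<dots> = (\<Sum>u\<in>Pow ?g. \<Prod>i<r. hR i (i \<in> u) * cnj (hR (i + r) (i \<in> u)))"
    by (rule sum_Pow_prod [where f = "\<lambda>i b. hR i b * cnj (hR (i + r) b)", symmetric]) simp
  also have "\<dots> = sg r (a1 \<inter> a2) * (\<Sum>n\<in>P ?p.
      gB r r m0 (gof d1 (a1 - d1)) (gof d2 (a2 - d2)) (gof d3 (a3 - d3))
        (gof (sd d2 d3) (sd (sd a2 (sd z n)) a3 - sd d2 d3)) m' *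
      tr r d1 a1 d2 a2 d3 a3 (sd z n) (sd x y))"
    unfolding sum_P_Pow [OF p] sum_distrib_left by (rule sum.cong [OF refl], rule R [symmetric]) auto
  finally show ?thesis .
qed

text \<open>Bracketing distributes the overlaps differently: the inner and outer sums run over q13 +
  p and q12 + q23 on the left, over q23 + p and q13 + q12 on the right. After splitting into the
  four disjoint pieces the sums over q13, q12 and q23 agree termwise, and \<open>FA4_scalar\<close>
  handles p.\<close>

lemma FA4_delta:
  assumes d1: "d1 \<in> D" and a1: "a1 \<in> C" and d2: "d2 \<in> D" and a2: "a2 \<in> C"
    and d3: "d3 \<in> D" and a3: "a3 \<in> C"
    and m': "m' \<in> gA r r m0 (gof d2 (a2 - d2)) (gof d1 (a1 - d1)) (gof d3 (a3 - d3))"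
  shows "L (pr m0 (prodV r G (delta d2 a2) (pr m' (prodV r G (delta d1 a1) (delta d3 a3))))) =
    (\<Sum>m\<in>gA r r m0 (gof d1 (a1 - d1)) (gof d2 (a2 - d2)) (gof d3 (a3 - d3)).
      sc (gB r r m0 (gof d1 (a1 - d1)) (gof d2 (a2 - d2)) (gof d3 (a3 - d3)) m m')
        (L (pr m0 (prodV r G (delta d1 a1) (pr m (prodV r G (delta d2 a2) (delta d3 a3)))))))"
proof -
  let ?m1 = "gof d1 (a1 - d1)" and ?m2 = "gof d2 (a2 - d2)" and ?m3 = "gof d3 (a3 - d3)"
  let ?gA = "gA r r m0 ?m1 ?m2 ?m3"
  define d where "d = sd d1 (sd d2 d3)"
  define a where "a = sd a1 (sd a2 a3)"
  define K where "K = eps r a2 a3 * eps r a1 a2 * eps r a1 a3"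
  define K' where "K' = eps r a1 a3 * eps r a2 a1 * eps r a2 a3"
  define T where "T x \<longleftrightarrow> m0 = gof d (sd a x - d)" for x
  define g where "g x = gof (sd d2 d3) (sd (sd a2 x) a3 - sd d2 d3)" for x
  define g' where "g' x = gof (sd d1 d3) (sd (sd a1 x) a3 - sd d1 d3)" for x
  define b where "b m = gB r r m0 ?m1 ?m2 ?m3 m m'" for m
  define p where "p = d1 \<inter> d2 \<inter> d3"
  define q12 where "q12 = d1 \<inter> d2 - d3"
  define q13 where "q13 = d1 \<inter> d3 - d2"
  define q23 where "q23 = d2 \<inter> d3 - d1"
  note q_defs = p_def q12_def q13_def q23_def
  have d: "d \<in> D" unfolding d_def by (intro D_sd d1 d2 d3)
  have a: "a \<in> C" unfolding a_def by (intro C_sd a1 a2 a3)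
  have d': "sd d2 (sd d1 d3) = d" and a': "sd a2 (sd a1 a3) = a"
    unfolding d_def a_def by (simp_all only: sd_left_commute)
  \<comment> \<open>Exchanging a1 and a2 in the cocycle factors costs
    \<open>sg r (a1 \<inter> a2)\<close>, the factor carried by \<open>FA4_scalar\<close>.\<close>
  have KK: "K' * (sg r (a1 \<inter> a2) * c) = K * c" for c
    unfolding K_def K'_def eps_comm [OF a1 a2] by (simp only: mult_ac)
  have fin: "finite ?gA" by (rule finite_subset [OF _ finite_grades [of r r]]) (auto simp: gA_def)
  have diag: "p \<in> P {..<2 * r}" "q12 \<in> P {..<2 * r}" "q13 \<in> P {..<2 * r}" "q23 \<in> P {..<2 * r}"
    using D_P [OF d1] D_P [OF d2] D_P [OF d3] unfolding P_char q_defs by auto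
  \<comment> \<open>Three ones add up to one modulo 2, so the triple overlap lies in the total d and
    its words fix t_d.\<close>
  have pd: "p \<subseteq> d" unfolding q_defs d_def by auto
  have s13: "d1 \<inter> d3 = q13 \<union> p" "q13 \<inter> p = {}" and s2: "d2 \<inter> sd d1 d3 = q12 \<union> q23" "q12 \<inter> q23 = {}"
    and s23: "d2 \<inter> d3 = q23 \<union> p" "q23 \<inter> p = {}" and s1: "d1 \<inter> sd d2 d3 = q13 \<union> q12" "q13 \<inter> q12 = {}"
    unfolding q_defs by auto
  have absorb: "T (sd x w) \<longleftrightarrow> T x" "Ff d a (sd x w) = Ff d a x"
    if x: "x \<in> P {..<2 * r}" and w: "w \<in> P p" for x w
  proof -
    have wd: "w \<in> P d" using w pd unfolding P_char by blast
    show "T (sd x w) \<longleftrightarrow> T x" unfolding T_def gof_absorb [OF P_sub [OF wd]] ..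
    show "Ff d a (sd x w) = Ff d a x" by (rule Ff_absorb [OF d a x wd])
  qed
  \<comment> \<open>A term of grade \<open>m0\<close> has an intermediate grade \<open>g x\<close>
    inside the index set, so the sum over m merely removes the condition
    \<open>m = g x\<close>.\<close>
  have gA: "g x \<in> ?gA" if x: "x \<in> P (d2 \<inter> d3)" and y: "y \<in> P (d1 \<inter> sd d2 d3)" and t: "T (sd x y)" for x y
  proof -
    have e: "sd d2 d3 \<in> D" by (intro D_sd d2 d3)
    have c: "sd (sd a2 x) a3 \<in> C" by (intro C_sd a2 a3 P_C [OF x])
    have "sd a (sd x y) = sd (sd a1 y) (sd (sd a2 x) a3)" unfolding a_def by (simp only: sd_ac)
    then have "m0 \<in> gfusion r r ?m1 (g x)"
      using gof_fusion [OF d1 a1 e c y] t unfolding T_def g_def d_def by simp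
    moreover have "g x \<in> gfusion r r ?m2 ?m3"
      unfolding g_def by (rule gof_fusion [OF d2 a2 d3 a3 x])
    ultimately show ?thesis by (simp add: gA_def gfusion_def Aset_def)
  qed
  have "(\<Sum>m\<in>?gA. sc (b m) (L (pr m0 (prodV r G (delta d1 a1) (pr m (prodV r G (delta d2 a2) (delta d3 a3))))))) =
      (\<Sum>m\<in>?gA. \<Sum>x\<in>P (d2 \<inter> d3). \<Sum>y\<in>P (d1 \<inter> sd d2 d3).
        if m = g x then if T (sd x y) then sc (K * (b (g x) * tr r d1 a1 d2 a2 d3 a3 x y)) (Ff d a (sd x y)) else 0 else 0)"
    unfolding L_triple [OF d1 a1 d2 a2 d3 a3] sc_sum K_def [symmetric] d_def [symmetric] a_def [symmetric]
      g_def [symmetric] T_def [symmetric]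
    by (intro sum.cong refl) (simp add: mult_ac)
  also have "\<dots> = (\<Sum>x\<in>P (d2 \<inter> d3). \<Sum>m\<in>?gA. \<Sum>y\<in>P (d1 \<inter> sd d2 d3).
        if m = g x then if T (sd x y) then sc (K * (b (g x) * tr r d1 a1 d2 a2 d3 a3 x y)) (Ff d a (sd x y)) else 0 else 0)"
    by (rule sum.swap)
  also have "\<dots> = (\<Sum>x\<in>P (d2 \<inter> d3). \<Sum>y\<in>P (d1 \<inter> sd d2 d3). \<Sum>m\<in>?gA.
        if m = g x then if T (sd x y) then sc (K * (b (g x) * tr r d1 a1 d2 a2 d3 a3 x y)) (Ff d a (sd x y)) else 0 else 0)"
    by (rule sum.cong [OF refl], rule sum.swap)
  also have "\<dots> = (\<Sum>x\<in>P (d2 \<inter> d3). \<Sum>y\<in>P (d1 \<inter> sd d2 d3).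
        if T (sd x y) then sc (K * (b (g x) * tr r d1 a1 d2 a2 d3 a3 x y)) (Ff d a (sd x y)) else 0)"
    by (intro sum.cong refl) (use fin gA in simp)
  also have "\<dots> = (\<Sum>z\<in>P q23. \<Sum>n\<in>P p. \<Sum>x\<in>P q13. \<Sum>y\<in>P q12.
        if T (sd (sd z n) (sd x y)) then sc (K * (b (g (sd z n)) * tr r d1 a1 d2 a2 d3 a3 (sd z n) (sd x y)))
          (Ff d a (sd (sd z n) (sd x y))) else 0)"
    unfolding sum_P_split [OF diag(4,1) s23(2,1)] sum_P_split [OF diag(3,2) s1(2,1)] ..
  also have "\<dots> = (\<Sum>x\<in>P q13. \<Sum>y\<in>P q12. \<Sum>z\<in>P q23. \<Sum>n\<in>P p.
        if T (sd (sd z n) (sd x y)) then sc (K * (b (g (sd z n)) * tr r d1 a1 d2 a2 d3 a3 (sd z n) (sd x y)))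
          (Ff d a (sd (sd z n) (sd x y))) else 0)"
    by (rule sum_rotate4)
  finally have R: "(\<Sum>m\<in>?gA. sc (b m) (L (pr m0 (prodV r G (delta d1 a1) (pr m (prodV r G (delta d2 a2) (delta d3 a3))))))) = \<dots>" .
  have "L (pr m0 (prodV r G (delta d2 a2) (pr m' (prodV r G (delta d1 a1) (delta d3 a3))))) =
      (\<Sum>x\<in>P (d1 \<inter> d3). \<Sum>y\<in>P (d2 \<inter> sd d1 d3).
        sc (K' * tr r d2 a2 d1 a1 d3 a3 x y) (if m' = g' x \<and> T (sd x y) then Ff d a (sd x y) else 0))"
    unfolding L_triple [OF d2 a2 d1 a1 d3 a3] K'_def d' a' g'_def T_def ..
  also have "\<dots> = (\<Sum>x\<in>P q13. \<Sum>w\<in>P p. \<Sum>y\<in>P q12. \<Sum>z\<in>P q23.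
        sc (K' * tr r d2 a2 d1 a1 d3 a3 (sd x w) (sd y z))
          (if m' = g' (sd x w) \<and> T (sd (sd x w) (sd y z)) then Ff d a (sd (sd x w) (sd y z)) else 0))"
    unfolding sum_P_split [OF diag(3,1) s13(2,1)] sum_P_split [OF diag(2,4) s2(2,1)] ..
  also have "\<dots> = (\<Sum>x\<in>P q13. \<Sum>y\<in>P q12. \<Sum>w\<in>P p. \<Sum>z\<in>P q23.
        sc (K' * tr r d2 a2 d1 a1 d3 a3 (sd x w) (sd y z))
          (if m' = g' (sd x w) \<and> T (sd (sd x w) (sd y z)) then Ff d a (sd (sd x w) (sd y z)) else 0))"
    by (rule sum.cong [OF refl], rule sum.swap)
  also have "\<dots> = (\<Sum>x\<in>P q13. \<Sum>y\<in>P q12. \<Sum>z\<in>P q23. \<Sum>w\<in>P p.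
        sc (K' * tr r d2 a2 d1 a1 d3 a3 (sd x w) (sd y z))
          (if m' = g' (sd x w) \<and> T (sd (sd x w) (sd y z)) then Ff d a (sd (sd x w) (sd y z)) else 0))"
    by (rule sum.cong [OF refl], rule sum.cong [OF refl], rule sum.swap)
  also have "\<dots> = (\<Sum>x\<in>P q13. \<Sum>y\<in>P q12. \<Sum>z\<in>P q23. \<Sum>n\<in>P p.
        if T (sd (sd z n) (sd x y)) then sc (K * (b (g (sd z n)) * tr r d1 a1 d2 a2 d3 a3 (sd z n) (sd x y)))
          (Ff d a (sd (sd z n) (sd x y))) else 0)"
  proof (rule sum.cong [OF refl], rule sum.cong [OF refl], rule sum.cong [OF refl])
    fix x y z assume x: "x \<in> P q13" and y: "y \<in> P q12" and z: "z \<in> P q23"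
    let ?x = "sd x (sd y z)"
    have xP: "?x \<in> P {..<2 * r}" by (intro P_sd P_lim [OF x] P_lim [OF y] P_lim [OF z])
    have scs: "(\<Sum>w\<in>A. sc (f w) v) = sc (\<Sum>w\<in>A. f w) v" for A v and f :: "nat set \<Rightarrow> complex"
      by (rule ext) (simp add: sum_fun_apply sum_distrib_right)
    have e1: "sd (sd x w) (sd y z) = sd ?x w" for w by (simp only: sd_ac)
    have e2: "sd (sd z w) (sd x y) = sd ?x w" for w by (simp only: sd_ac)
    have "(\<Sum>w\<in>P p. sc (K' * tr r d2 a2 d1 a1 d3 a3 (sd x w) (sd y z))
          (if m' = g' (sd x w) \<and> T (sd (sd x w) (sd y z)) then Ff d a (sd (sd x w) (sd y z)) else 0)) =
        (\<Sum>w\<in>P p. sc (if T ?x then K' * (if m' = g' (sd x w) then tr r d2 a2 d1 a1 d3 a3 (sd x w) (sd y z) else 0) else 0)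
          (Ff d a ?x))"
      by (rule sum.cong [OF refl]) (simp add: e1 absorb [OF xP])
    also have "\<dots> = sc (if T ?x then K' * (\<Sum>w\<in>P p. if m' = g' (sd x w) then tr r d2 a2 d1 a1 d3 a3 (sd x w) (sd y z) else 0) else 0)
          (Ff d a ?x)"
      unfolding scs by (cases "T ?x") (simp_all add: sum_distrib_left)
    also have "\<dots> = sc (if T ?x then K * (\<Sum>n\<in>P p. b (g (sd z n)) * tr r d1 a1 d2 a2 d3 a3 (sd z n) (sd x y)) else 0)
          (Ff d a ?x)"
    \<comment> \<open>If \<open>T ?x\<close> fails, the projection to \<open>m0\<close> kills the
      term on both sides; if it holds, it is the hypothesis on \<open>m0\<close> in
      \<open>FA4_scalar\<close>.\<close>
    proof (cases "T ?x")
      case True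
      then have "m0 = gof (sd d1 (sd d2 d3)) (sd (sd a1 (sd a2 a3)) (sd x (sd y z)) - sd d1 (sd d2 d3))"
        by (simp add: T_def d_def a_def)
      from FA4_scalar [OF d1 a1 d2 a2 d3 a3 x [unfolded q13_def] y [unfolded q12_def] z [unfolded q23_def] this m']
      have "(\<Sum>w\<in>P p. if m' = g' (sd x w) then tr r d2 a2 d1 a1 d3 a3 (sd x w) (sd y z) else 0) =
        sg r (a1 \<inter> a2) * (\<Sum>n\<in>P p. b (g (sd z n)) * tr r d1 a1 d2 a2 d3 a3 (sd z n) (sd x y))"
        unfolding p_def g'_def g_def b_def .
      then show ?thesis by (simp only: KK)
    qed simp
    also have "\<dots> = (\<Sum>n\<in>P p. sc (if T ?x then K * (b (g (sd z n)) * tr r d1 a1 d2 a2 d3 a3 (sd z n) (sd x y)) else 0)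
          (Ff d a ?x))"
      unfolding scs by (cases "T ?x") (simp_all add: sum_distrib_left)
    also have "\<dots> = (\<Sum>n\<in>P p. if T (sd (sd z n) (sd x y))
        then sc (K * (b (g (sd z n)) * tr r d1 a1 d2 a2 d3 a3 (sd z n) (sd x y))) (Ff d a (sd (sd z n) (sd x y))) else 0)"
      by (rule sum.cong [OF refl]) (simp add: e2 absorb [OF xP])
    finally show "(\<Sum>w\<in>P p. sc (K' * tr r d2 a2 d1 a1 d3 a3 (sd x w) (sd y z))
          (if m' = g' (sd x w) \<and> T (sd (sd x w) (sd y z)) then Ff d a (sd (sd x w) (sd y z)) else 0)) = \<dots>" .
  qed
  also note R [symmetric]
  finally show ?thesis unfolding b_def .
qed

section \<open>Extension to homogeneous vectors and collection of the axioms\<close>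

definition triple :: "grade \<Rightarrow> grade \<Rightarrow> vec \<Rightarrow> vec \<Rightarrow> vec \<Rightarrow> vec" where
  "triple m0 m u v w = L (pr m0 (prodV r G u (pr m (prodV r G v w))))"

lemma vlin_triple:
  "vlin (\<lambda>u. triple m0 m u v w)" "vlin (\<lambda>v. triple m0 m u v w)" "vlin (\<lambda>w. triple m0 m u v w)"
  unfolding triple_def
  by (rule vlin_comp [OF vlin_L vlin_comp [OF vlin_pr vlin_prod_left]],
      rule vlin_comp [OF vlin_L vlin_comp [OF vlin_pr vlin_comp [OF vlin_prod_right vlin_comp [OF vlin_pr vlin_prod_left]]]],
      rule vlin_comp [OF vlin_L vlin_comp [OF vlin_pr vlin_comp [OF vlin_prod_right vlin_comp [OF vlin_pr vlin_prod_right]]]])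

text \<open>Trilinear extension. Homogeneity forces every basis vector with nonzero coefficient to
  have the grade m1, m2 or m3, so the braiding coefficients are the same in all terms.\<close>

lemma FA4_vec:
  assumes u: "u \<in> V" "pr m1 u = u" and v: "v \<in> V" "pr m2 v = v" and w: "w \<in> V" "pr m3 w = w"
    and m': "m' \<in> gA r r m0 m2 m1 m3"
  shows "triple m0 m' v u w = (\<Sum>m\<in>gA r r m0 m1 m2 m3. sc (gB r r m0 m1 m2 m3 m m') (triple m0 m u v w))"
proof -
  have supp: "m = gof d (a - d)" if "pr m t = t" "t (d, a) \<noteq> 0" for m t d a
    using fun_cong [OF that(1), of "(d, a)"] that(2) by (auto simp: pr_apply split: if_splits)
  show ?thesis
  proof (rule vlin_ext [OF vlin_triple(2) vlin_sum_fun [OF vlin_triple(1)] u(1)])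
    fix d1 a1 assume 1: "d1 \<in> D" "a1 \<in> C" "u (d1, a1) \<noteq> 0"
    show "triple m0 m' v (delta d1 a1) w =
        (\<Sum>m\<in>gA r r m0 m1 m2 m3. sc (gB r r m0 m1 m2 m3 m m') (triple m0 m (delta d1 a1) v w))"
    proof (rule vlin_ext [OF vlin_triple(1) vlin_sum_fun [OF vlin_triple(2)] v(1)])
      fix d2 a2 assume 2: "d2 \<in> D" "a2 \<in> C" "v (d2, a2) \<noteq> 0"
      show "triple m0 m' (delta d2 a2) (delta d1 a1) w =
          (\<Sum>m\<in>gA r r m0 m1 m2 m3. sc (gB r r m0 m1 m2 m3 m m') (triple m0 m (delta d1 a1) (delta d2 a2) w))"
      proof (rule vlin_ext [OF vlin_triple(3) vlin_sum_fun [OF vlin_triple(3)] w(1)])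
        fix d3 a3 assume 3: "d3 \<in> D" "a3 \<in> C" "w (d3, a3) \<noteq> 0"
        have m: "m1 = gof d1 (a1 - d1)" "m2 = gof d2 (a2 - d2)" "m3 = gof d3 (a3 - d3)"
          using supp u(2) v(2) w(2) 1(3) 2(3) 3(3) by blast+
        show "triple m0 m' (delta d2 a2) (delta d1 a1) (delta d3 a3) =
          (\<Sum>m\<in>gA r r m0 m1 m2 m3. sc (gB r r m0 m1 m2 m3 m m')
            (triple m0 m (delta d1 a1) (delta d2 a2) (delta d3 a3)))"
          using FA4_delta [OF 1(1,2) 2(1,2) 3(1,2), of m' m0] m' unfolding m triple_def by blast
      qed
    qed
  qed
qed

lemma FA4_S:
  assumes m0: "m0 \<in> grades r r" and x1: "x1 \<in> piece S m1" and x2: "x2 \<in> piece S m2" and x3: "x3 \<in> piece S m3"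
    and m': "m' \<in> gA r r m0 m2 m1 m3"
  shows "compo S r r m0 (mult S x2 (compo S r r m' (mult S x1 x3))) =
    vsum S (\<lambda>m. vscale S (gB r r m0 m1 m2 m3 m m')
      (compo S r r m0 (mult S x1 (compo S r r m (mult S x2 x3))))) (gA r r m0 m1 m2 m3)"
proof -
  obtain u where u: "u \<in> V" "pr m1 u = u" "x1 = cs u" using x1 by (auto simp: piece_S)
  obtain v where v: "v \<in> V" "pr m2 v = v" "x2 = cs v" using x2 by (auto simp: piece_S)
  obtain w where w: "w \<in> V" "pr m3 w = w" "x3 = cs w" using x3 by (auto simp: piece_S)
  have gr: "m \<in> grades r r" if "m \<in> gA r r m0 n1 n2 n3" for m n1 n2 n3
    using that by (simp add: gA_def)
  have comp: "compo S r r m0 (mult S (cs s) (compo S r r m (mult S (cs t) (cs w)))) =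
      cs (pr m0 (prodV r G s (pr m (prodV r G t w))))" if "s \<in> V" "t \<in> V" "m \<in> grades r r" for s t m
    using that w(1) m0 by (simp add: mult_S compo_S V_prod V_pr)
  have "finite (gA r r m0 m1 m2 m3)"
    by (rule finite_subset [OF _ finite_grades [of r r]]) (auto simp: gA_def)
  then have "vsum S (\<lambda>m. vscale S (gB r r m0 m1 m2 m3 m m')
      (compo S r r m0 (mult S x1 (compo S r r m (mult S x2 x3))))) (gA r r m0 m1 m2 m3) =
    cs (\<Sum>m\<in>gA r r m0 m1 m2 m3. sc (gB r r m0 m1 m2 m3 m m') (pr m0 (prodV r G u (pr m (prodV r G v w)))))"
  proof (rule vsum_S)
    fix m assume "m \<in> gA r r m0 m1 m2 m3"
    then show "vscale S (gB r r m0 m1 m2 m3 m m') (compo S r r m0 (mult S x1 (compo S r r m (mult S x2 x3)))) =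
        cs (sc (gB r r m0 m1 m2 m3 m m') (pr m0 (prodV r G u (pr m (prodV r G v w)))))"
      unfolding u(3) v(3) w(3) by (simp add: comp [OF u(1) v(1) gr] vscale_S)
  qed
  also have "\<dots> = cs (pr m0 (prodV r G v (pr m' (prodV r G u w))))"
    unfolding coset_cong vlin_sum [OF vlin_L] vlin_sc [OF vlin_L]
    using FA4_vec [OF u(1,2) v(1,2) w(1,2) m'] unfolding triple_def by simp
  also have "\<dots> = compo S r r m0 (mult S x2 (compo S r r m' (mult S x1 x3)))"
    unfolding u(3) v(3) w(3) by (simp add: comp [OF v(1) u(1) gr [OF m']])
  finally show ?thesis by simp
qed

lemma framed_algebra_S: "framed_algebra r r S"
  unfolding framed_algebra_def
proof (intro conjI ballI impI)
  show "cvector_space S" by (rule cvector_space_S)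
  show "fin_dim S" by (rule fin_dim_S)
  show "graded S r r" by (rule graded_S)
  show "bilinear_mult S" by (rule bilinear_S)
  show "piece S m = {vzero S}" if "sval r r m \<notin> \<int>" for m
    using piece_nontrivial [of m] sval_gof that by blast
  show "unit S \<in> carrier S" by (simp add: unit_S cs_in_carrier V_delta)
  show "unit S \<noteq> vzero S" by (simp add: unit_S cs_eq_zero L_delta_nz)
  show "piece S zgrade = range (\<lambda>c. vscale S c (unit S))" by (rule piece_zgrade)
  show "mult S (unit S) a = a" "mult S a (unit S) = a" if "a \<in> carrier S" for a
    using that by (auto simp: carrier_S unit_S mult_S V_delta unit_mult)
  show "compo S r r m (mult S a b) = vzero S"
    if a: "a \<in> piece S m1" and b: "b \<in> piece S m2" and m: "m \<in> grades r r" "m \<notin> gfusion r r m1 m2" for a b m m1 m2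
  proof -
    obtain u where u: "u \<in> V" "pr m1 u = u" "a = cs u" using a by (auto simp: piece_S)
    obtain v where v: "v \<in> V" "pr m2 v = v" "b = cs v" using b by (auto simp: piece_S)
    have "compo S r r m (mult S a b) = cs (pr m (prodV r G u v))"
      unfolding u(3) v(3) using u(1) v(1) m(1) by (simp add: mult_S compo_S V_prod)
    then show ?thesis unfolding pr_prod_fusion [OF u(1,2) v(1,2) m(2)] vzero_S .
  qed
  show "compo S r r m0 (mult S a2 (compo S r r m' (mult S a1 a3))) =
      vsum S (\<lambda>m. vscale S (gB r r m0 m1 m2 m3 m m')
        (compo S r r m0 (mult S a1 (compo S r r m (mult S a2 a3))))) (gA r r m0 m1 m2 m3)"
    if "m0 \<in> grades r r" "a1 \<in> piece S m1" "a2 \<in> piece S m2" "a3 \<in> piece S m3"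
      "m' \<in> gA r r m0 m2 m1 m3" for m0 m1 m2 m3 a1 a2 a3 m'
    using that by (rule FA4_S)
qed

end

theorem theorem2:
  fixes r :: nat and G :: "nat set set"
  assumes "r \<ge> 1"
    and "is_subgroup r G"
    and "{..<r} \<in> G"
  shows "framed_algebra r r (SG r G) \<and> simple r r (SG r G) \<and>
         Dcode r r (SG r G) = DG r G \<and>
         Ccode r r (SG r G) = perp r r (DG r G)"
proof -
  interpret code_setup r G using assms by unfold_locales
  show ?thesis using framed_algebra_S simple_S Dcode_S Ccode_S by blast
qed

end
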